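(* Let $\widetilde{\nu}\in\Omega$ be a non-degenerate point of the optimization problem $$\alpha_\epsilon(\nu)=\max\{s_1 \mid s=(s_1,s_2)\in\mathbb{R}^2,\ \sigma(\nu,s)-\epsilon\,p_w(\|s\|)\le 0\}$$ (as defined in the context), with unique optimizer $s(\widetilde\nu)=(s_1(\widetilde\nu),s_2(\widetilde\nu))$ at $\nu=\widetilde\nu$. Moreover, suppose that $p_w(\|s(\widetilde{\nu})\|)\neq 0$ and $g_s(s(\widetilde{\nu});\widetilde{\nu})\neq 0$. Then the function $\nu\mapsto\alpha_\epsilon(\nu)$ is real analytic at $\widetilde{\nu}$ with the first derivatives given by $$\frac{\partial\alpha_\epsilon}{\partial\nu_j}(\widetilde{\nu})=-\mu(\widetilde{\nu})\,\mathrm{Re}\left\{u^* P_{\nu_j}(\widetilde{\nu},s(\widetilde{\nu}))\,v\right\},\qquad j=1,\dots,d,$$ where $P_{\nu_j}$ denotes the partial derivative of $P(\nu,s)$ with respect to $\nu_j$, $$\mu(\widetilde{\nu}):=\frac{1}{\mathrm{Re}\{u^*P'(s(\widetilde{\nu});\widetilde{\nu})v\}-\epsilon\,\{s_1(\widetilde{\nu})/\|s(\widetilde{\nu})\|\}\,p_w'(\|s(\widetilde{\nu})\|)},$$ and $u,v$ are consistent unit left, right singular vectors, respectively, of $P(\widetilde{\nu},s(\widetilde{\nu}))$ corresponding to its smallest singular value $\sigma(\widetilde{\nu},s(\widetilde{\nu}))$.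
   Context: Setting. Let $\Omega\subseteq\mathbb{R}^d$ be open, $\underline{\Omega}\subseteq\Omega$ compact, $\epsilon>0$, and let $w=(w_m,w_c,w_k)$ be nonnegative real weights. Consider the parameter-dependent quadratic matrix polynomial $P(\lambda;\nu)=\lambda^2M(\nu)+\lambda C(\nu)+K(\nu)$, $\nu\in\Omega$, where $M(\nu)=\sum_i\psi_i(\nu)M_i$, $C(\nu)=\sum_j\zeta_j(\nu)C_j$, $K(\nu)=\sum_\ell\kappa_\ell(\nu)K_\ell$ are finite sums with given matrices $M_i,C_j,K_\ell\in\mathbb{C}^{n\times n}$ and real-analytic functions $\psi_i,\zeta_j,\kappa_\ell:\Omega\to\mathbb{R}$. Pseudospectrum. Let $p_w(z):=\sqrt{w_m^2z^4+w_c^2z^2+w_k^2}$, let $p_w'$ be its ordinary derivative, and let $\sigma_{\min}(A)$ be the smallest singular value of $A$. The $\epsilon$-pseudospectrum is $\Lambda_\epsilon(P(\cdot;\nu))=\{\lambda\in\mathbb{C}\mid\sigma_{\min}(P(\lambda;\nu))\le\epsilon\,p_w(|\lambda|)\}$, and the $\epsilon$-pseudospectral abscissa is $\alpha_\epsilon(\nu):=\sup\{\mathrm{Re}(z)\mid z\in\Lambda_\epsilon(P(\cdot;\nu))\}$. Standing assumption: $\Lambda_\epsilon(P(\cdot;\nu))$ is bounded for all $\nu\in\underline{\Omega}$ (so that the supremum is attained there). Notation. For $s=(s_1,s_2)\in\mathbb{R}^2$ put $P(\nu,s):=P(s_1+\mathrm{i}s_2;\nu)$, $\sigma(\nu,s):=\sigma_{\min}(P(\nu,s))$,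 $\|s\|:=\sqrt{s_1^2+s_2^2}$, and $P'(s;\nu):=2(s_1+\mathrm{i}s_2)M(\nu)+C(\nu)$. Let $g(s;\nu):=\sigma(\nu,s)-\epsilon\,p_w(\|s\|)$, with $g_s$ its gradient with respect to $s$. The Lagrangian is $\mathcal{L}(\nu,s,\mu):=s_1-\mu\{\sigma(\nu,s)-\epsilon\,p_w(\|s\|)\}$, written $\mathcal{L}(\nu,y)$ with $y=(s,\mu)\in\mathbb{R}^3$; $\mathcal{L}_y$ and $\mathcal{L}_{yy}$ denote its gradient and Hessian with respect to $y$. When the maximization problem has a unique optimizer $s(\nu)$, $\sigma(\nu,s(\nu))$ is a simple singular value, and a constraint qualification holds (e.g. $g_s(s(\nu);\nu)\ne0$), $\mu(\nu)$ denotes the unique multiplier with $\mathcal{L}_y(\nu,s(\nu),\mu(\nu))=0$, and $y(\nu):=(s(\nu),\mu(\nu))$. Non-degenerate point. A point $\nu\in\Omega$ is non-degenerate if (1) there is a unique optimizer $s(\nu)=(s_1(\nu),s_2(\nu))$ of the maximization problem defining $\alpha_\epsilon(\nu)$; (2) the singular value $\sigma(\nu,s(\nu))$ of $P(\nu,s(\nu))$ is simple; and (3) the Hessian $\mathcal{L}_{yy}(\nu,y(\nu))$ is invertible. Consistent unit left and right singular vectors $u,v$ of a matrix $A$ for the singular value $\sigma$ are unit vectors with $Av=\sigma u$ and $u^*A=\sigma v^*$.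
   Formalization: The boundedness assumption is also required at ν̃ itself and, when w_m = 0, the ε-pseudospectra are assumed uniformly bounded for ν near ν̃; with only pointwise boundedness on the compact subset the claim fails (n=1, M=ν, C=K=1, w=(0,0,1), ε=1/2, ν̃=0). *)

theory Defs
  imports "HOL-Analysis.Analysis"
begin

text \<open>Multi-indices are functions \<open>k :: 'd \<Rightarrow> nat\<close>; \<open>has_sum\<close> is unordered (hence absolute)
  convergence over all of them.\<close>

definition real_analytic_at :: "(real^'d \<Rightarrow> real) \<Rightarrow> real^'d \<Rightarrow> bool" where
  "real_analytic_at f a \<longleftrightarrow>
     (\<exists>(c :: ('d \<Rightarrow> nat) \<Rightarrow> real) r. r > 0 \<and>
        (\<forall>x\<in>ball a r. ((\<lambda>k. c k * (\<Prod>i\<in>UNIV. (x $ i - a $ i) ^ k i)) has_sum f x) UNIV))"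

definition real_analytic_on :: "(real^'d \<Rightarrow> real) \<Rightarrow> (real^'d) set \<Rightarrow> bool" where
  "real_analytic_on f S \<longleftrightarrow> (\<forall>a\<in>S. real_analytic_at f a)"

definition partial_derivative :: "'d \<Rightarrow> (real^'d \<Rightarrow> 'b::real_normed_vector) \<Rightarrow> real^'d \<Rightarrow> 'b" where
  "partial_derivative j F x = vector_derivative (\<lambda>t. F (x + t *\<^sub>R axis j 1)) (at 0)"

definition gradient :: "('a::real_inner \<Rightarrow> real) \<Rightarrow> 'a \<Rightarrow> 'a" where
  "gradient f x = (THE D. GDERIV f x :> D)"

definition hessian :: "(real^'k \<Rightarrow> real) \<Rightarrow> real^'k \<Rightarrow> real^'k^'k" where
  "hessian f x = jacobian (gradient f) (at x)"

definition cadjoint :: "complex^'n^'m \<Rightarrow> complex^'m^'n" where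
  "cadjoint A = map_matrix cnj (transpose A)"

definition cnj_vec :: "complex^'n \<Rightarrow> complex^'n" where
  "cnj_vec u = (\<chi> i. cnj (u $ i))"

definition sesq :: "complex^'n \<Rightarrow> complex^'n^'n \<Rightarrow> complex^'n \<Rightarrow> complex" where
  "sesq u B v = (\<Sum>i\<in>UNIV. cnj (u $ i) * (B *v v) $ i)"

definition singular_space :: "complex^'n^'n \<Rightarrow> real \<Rightarrow> (complex^'n) set" where
  "singular_space A \<sigma> = {x. (cadjoint A ** A) *v x = (\<sigma>\<^sup>2) *\<^sub>R x}"

definition singular_values :: "complex^'n^'n \<Rightarrow> real set" where
  "singular_values A = {\<sigma>. \<sigma> \<ge> 0 \<and> (\<exists>x\<in>singular_space A \<sigma>. x \<noteq> 0)}"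

definition sigma_min :: "complex^'n^'n \<Rightarrow> real" where
  "sigma_min A = (LEAST \<sigma>. \<sigma> \<in> singular_values A)"

text \<open>Since \<open>A\<^sup>* A\<close> is Hermitian, the multiplicity of a singular value is the complex dimension
  (\<open>vec.dim\<close> refers to scalar multiplication \<open>*s\<close> over \<open>complex\<close>) of its eigenspace.\<close>

definition simple_singular_value :: "complex^'n^'n \<Rightarrow> real \<Rightarrow> bool" where
  "simple_singular_value A \<sigma> \<longleftrightarrow> \<sigma> \<in> singular_values A \<and> vec.dim (singular_space A \<sigma>) = 1"

definition consistent_singular_vectors ::
  "complex^'n^'n \<Rightarrow> real \<Rightarrow> complex^'n \<Rightarrow> complex^'n \<Rightarrow> bool" where
  "consistent_singular_vectors A \<sigma> u v \<longleftrightarrow>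
     norm u = 1 \<and> norm v = 1 \<and> A *v v = \<sigma> *\<^sub>R u \<and> cnj_vec u v* A = \<sigma> *\<^sub>R cnj_vec v"

definition cscale :: "complex \<Rightarrow> complex^'n^'m \<Rightarrow> complex^'n^'m" where
  "cscale c A = map_matrix (\<lambda>a. c * a) A"

definition quad_poly ::
  "complex^'n^'n \<Rightarrow> complex^'n^'n \<Rightarrow> complex^'n^'n \<Rightarrow> complex \<Rightarrow> complex^'n^'n" where
  "quad_poly M C K z = cscale (z\<^sup>2) M + cscale z C + K"

definition quad_poly' :: "complex^'n^'n \<Rightarrow> complex^'n^'n \<Rightarrow> complex \<Rightarrow> complex^'n^'n" where
  "quad_poly' M C z = cscale (2 * z) M + C"

text \<open>The weights are passed as the triple \<open>w = (w\<^sub>m, w\<^sub>c, w\<^sub>k)\<close>.\<close>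

fun p_w :: "real \<times> real \<times> real \<Rightarrow> real \<Rightarrow> real" where
  "p_w (wm, wc, wk) z = sqrt (wm\<^sup>2 * z ^ 4 + wc\<^sup>2 * z\<^sup>2 + wk\<^sup>2)"

text \<open>In the following, \<open>A\<close> is the matrix function \<open>P(\<cdot>; \<nu>)\<close> for a fixed parameter \<open>\<nu>\<close>.\<close>

definition pseudospectrum ::
  "real \<times> real \<times> real \<Rightarrow> real \<Rightarrow> (complex \<Rightarrow> complex^'n^'n) \<Rightarrow> complex set" where
  "pseudospectrum w \<epsilon> A = {z. sigma_min (A z) \<le> \<epsilon> * p_w w (cmod z)}"

definition pseudospectral_abscissa ::
  "real \<times> real \<times> real \<Rightarrow> real \<Rightarrow> (complex \<Rightarrow> complex^'n^'n) \<Rightarrow> real" where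
  "pseudospectral_abscissa w \<epsilon> A = (SUP z\<in>pseudospectrum w \<epsilon> A. Re z)"

definition cplx :: "real^2 \<Rightarrow> complex" where
  "cplx s = Complex (s $ 1) (s $ 2)"

definition constraint ::
  "real \<times> real \<times> real \<Rightarrow> real \<Rightarrow> (complex \<Rightarrow> complex^'n^'n) \<Rightarrow> real^2 \<Rightarrow> real" where
  "constraint w \<epsilon> A s = sigma_min (A (cplx s)) - \<epsilon> * p_w w (norm s)"

text \<open>The argument \<open>y = (s\<^sub>1, s\<^sub>2, \<mu>)\<close> of the Lagrangian is a vector in \<open>\<real>\<^sup>3\<close>.\<close>

definition lagrangian ::
  "real \<times> real \<times> real \<Rightarrow> real \<Rightarrow> (complex \<Rightarrow> complex^'n^'n) \<Rightarrow> real^3 \<Rightarrow> real" where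
  "lagrangian w \<epsilon> A y = y $ 1 - y $ 3 * constraint w \<epsilon> A (vector [y $ 1, y $ 2])"

definition is_optimizer ::
  "real \<times> real \<times> real \<Rightarrow> real \<Rightarrow> (complex \<Rightarrow> complex^'n^'n) \<Rightarrow> real^2 \<Rightarrow> bool" where
  "is_optimizer w \<epsilon> A s \<longleftrightarrow>
     constraint w \<epsilon> A s \<le> 0 \<and> (\<forall>t. constraint w \<epsilon> A t \<le> 0 \<longrightarrow> t $ 1 \<le> s $ 1)"

definition optimizer ::
  "real \<times> real \<times> real \<Rightarrow> real \<Rightarrow> (complex \<Rightarrow> complex^'n^'n) \<Rightarrow> real^2" where
  "optimizer w \<epsilon> A = (THE s. is_optimizer w \<epsilon> A s)"

definition kkt_point ::
  "real \<times> real \<times> real \<Rightarrow> real \<Rightarrow> (complex \<Rightarrow> complex^'n^'n) \<Rightarrow> real \<Rightarrow> real^3" where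
  "kkt_point w \<epsilon> A \<mu> = vector [optimizer w \<epsilon> A $ 1, optimizer w \<epsilon> A $ 2, \<mu>]"

text \<open>If \<open>sigma_min\<close> is a simple positive singular value at the unique optimizer (so that the
  constraint is smooth there) and the gradient of the constraint does not vanish, then the
  definite descriptions and derivatives used here and in \<open>hessian\<close> denote.\<close>

definition multiplier ::
  "real \<times> real \<times> real \<Rightarrow> real \<Rightarrow> (complex \<Rightarrow> complex^'n^'n) \<Rightarrow> real" where
  "multiplier w \<epsilon> A = (THE \<mu>. gradient (lagrangian w \<epsilon> A) (kkt_point w \<epsilon> A \<mu>) = 0)"

definition non_degenerate ::
  "real \<times> real \<times> real \<Rightarrow> real \<Rightarrow> (complex \<Rightarrow> complex^'n^'n) \<Rightarrow> bool" where
  "non_degenerate w \<epsilon> A \<longleftrightarrow>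
     (\<exists>!s. is_optimizer w \<epsilon> A s) \<and>
     simple_singular_value (A (cplx (optimizer w \<epsilon> A))) (sigma_min (A (cplx (optimizer w \<epsilon> A)))) \<and>
     invertible (hessian (lagrangian w \<epsilon> A) (kkt_point w \<epsilon> A (multiplier w \<epsilon> A)))"

end

theory Submission
  imports Defs "HOL-Complex_Analysis.Conformal_Mappings"
begin

text \<open>Near the optimizer the smallest singular value is a simple root of the characteristic
  polynomial of \<open>P\<^sup>* P\<close>, so the constraint \<open>g = 0\<close> becomes \<open>H(\<nu>, s) = 0\<close> with
  \<open>H(\<nu>, s) = det (P\<^sup>* P - \<epsilon>\<^sup>2 p\<^sub>w(\<parallel>s\<parallel>)\<^sup>2 I)\<close>, which is polynomial in \<open>s\<close> with
  coefficients analytic in \<open>\<nu>\<close>. A maximizer of \<open>s\<^sub>1\<close> satisfies \<open>H = 0\<close> and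
  \<open>\<partial>H/\<partial>s\<^sub>2 = 0\<close>; the Jacobian of this \<open>2 \<times> 2\<close> system is triangular, with diagonal entries
  that are nonzero multiples of \<open>\<partial>g/\<partial>s\<^sub>1\<close> and \<open>\<partial>\<^sup>2g/\<partial>s\<^sub>2\<^sup>2\<close>, and the latter is nonzero
  because the Hessian of the Lagrangian is invertible. By the analytic implicit function theorem
  the solution is analytic in \<open>\<nu>\<close>, and by compactness the maximizers for \<open>\<nu>\<close> near \<open>\<nu>0\<close> lie
  close to the optimizer at \<open>\<nu>0\<close>, hence coincide with that solution. The implicit function
  theorem is proved by a contraction in the algebra of power series with finite weighted
  \<open>\<ell>\<^sup>1\<close> norm of the coefficients.\<close>

subsection \<open>Power series with bounded coefficient norm\<close>

text \<open>An implicit function theorem does not apply to g directly: \<open>sigma_min\<close> is a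
  minimum and \<open>p_w\<close> a root. Squares and a determinant remove both and leave functions
  polynomial in the unknowns with analytic coefficients, so that composing power series reduces to
  sums and products. The Hessian hypothesis, however, speaks of derivatives of
  \<open>sigma_min\<close>. The link is \<open>X\<close>, the characteristic equation in a candidate
  singular value \<tau>: at \<open>\<nu>0\<close>, near the optimizer, its zero set is the graph of
  \<open>sigma_min\<close> over s, while \<tau> = \<open>\<epsilon> * p_w w (norm s)\<close> turns
  it into \<open>H\<close>, so derivatives of \<open>H\<close> and of g can be compared. For other
  \<nu> only continuity of \<open>sigma_min\<close> is used: criticality of nearby maximizers is
  read off from the sign of \<open>H\<close>, and differentiability along the optimizer curve comes
  from the active constraint. Compactness requires pseudospectra bounded uniformly near
  \<open>\<nu>0\<close>. For a positive leading weight this follows from boundedness at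
  \<open>\<nu>0\<close>, which amounts to the open condition
  \<open>\<epsilon> * wm < sigma_min M\<close>; for leading weight 0 it is assumed.\<close>

definition monomial :: "('d \<Rightarrow> nat) \<Rightarrow> real^'d \<Rightarrow> real" where
  "monomial k x = (\<Prod>i\<in>UNIV. (x $ i) ^ k i)"

definition mdeg :: "('d::finite \<Rightarrow> nat) \<Rightarrow> nat" where
  "mdeg k = (\<Sum>i\<in>UNIV. k i)"

text \<open>Cubes rather than balls: on \<open>cube r\<close> every monomial is bounded by its
  weight \<open>r ^ mdeg k\<close>, with equality at the corner, so convergence of the series at the
  corner is convergence of the weighted norm.\<close>

definition cube :: "real \<Rightarrow> (real^'d) set" where
  "cube r = {x. \<forall>i. \<bar>x $ i\<bar> \<le> r}"

text \<open>\<open>ana_le r f B\<close>: on the cube of half-width \<open>r\<close> around \<open>0\<close>, \<open>f\<close> has a power series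
  whose weighted \<open>\<ell>\<^sup>1\<close> norm is at most \<open>B\<close>. Speaking of bounds instead of the norm itself avoids
  uniqueness of the coefficients.\<close>

definition ana_le :: "real \<Rightarrow> (real^'d \<Rightarrow> real) \<Rightarrow> real \<Rightarrow> bool" where
  "ana_le r f B \<longleftrightarrow> (\<exists>c S. ((\<lambda>k. \<bar>c k\<bar> * r ^ mdeg k) has_sum S) UNIV \<and> S \<le> B \<and>
     (\<forall>x\<in>cube r. ((\<lambda>k. c k * monomial k x) has_sum f x) UNIV))"

lemma ana_leI:
  assumes "((\<lambda>k. \<bar>c k\<bar> * r ^ mdeg k) has_sum S) UNIV" "S \<le> B"
    "\<And>x. x \<in> cube r \<Longrightarrow> ((\<lambda>k. c k * monomial k x) has_sum f x) UNIV"
  shows "ana_le r f B"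
  using assms unfolding ana_le_def by blast

lemma monomial_bound: "x \<in> cube r \<Longrightarrow> \<bar>monomial k x\<bar> \<le> r ^ mdeg k"
proof -
  assume x: "x \<in> cube r"
  have "\<bar>monomial k x\<bar> = (\<Prod>i\<in>UNIV. \<bar>x $ i\<bar> ^ k i)"
    by (simp add: monomial_def abs_prod power_abs)
  also have "\<dots> \<le> (\<Prod>i\<in>UNIV. r ^ k i)"
    using x by (intro prod_mono) (auto simp: cube_def intro!: power_mono)
  finally show ?thesis by (simp add: mdeg_def power_sum)
qed

lemma monomial_add: "monomial k x * monomial l x = monomial (\<lambda>i. k i + l i) x"
  by (simp add: monomial_def power_add prod.distrib)

lemma mdeg_add: "mdeg (\<lambda>i. k i + l i) = mdeg k + mdeg l"
  by (simp add: mdeg_def sum.distrib)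

lemma monomial_0 [simp]: "monomial (\<lambda>_. 0) x = 1"
  by (simp add: monomial_def)

lemma mdeg_0_iff [simp]: "mdeg k = 0 \<longleftrightarrow> k = (\<lambda>_. 0)"
  by (simp add: mdeg_def fun_eq_iff)

lemma abs_summable_has_sum_le:
  fixes f g :: "'i \<Rightarrow> real"
  assumes "(g has_sum S) A" "\<And>i. i \<in> A \<Longrightarrow> \<bar>f i\<bar> \<le> g i"
  shows "f summable_on A" "\<bar>infsum f A\<bar> \<le> S"
proof -
  have "g summable_on A" using assms(1) by (auto simp: summable_on_def)
  then have a: "(\<lambda>i. \<bar>f i\<bar>) summable_on A"
    by (rule summable_on_comparison_test) (use assms(2) in auto)
  then show b: "f summable_on A"
    using summable_on_iff_abs_summable_on_real by auto
  have "\<bar>infsum f A\<bar> \<le> infsum (\<lambda>i. \<bar>f i\<bar>) A"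
    using norm_infsum_bound[of f A] a by simp
  also have "\<dots> \<le> S"
    using a assms by (intro has_sum_mono[OF has_sum_infsum]) auto
  finally show "\<bar>infsum f A\<bar> \<le> S" .
qed

lemma has_sum_delta: "((\<lambda>k. if k = k0 then b else 0) has_sum b) UNIV"
  by (rule has_sum_cong_neutral[THEN iffD1, OF _ _ _ has_sum_finite[of "{k0}" "\<lambda>_. b", simplified]]) auto

text \<open>Series indexed by an arbitrary type, with repeated exponents, so that products and infinite
  sums need no convolution of coefficients.\<close>

lemma ana_le_collect:
  fixes a :: "'i \<Rightarrow> real" and k :: "'i \<Rightarrow> 'd::finite \<Rightarrow> nat"
  assumes r: "r > 0" and S: "((\<lambda>i. \<bar>a i\<bar> * r ^ mdeg (k i)) has_sum S) UNIV" and B: "S \<le> B"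
    and f: "\<And>x. x \<in> cube r \<Longrightarrow> ((\<lambda>i. a i * monomial (k i) x) has_sum f x) UNIV"
  shows "ana_le r f B"
proof -
  define I where "I m = {i. k i = m}" for m
  have bij: "bij_betw snd (Sigma UNIV I) UNIV"
    by (rule bij_betwI[of _ _ _ "\<lambda>i. (k i, i)"]) (auto simp: I_def)
  have abs_summable: "(\<lambda>i. \<bar>a i\<bar>) summable_on I m" for m
  proof -
    have "(\<lambda>i. \<bar>a i\<bar> * r ^ mdeg (k i)) summable_on I m"
      using S summable_on_subset_banach summable_on_def by blast
    then have "(\<lambda>i. \<bar>a i\<bar> * r ^ mdeg m) summable_on I m"
      by (rule summable_on_cong[THEN iffD1, rotated]) (auto simp: I_def)
    then have "(\<lambda>i. \<bar>a i\<bar> * r ^ mdeg m * inverse (r ^ mdeg m)) summable_on I m"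
      by (rule summable_on_cmult_left)
    then show ?thesis using r by (simp add: mult.assoc)
  qed
  then have summable: "a summable_on I m" for m
    using summable_on_iff_abs_summable_on_real by auto
  define c where "c m = infsum a (I m)" for m
  have c: "(a has_sum c m) (I m)" for m
    using summable by (simp add: c_def)
  define C where "C m = infsum (\<lambda>i. \<bar>a i\<bar>) (I m)" for m
  have C: "((\<lambda>i. \<bar>a i\<bar>) has_sum C m) (I m)" for m
    using abs_summable by (simp add: C_def)
  have cC: "\<bar>c m\<bar> \<le> C m" for m
    using norm_infsum_bound[of a "I m"] abs_summable by (simp add: c_def C_def)
  have "((\<lambda>p. \<bar>a (snd p)\<bar> * r ^ mdeg (k (snd p))) has_sum S) (Sigma UNIV I)"
    using S by (subst has_sum_reindex_bij_betw[OF bij])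
  then have "((\<lambda>m. C m * r ^ mdeg m) has_sum S) UNIV"
  proof (rule has_sum_SigmaD)
    fix m
    have "((\<lambda>i. \<bar>a i\<bar> * r ^ mdeg m) has_sum C m * r ^ mdeg m) (I m)"
      by (rule has_sum_cmult_left[OF C])
    then show "((\<lambda>i. \<bar>a (snd (m, i))\<bar> * r ^ mdeg (k (snd (m, i)))) has_sum C m * r ^ mdeg m) (I m)"
      by (rule has_sum_cong[THEN iffD1, rotated]) (auto simp: I_def)
  qed
  moreover have "\<bar>\<bar>c m\<bar> * r ^ mdeg m\<bar> \<le> C m * r ^ mdeg m" for m
    using r cC by (simp add: mult_right_mono abs_mult)
  ultimately have "(\<lambda>m. \<bar>c m\<bar> * r ^ mdeg m) summable_on UNIV"
    "\<bar>infsum (\<lambda>m. \<bar>c m\<bar> * r ^ mdeg m) UNIV\<bar> \<le> S"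
    using abs_summable_has_sum_le[of _ UNIV S "\<lambda>m. \<bar>c m\<bar> * r ^ mdeg m"] by blast+
  moreover have "((\<lambda>m. c m * monomial m x) has_sum f x) UNIV" if "x \<in> cube r" for x
  proof (rule has_sum_SigmaD)
    show "((\<lambda>p. a (snd p) * monomial (k (snd p)) x) has_sum f x) (Sigma UNIV I)"
      using f[OF that] by (subst has_sum_reindex_bij_betw[OF bij])
    fix m
    have "((\<lambda>i. a i * monomial m x) has_sum c m * monomial m x) (I m)"
      by (rule has_sum_cmult_left[OF c])
    then show "((\<lambda>i. a (snd (m, i)) * monomial (k (snd (m, i))) x) has_sum c m * monomial m x) (I m)"
      by (rule has_sum_cong[THEN iffD1, rotated]) (auto simp: I_def)
  qed
  ultimately show ?thesis
    by (rule ana_leI[OF has_sum_infsum order_trans[OF order_trans[OF abs_ge_self] B]])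
qed

text \<open>Weighted absolute convergence makes the double series summable in every order. The outer
  sum of the values \<open>g x\<close> therefore exists, and the last assumption only has to
  identify that sum with \<open>f x\<close>.\<close>

lemma ana_le_collect_Times:
  fixes a :: "'i \<times> 'j \<Rightarrow> real" and k :: "'i \<times> 'j \<Rightarrow> 'd::finite \<Rightarrow> nat"
  assumes r: "r > 0"
    and S: "\<And>i. ((\<lambda>j. \<bar>a (i, j)\<bar> * r ^ mdeg (k (i, j))) has_sum S i) UNIV" "(S has_sum B') UNIV" "B' \<le> B"
    and f: "\<And>x i. x \<in> cube r \<Longrightarrow> ((\<lambda>j. a (i, j) * monomial (k (i, j)) x) has_sum g x i) UNIV"
      "\<And>x h. x \<in> cube r \<Longrightarrow> (g x has_sum h) UNIV \<Longrightarrow> f x = h"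
  shows "ana_le r f B"
proof (rule ana_le_collect[where a = a and k = k])
  have 1: "(\<lambda>p. \<bar>a p\<bar> * r ^ mdeg (k p)) summable_on (UNIV \<times> UNIV)"
    using S r by (intro summable_on_SigmaI[where g = S]) (auto simp: summable_on_def)
  then show "((\<lambda>p. \<bar>a p\<bar> * r ^ mdeg (k p)) has_sum B') UNIV"
    using has_sum_SigmaI[where A=UNIV and B="\<lambda>_. UNIV" and f="\<lambda>p. \<bar>a p\<bar> * r ^ mdeg (k p)" and g=S and S=B'] S by simp
  fix x :: "real^'d" assume x: "x \<in> cube r"
  have "(\<lambda>p. a p * monomial (k p) x) summable_on (UNIV \<times> UNIV)"
    using 1 monomial_bound[OF x]
    by (intro abs_summable_has_sum_le[OF has_sum_infsum[OF 1]]) (auto simp: abs_mult intro!: mult_left_mono)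
  then obtain h where h: "((\<lambda>p. a p * monomial (k p) x) has_sum h) (UNIV \<times> UNIV)"
    by (auto simp: summable_on_def)
  then have "(g x has_sum h) UNIV"
    by (rule has_sum_SigmaD) (use f(1)[OF x] in auto)
  with h show "((\<lambda>p. a p * monomial (k p) x) has_sum f x) UNIV"
    using f(2)[OF x] by simp
qed (use r S(3) in auto)

lemma ana_le_mono: "ana_le r f B \<Longrightarrow> B \<le> B' \<Longrightarrow> ana_le r f B'"
  unfolding ana_le_def by (meson order_trans)

lemma ana_le_cong: "ana_le r f B \<Longrightarrow> (\<And>x. x \<in> cube r \<Longrightarrow> f x = g x) \<Longrightarrow> ana_le r g B"
  unfolding ana_le_def by (simp cong: ball_cong)

lemma ana_le_nonneg: "0 < r \<Longrightarrow> ana_le r f B \<Longrightarrow> 0 \<le> B"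
  unfolding ana_le_def by (auto intro: order_trans[OF has_sum_nonneg])

lemma ana_le_bound: "ana_le r f B \<Longrightarrow> x \<in> cube r \<Longrightarrow> \<bar>f x\<bar> \<le> B"
proof -
  assume "ana_le r f B" and x: "x \<in> cube r"
  then obtain c S where S: "((\<lambda>k. \<bar>c k\<bar> * r ^ mdeg k) has_sum S) UNIV" "S \<le> B"
    and f: "((\<lambda>k. c k * monomial k x) has_sum f x) UNIV"
    unfolding ana_le_def by blast
  have "\<bar>infsum (\<lambda>k. c k * monomial k x) UNIV\<bar> \<le> S"
    using monomial_bound[OF x]
    by (intro abs_summable_has_sum_le[OF S(1)]) (auto simp: abs_mult intro!: mult_left_mono)
  with S f show ?thesis by (simp add: infsumI)
qed

lemma ana_le_const: "ana_le r (\<lambda>_. b) \<bar>b\<bar>"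
proof -
  let ?c = "\<lambda>k::'d \<Rightarrow> nat. if k = (\<lambda>_. 0) then b else 0"
  have "((\<lambda>k. \<bar>?c k\<bar> * r ^ mdeg k) has_sum \<bar>b\<bar>) UNIV"
    by (rule has_sum_cong_neutral[THEN iffD1, OF _ _ _ has_sum_finite[of "{\<lambda>_. 0}", simplified]]) 
      (auto simp: mdeg_def)
  moreover have "((\<lambda>k. ?c k * monomial k x) has_sum b) UNIV" for x
    by (rule has_sum_cong_neutral[THEN iffD1, OF _ _ _ has_sum_finite[of "{\<lambda>_. 0}", simplified]]) auto
  ultimately show ?thesis by (rule ana_leI[OF _ order_refl])
qed

lemma ana_le_cmult: "ana_le r f B \<Longrightarrow> ana_le r (\<lambda>x. b * f x) (\<bar>b\<bar> * B)"
proof -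
  assume "ana_le r f B"
  then obtain c S where S: "((\<lambda>k. \<bar>c k\<bar> * r ^ mdeg k) has_sum S) UNIV" "S \<le> B"
    and f: "\<And>x. x \<in> cube r \<Longrightarrow> ((\<lambda>k. c k * monomial k x) has_sum f x) UNIV"
    unfolding ana_le_def by blast
  show ?thesis
  proof (rule ana_leI[where c = "\<lambda>k. b * c k" and S = "\<bar>b\<bar> * S"])
    show "((\<lambda>k. \<bar>b * c k\<bar> * r ^ mdeg k) has_sum (\<bar>b\<bar> * S)) UNIV"
      using has_sum_cmult_right[OF S(1), of "\<bar>b\<bar>"] by (simp add: abs_mult mult.assoc)
    show "((\<lambda>k. (b * c k) * monomial k x) has_sum b * f x) UNIV" if "x \<in> cube r" for x
      using has_sum_cmult_right[OF f[OF that], of b] by (simp add: mult.assoc)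
  qed (simp add: S(2) mult_left_mono)
qed

lemma ana_le_add: 
  assumes r: "0 < r" and "ana_le r f B" "ana_le r g D" shows "ana_le r (\<lambda>x. f x + g x) (B + D)"
proof -
  obtain c S where S: "((\<lambda>k. \<bar>c k\<bar> * r ^ mdeg k) has_sum S) UNIV" "S \<le> B"
    and f: "\<And>x. x \<in> cube r \<Longrightarrow> ((\<lambda>k. c k * monomial k x) has_sum f x) UNIV"
    using assms unfolding ana_le_def by blast
  obtain d T where T: "((\<lambda>k. \<bar>d k\<bar> * r ^ mdeg k) has_sum T) UNIV" "T \<le> D"
    and g: "\<And>x. x \<in> cube r \<Longrightarrow> ((\<lambda>k. d k * monomial k x) has_sum g x) UNIV"
    using assms unfolding ana_le_def by blast
  let ?G = "\<lambda>k. \<bar>c k\<bar> * r ^ mdeg k + \<bar>d k\<bar> * r ^ mdeg k"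
  have *: "(?G has_sum (S + T)) UNIV" by (rule has_sum_add[OF S(1) T(1)])
  have le: "\<bar>\<bar>c k + d k\<bar> * r ^ mdeg k\<bar> \<le> ?G k" for k
    using r abs_triangle_ineq[of "c k" "d k"]
    by (simp add: abs_mult mult_right_mono flip: distrib_right)
  show ?thesis
  proof (rule ana_leI[where c = "\<lambda>k. c k + d k"])
    show "((\<lambda>k. \<bar>c k + d k\<bar> * r ^ mdeg k) has_sum (infsum (\<lambda>k. \<bar>c k + d k\<bar> * r ^ mdeg k) UNIV)) UNIV"
      using abs_summable_has_sum_le(1)[OF * le] by simp
    show "infsum (\<lambda>k. \<bar>c k + d k\<bar> * r ^ mdeg k) UNIV \<le> B + D"
      using abs_summable_has_sum_le(2)[OF * le] S(2) T(2) by linarith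
    show "((\<lambda>k. (c k + d k) * monomial k x) has_sum f x + g x) UNIV" if "x \<in> cube r" for x
      using has_sum_add[OF f[OF that] g[OF that]] by (simp add: distrib_right)
  qed
qed

lemma ana_le_sum:
  assumes "0 < r" "finite A" "\<And>j. j \<in> A \<Longrightarrow> ana_le r (f j) (B j)"
  shows "ana_le r (\<lambda>x. \<Sum>j\<in>A. f j x) (\<Sum>j\<in>A. B j)"
  using assms(2,3)
proof (induction A rule: finite_induct)
  case empty
  then show ?case using ana_le_const[of r 0] by simp
next
  case (insert j A)
  then show ?case using ana_le_add[OF assms(1), of "f j" "B j"] by simp
qed

lemma ana_le_mult: 
  assumes r: "0 < r" and "ana_le r f B" "ana_le r g D" shows "ana_le r (\<lambda>x. f x * g x) (B * D)"
proof -
  obtain c S where S: "((\<lambda>k. \<bar>c k\<bar> * r ^ mdeg k) has_sum S) UNIV" "S \<le> B"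
    and f: "\<And>x. x \<in> cube r \<Longrightarrow> ((\<lambda>k. c k * monomial k x) has_sum f x) UNIV"
    using assms unfolding ana_le_def by blast
  obtain d T where T: "((\<lambda>k. \<bar>d k\<bar> * r ^ mdeg k) has_sum T) UNIV" "T \<le> D"
    and g: "\<And>x. x \<in> cube r \<Longrightarrow> ((\<lambda>k. d k * monomial k x) has_sum g x) UNIV"
    using assms unfolding ana_le_def by blast
  have nn: "0 \<le> S" "0 \<le> T" using S(1) T(1) r by (auto intro: has_sum_nonneg)
  show ?thesis
  proof (rule ana_le_collect_Times[OF r, where a = "\<lambda>(k, l). c k * d l" and k = "\<lambda>(k, l) i. k i + l i"
        and S = "\<lambda>k. (\<bar>c k\<bar> * r ^ mdeg k) * T" and B' = "S * T" and g = "\<lambda>x k. (c k * monomial k x) * g x"])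
    show "((\<lambda>l. \<bar>case (k, l) of (k, l) \<Rightarrow> c k * d l\<bar> * r ^ mdeg (case (k, l) of (k, l) \<Rightarrow> \<lambda>i. k i + l i)) has_sum
          \<bar>c k\<bar> * r ^ mdeg k * T) UNIV" for k
      using has_sum_cmult_right[OF T(1), of "\<bar>c k\<bar> * r ^ mdeg k"]
      by (simp add: mdeg_add power_add abs_mult mult_ac)
    show "((\<lambda>k. (\<bar>c k\<bar> * r ^ mdeg k) * T) has_sum S * T) UNIV"
      by (rule has_sum_cmult_left[OF S(1)])
    show "S * T \<le> B * D" using S(2) T(2) nn by (intro mult_mono) auto
    show "((\<lambda>l. (case (k, l) of (k, l) \<Rightarrow> c k * d l) * monomial (case (k, l) of (k, l) \<Rightarrow> \<lambda>i. k i + l i) x) has_sum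
          c k * monomial k x * g x) UNIV" if "x \<in> cube r" for x k
      using has_sum_cmult_right[OF g[OF that], of "c k * monomial k x"]
      by (simp flip: monomial_add add: mult_ac)
    show "f x * g x = h" if "x \<in> cube r" "((\<lambda>k. c k * monomial k x * g x) has_sum h) UNIV" for x h
      using has_sum_cmult_left[OF f[OF that(1)], of "g x"] that(2) has_sum_unique by blast
  qed
qed

text \<open>Completeness of the algebra: it turns the limit of the fixed point iteration, written as
  a telescoping series, into a power series.\<close>

lemma ana_le_suminf:
  assumes r: "0 < r" and fB: "\<And>n. ana_le r (f n) (B n)" and "summable B"
  shows "ana_le r (\<lambda>x. \<Sum>n. f n x) (suminf B)"
proof -
  have "\<forall>n. \<exists>p. ((\<lambda>k. \<bar>fst p k\<bar> * r ^ mdeg k) has_sum snd p) UNIV \<and> snd p \<le> B n \<and>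
     (\<forall>x\<in>cube r. ((\<lambda>k. fst p k * monomial k x) has_sum f n x) UNIV)"
    using fB unfolding ana_le_def by auto
  from choice[OF this] obtain p where p: "\<forall>n. ((\<lambda>k. \<bar>fst (p n) k\<bar> * r ^ mdeg k) has_sum snd (p n)) UNIV \<and> snd (p n) \<le> B n \<and>
     (\<forall>x\<in>cube r. ((\<lambda>k. fst (p n) k * monomial k x) has_sum f n x) UNIV)" ..
  define c S where "c = fst \<circ> p" and "S = snd \<circ> p"
  have S: "\<And>n. ((\<lambda>k. \<bar>c n k\<bar> * r ^ mdeg k) has_sum S n) UNIV" "\<And>n. S n \<le> B n"
    and f: "\<And>n x. x \<in> cube r \<Longrightarrow> ((\<lambda>k. c n k * monomial k x) has_sum f n x) UNIV"
    using p by (auto simp: c_def S_def)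
  have nn: "0 \<le> S n" for n using S(1)[of n] r by (auto intro: has_sum_nonneg)
  have sS: "summable S" by (rule summable_comparison_test_ev[OF _ \<open>summable B\<close>]) (use nn S(2) in auto)
  have hS: "(S has_sum suminf S) UNIV"
    by (rule norm_summable_imp_has_sum) (use nn sS summable_sums in \<open>simp_all\<close>)
  show ?thesis
  proof (rule ana_le_collect_Times[OF r, where a = "\<lambda>(n, k). c n k" and k = "snd" and S = S and B' = "suminf S"
        and g = "\<lambda>x n. f n x"])
    show "suminf S \<le> suminf B" using S(2) sS \<open>summable B\<close> by (intro suminf_le) auto
    show "(\<Sum>n. f n x) = h" if "((\<lambda>n. f n x) has_sum h) UNIV" for x h
      using has_sum_imp_sums[OF that] by (simp add: sums_iff)
  qed (use S f hS in auto)
qed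

lemma cube_0 [simp]: "0 \<le> r \<Longrightarrow> 0 \<in> cube r"
  by (simp add: cube_def)

lemma cube_mono: "r \<le> r' \<Longrightarrow> cube r \<subseteq> cube r'"
  unfolding cube_def by (auto intro: order_trans)

lemma norm_cube:
  assumes "x \<in> cube r"
  shows "norm (x::real^'d) \<le> real CARD('d) * r"
proof -
  have "(\<Sum>i\<in>UNIV. \<bar>x $ i\<bar>) \<le> real CARD('d) * r"
    by (rule sum_bounded_above) (use assms in \<open>auto simp: cube_def\<close>)
  then show ?thesis using norm_le_l1_cart[of x] by linarith
qed

lemma ball_subset_cube: "ball 0 r \<subseteq> cube r"
proof
  fix x :: "real^'d" assume "x \<in> ball 0 r"
  then show "x \<in> cube r" unfolding cube_def using component_le_norm_cart[of x]
    by (auto intro: order_trans less_imp_le)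
qed

section \<open>Real analyticity at a point versus the weighted coefficient norm\<close>

lemma real_analytic_at_iff:
  "real_analytic_at f a \<longleftrightarrow> (\<exists>c R. R > 0 \<and>
     (\<forall>x\<in>ball a R. ((\<lambda>k. c k * monomial k (x - a)) has_sum f x) UNIV))"
  by (simp add: real_analytic_at_def monomial_def)

text \<open>Once the constant term is removed, every monomial gains at least one factor
  \<open>r / r1\<close> when the cube shrinks from \<open>r1\<close> to \<open>r\<close>. The norm
  is then at most \<open>(r / r1) * S\<close>, which tends to 0 with \<open>r\<close>.\<close>

lemma real_analytic_at_imp_ana_le:
  fixes h :: "real^'d \<Rightarrow> real"
  assumes h: "real_analytic_at h a" and "0 < \<eta>"
  shows "\<exists>r0>0. \<forall>r. 0 < r \<and> r \<le> r0 \<longrightarrow> ana_le r (\<lambda>x. h (a + x) - h a) \<eta>"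
proof -
  obtain c R where R: "R > 0" and c: "\<And>x. x \<in> ball a R \<Longrightarrow> ((\<lambda>k. c k * monomial k (x - a)) has_sum h x) UNIV"
    using h unfolding real_analytic_at_iff by blast
  \<comment> \<open>On \<open>cube r1\<close> the Euclidean norm is at most
    \<open>CARD('d) * r1 = R / 2\<close>.\<close>
  define r1 where "r1 = R / (2 * real CARD('d))"
  have r1: "r1 > 0" using R by (simp add: r1_def)
  have ball: "a + x \<in> ball a R" if "x \<in> cube r1" for x
    using norm_cube[OF that] R by (simp add: r1_def dist_norm)
  have h1: "((\<lambda>k. c k * monomial k x) has_sum h (a + x)) UNIV" if "x \<in> cube r1" for x
    using c[OF ball[OF that]] by simp
  \<comment> \<open>At the corner of the cube the monomials equal the weights, and unordered
    convergence of a real series is absolute.\<close>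
  have "(\<chi> i. r1) \<in> cube r1" using r1 by (simp add: cube_def)
  from h1[OF this] have "(\<lambda>k. c k * r1 ^ mdeg k) summable_on UNIV"
    by (auto simp: summable_on_def monomial_def mdeg_def power_sum)
  then have "(\<lambda>k. \<bar>c k * r1 ^ mdeg k\<bar>) summable_on UNIV"
    using summable_on_iff_abs_summable_on_real[of "\<lambda>k. c k * r1 ^ mdeg k" UNIV] by (simp only: real_norm_def)
  then have "(\<lambda>k. \<bar>c k\<bar> * r1 ^ mdeg k) summable_on UNIV"
    using r1 by (simp add: abs_mult)
  then obtain S where S: "((\<lambda>k. \<bar>c k\<bar> * r1 ^ mdeg k) has_sum S) UNIV"
    by (auto simp: summable_on_def)
  have S0: "0 \<le> S" using S r1 by (auto intro: has_sum_nonneg)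
  have c0: "c (\<lambda>_. 0) = h a"
  proof -
    have *: "c k * monomial k 0 = (if k = (\<lambda>_. 0) then c (\<lambda>_. 0) else 0)" for k
    proof (cases "k = (\<lambda>_. 0)")
      case False
      then obtain i where "k i \<noteq> 0" by auto
      then show ?thesis using False by (auto simp: monomial_def)
    qed simp
    have "((\<lambda>k. c k * monomial k 0) has_sum c (\<lambda>_. 0)) UNIV"
      unfolding * by (rule has_sum_delta)
    then show ?thesis using h1[of 0] r1 has_sum_unique by fastforce
  qed
  define c' where "c' = c((\<lambda>_. 0) := 0)"
  have "ana_le r (\<lambda>x. h (a + x) - h a) \<eta>" if r: "0 < r" "r \<le> r1" "r \<le> r1 * \<eta> / (S + 1)" for r
  proof -
    have g: "((\<lambda>k. (r / r1) * (\<bar>c k\<bar> * r1 ^ mdeg k)) has_sum (r / r1) * S) UNIV"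
      by (rule has_sum_cmult_right[OF S])
    have le: "\<bar>\<bar>c' k\<bar> * r ^ mdeg k\<bar> \<le> (r / r1) * (\<bar>c k\<bar> * r1 ^ mdeg k)" for k
    proof (cases "k = (\<lambda>_. 0)")
      case False
      then obtain n where n: "mdeg k = Suc n" using not0_implies_Suc mdeg_0_iff by blast
      have "r ^ n \<le> r1 ^ n" using r by (intro power_mono) auto
      then show ?thesis using False r r1
        by (simp add: c'_def n field_simps abs_mult mult_left_mono)
    qed (use r r1 in \<open>simp add: c'_def\<close>)
    have "(r / r1) * S \<le> (\<eta> / (S + 1)) * S"
      using r r1 S0 by (intro mult_right_mono) (auto simp: field_simps)
    also have "\<dots> \<le> \<eta>" using S0 \<open>0 < \<eta>\<close> by (simp add: field_simps)
    finally have le2: "(r / r1) * S \<le> \<eta>" .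
    have "((\<lambda>k. c' k * monomial k x) has_sum h (a + x) - h a) UNIV" if x: "x \<in> cube r" for x
    proof -
      have "x \<in> cube r1" using x cube_mono[OF r(2)] by auto
      from has_sum_add[OF h1[OF this] has_sum_delta[of "\<lambda>_. 0" "- h a"]]
      have "((\<lambda>k. c k * monomial k x + (if k = (\<lambda>_. 0) then - h a else 0)) has_sum h (a + x) - h a) UNIV"
        by simp
      then show ?thesis
        by (rule has_sum_cong[THEN iffD1, rotated]) (auto simp: c'_def c0)
    qed
    with abs_summable_has_sum_le[OF g le] show ?thesis
      by (rule ana_leI[OF has_sum_infsum order_trans[OF order_trans[OF abs_ge_self] le2]])
  qed
  then show ?thesis
    using r1 S0 \<open>0 < \<eta>\<close> by (intro exI[of _ "min r1 (r1 * \<eta> / (S + 1))"]) auto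
qed

lemma ana_le_imp_real_analytic_at:
  assumes "0 < r" "ana_le r f B" "\<And>x. x \<in> ball 0 r \<Longrightarrow> h (a + x) = f x"
  shows "real_analytic_at h a"
proof -
  obtain c where c: "\<And>x. x \<in> cube r \<Longrightarrow> ((\<lambda>k. c k * monomial k x) has_sum f x) UNIV"
    using assms(2) unfolding ana_le_def by blast
  have "((\<lambda>k. c k * monomial k (x - a)) has_sum h x) UNIV" if "x \<in> ball a r" for x
  proof -
    have *: "x - a \<in> ball 0 r" using that by (simp add: dist_norm norm_minus_commute)
    then show ?thesis using c[of "x - a"] assms(3)[of "x - a"] ball_subset_cube by force
  qed
  then show ?thesis unfolding real_analytic_at_iff using assms(1) by blast
qed

text \<open>Along an axis only the multi-indices supported in \<open>j\<close> contribute, which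
  leaves an ordinary power series in \<open>t\<close> to be differentiated term by term.\<close>

lemma real_analytic_at_imp_DERIV:
  fixes f :: "real^'d \<Rightarrow> real"
  assumes "real_analytic_at f a"
  shows "\<exists>D. ((\<lambda>t. f (a + t *\<^sub>R axis j 1)) has_real_derivative D) (at 0)"
proof -
  obtain c R where R: "R > 0" and c: "\<And>x. x \<in> ball a R \<Longrightarrow> ((\<lambda>k. c k * monomial k (x - a)) has_sum f x) UNIV"
    using assms unfolding real_analytic_at_iff by blast
  define k where "k n = (\<lambda>i. if i = j then n else (0::nat))" for n :: nat
  have inj: "inj k" by (auto simp: inj_def k_def fun_eq_iff split: if_splits)
  have mk: "monomial (k n) (t *\<^sub>R axis j 1) = t ^ n" for n t
    by (simp add: monomial_def k_def axis_def if_distrib prod.delta cong: if_cong)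
  have s: "(\<lambda>n. c (k n) * t ^ n) sums f (a + t *\<^sub>R axis j 1)" if "\<bar>t\<bar> < R" for t
  proof -
    have "((\<lambda>l. c l * monomial l (t *\<^sub>R axis j 1)) has_sum f (a + t *\<^sub>R axis j 1)) UNIV"
      using c[of "a + t *\<^sub>R axis j 1"] that by (simp add: dist_norm)
    then have "((\<lambda>l. c l * monomial l (t *\<^sub>R axis j 1)) has_sum f (a + t *\<^sub>R axis j 1)) (range k)"
    proof (rule has_sum_cong_neutral[THEN iffD1, rotated 3])
      fix l assume "l \<in> UNIV - range k"
      then have "l \<noteq> k (l j)" by auto
      then obtain i where "i \<noteq> j" "l i \<noteq> 0" by (auto simp: k_def fun_eq_iff split: if_splits)
      then have "monomial l (t *\<^sub>R axis j 1) = 0"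
        by (auto simp: monomial_def axis_def intro!: bexI[of _ i])
      then show "c l * monomial l (t *\<^sub>R axis j 1) = 0" by simp
    qed auto
    then have "((\<lambda>n. c (k n) * t ^ n) has_sum f (a + t *\<^sub>R axis j 1)) UNIV"
      by (simp add: has_sum_reindex[OF inj] o_def mk)
    then show ?thesis by (rule has_sum_imp_sums)
  qed
  have "summable (\<lambda>n. c (k n) * (R/2) ^ n)" using s[of "R/2"] R by (auto simp: sums_iff)
  then have "DERIV (\<lambda>t. \<Sum>n. c (k n) * t ^ n) 0 :> (\<Sum>n. diffs (\<lambda>n. c (k n)) n * 0 ^ n)"
    by (rule termdiffs_strong) (use R in auto)
  then have "DERIV (\<lambda>t. f (a + t *\<^sub>R axis j 1)) 0 :> (\<Sum>n. diffs (\<lambda>n. c (k n)) n * 0 ^ n)"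
  proof (rule has_field_derivative_transform_within_open[of _ _ _ "ball 0 R"])
  qed (use R s in \<open>auto simp: sums_iff dist_norm\<close>)
  then show ?thesis by blast
qed

subsection \<open>The analytic implicit function theorem\<close>

abbreviation ana_vec :: "real \<Rightarrow> (real^'d \<Rightarrow> real^'m) \<Rightarrow> real \<Rightarrow> bool" where
  "ana_vec r y B \<equiv> \<forall>j. ana_le r (\<lambda>x. y x $ j) B"

text \<open>Strict differentiability at \<open>y0\<close>, with derivative \<open>L\<close>, of the superposition operator
  \<open>y \<mapsto> (x \<mapsto> F (a + x) (y0 + y x))\<close> with respect to the coefficient norm.\<close>

definition strict_diff_bound :: "real^'d \<Rightarrow> real^'m \<Rightarrow> (real^'d \<Rightarrow> real^'m \<Rightarrow> real) \<Rightarrow> ('m \<Rightarrow> real) \<Rightarrow>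
    real \<Rightarrow> real \<Rightarrow> real \<Rightarrow> bool" where
  "strict_diff_bound a y0 F L \<eta> \<rho> r \<longleftrightarrow>
    (\<forall>y. ana_vec r y \<rho> \<longrightarrow> ana_le r (\<lambda>x. F (a + x) (y0 + y x) - F a y0) \<eta>) \<and>
    (\<forall>y y' B. ana_vec r y \<rho> \<longrightarrow> ana_vec r y' \<rho> \<longrightarrow>
       (\<forall>j. ana_le r (\<lambda>x. y x $ j - y' x $ j) B) \<longrightarrow>
       ana_le r (\<lambda>x. F (a + x) (y0 + y x) - F (a + x) (y0 + y' x)
              - (\<Sum>j\<in>UNIV. L j * (y x $ j - y' x $ j))) (\<eta> * B))"

text \<open>The norm bound \<open>\<delta>\<close> on the functions \<open>y\<close> and the
  half-width \<open>r\<close> of the cube are kept apart: a ball of functions can be fixed first and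
  the cube shrunk afterwards, as in \<open>poly_ana_contraction_bounds\<close>.\<close>

abbreviation small_diff :: "real^'d \<Rightarrow> real^'m \<Rightarrow> (real^'d \<Rightarrow> real^'m \<Rightarrow> real) \<Rightarrow> ('m \<Rightarrow> real) \<Rightarrow> real \<Rightarrow> bool" where
  "small_diff a y0 F L \<eta> \<equiv> \<forall>\<^sub>F \<delta> in at_right 0. \<forall>r. 0 < r \<and> r \<le> \<delta> \<longrightarrow> strict_diff_bound a y0 F L \<eta> \<delta> r"

definition strict_diff :: "real^'d \<Rightarrow> real^'m \<Rightarrow> (real^'d \<Rightarrow> real^'m \<Rightarrow> real) \<Rightarrow> ('m \<Rightarrow> real) \<Rightarrow> bool" where
  "strict_diff a y0 F L \<longleftrightarrow> (\<forall>\<eta>>0. small_diff a y0 F L \<eta>)"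

lemma strict_diff_bound1: "strict_diff_bound a y0 F L \<eta> \<rho> r \<Longrightarrow> (\<And>j. ana_le r (\<lambda>x. y x $ j) \<rho>) \<Longrightarrow>
    ana_le r (\<lambda>x. F (a + x) (y0 + y x) - F a y0) \<eta>"
  unfolding strict_diff_bound_def by blast

lemma strict_diff_bound2: "strict_diff_bound a y0 F L \<eta> \<rho> r \<Longrightarrow> (\<And>j. ana_le r (\<lambda>x. y x $ j) \<rho>) \<Longrightarrow> (\<And>j. ana_le r (\<lambda>x. y' x $ j) \<rho>) \<Longrightarrow>
    (\<And>j. ana_le r (\<lambda>x. y x $ j - y' x $ j) B) \<Longrightarrow>
    ana_le r (\<lambda>x. F (a + x) (y0 + y x) - F (a + x) (y0 + y' x) - (\<Sum>j\<in>UNIV. L j * (y x $ j - y' x $ j))) (\<eta> * B)"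
  unfolding strict_diff_bound_def by blast

lemma eventually_at_right_le: "0 < c \<Longrightarrow> \<forall>\<^sub>F \<delta> in at_right 0. 0 < \<delta> \<and> \<delta> \<le> (c::real)"
  by (rule eventually_at_rightI[of 0 c]) auto

lemma strict_diff_coef:
  assumes "real_analytic_at h a"
  shows "strict_diff a y0 (\<lambda>x y. h x) (\<lambda>_. 0)"
  unfolding strict_diff_def
proof (intro allI impI)
  fix \<eta> :: real assume "0 < \<eta>"
  from real_analytic_at_imp_ana_le[OF assms this] obtain r0
    where r0: "r0 > 0" "\<And>r. 0 < r \<Longrightarrow> r \<le> r0 \<Longrightarrow> ana_le r (\<lambda>x. h (a + x) - h a) \<eta>" by blast
  have 2: "ana_le r (\<lambda>x. 0) (\<eta> * B)" if "0 < r" "\<forall>j. ana_le r (\<lambda>x. y x $ j - y' x $ j) B" for r B and y y' :: "real^'a \<Rightarrow> real^'b"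
  proof (rule ana_le_mono[OF ana_le_const[of r 0, simplified]])
    have "0 \<le> B" using ana_le_nonneg[OF that(1)] that(2) by blast
    then show "0 \<le> \<eta> * B" using \<open>0 < \<eta>\<close> by simp
  qed
  show "small_diff a y0 (\<lambda>x y. h x) (\<lambda>_. 0) \<eta>"
    using eventually_at_right_le[OF r0(1)]
    by eventually_elim (use r0(2) 2 in \<open>auto simp: strict_diff_bound_def\<close>)
qed

lemma strict_diff_var: "strict_diff a y0 (\<lambda>x y. y $ k) (\<lambda>j. if j = k then 1 else 0)"
  unfolding strict_diff_def
proof (intro allI impI)
  fix \<eta> :: real assume "0 < \<eta>"
  have 2: "ana_le r (\<lambda>x. 0) (\<eta> * B)" if "0 < r" "\<forall>j. ana_le r (\<lambda>x. y x $ j - y' x $ j) B" for r B and y y' :: "real^'a \<Rightarrow> real^'b"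
  proof (rule ana_le_mono[OF ana_le_const[of r 0, simplified]])
    have "0 \<le> B" using ana_le_nonneg[OF that(1)] that(2) by blast
    then show "0 \<le> \<eta> * B" using \<open>0 < \<eta>\<close> by simp
  qed
  show "small_diff a y0 (\<lambda>x y. y $ k) (\<lambda>j. if j = k then 1 else 0) \<eta>"
    using eventually_at_right_le[OF \<open>0 < \<eta>\<close>]
    by eventually_elim (use 2 in \<open>auto simp: strict_diff_bound_def if_distrib[of "\<lambda>x. x * _"] cong: if_cong intro: ana_le_mono\<close>)
qed

lemma strict_diff_add:
  assumes "strict_diff a y0 F L1" "strict_diff a y0 G L2"
  shows "strict_diff a y0 (\<lambda>x y. F x y + G x y) (\<lambda>j. L1 j + L2 j)"
  unfolding strict_diff_def
proof (intro allI impI)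
  fix \<eta> :: real assume \<eta>: "0 < \<eta>"
  then have "small_diff a y0 F L1 (\<eta>/2)"
    "small_diff a y0 G L2 (\<eta>/2)"
    using assms unfolding strict_diff_def by auto
  then show "small_diff a y0 (\<lambda>x y. F x y + G x y) (\<lambda>j. L1 j + L2 j) \<eta>"
  proof eventually_elim
    case (elim \<delta>)
    show ?case
    proof (intro allI impI)
      fix r assume r: "0 < r \<and> r \<le> \<delta>"
      then have s: "strict_diff_bound a y0 F L1 (\<eta>/2) \<delta> r" "strict_diff_bound a y0 G L2 (\<eta>/2) \<delta> r" using elim by auto
      show "strict_diff_bound a y0 (\<lambda>x y. F x y + G x y) (\<lambda>j. L1 j + L2 j) \<eta> \<delta> r"
        unfolding strict_diff_bound_def
      proof (intro conjI allI impI)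
        fix y :: "real^'a \<Rightarrow> real^'b" assume y: "ana_vec r y \<delta>"
        have "ana_le r (\<lambda>x. (F (a + x) (y0 + y x) - F a y0) + (G (a + x) (y0 + y x) - G a y0)) (\<eta>/2 + \<eta>/2)"
          using r y by (intro ana_le_add strict_diff_bound1[OF s(1)] strict_diff_bound1[OF s(2)]) auto
        then show "ana_le r (\<lambda>x. F (a + x) (y0 + y x) + G (a + x) (y0 + y x) - (F a y0 + G a y0)) \<eta>"
          by (simp add: algebra_simps)
      next
        fix y y' :: "real^'a \<Rightarrow> real^'b" and B 
        assume y: "ana_vec r y \<delta>" "ana_vec r y' \<delta>" "\<forall>j. ana_le r (\<lambda>x. y x $ j - y' x $ j) B"
        have "ana_le r (\<lambda>x. (F (a + x) (y0 + y x) - F (a + x) (y0 + y' x) - (\<Sum>j\<in>UNIV. L1 j * (y x $ j - y' x $ j)))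
          + (G (a + x) (y0 + y x) - G (a + x) (y0 + y' x) - (\<Sum>j\<in>UNIV. L2 j * (y x $ j - y' x $ j)))) (\<eta>/2*B + \<eta>/2*B)"
          using r y by (intro ana_le_add strict_diff_bound2[OF s(1)] strict_diff_bound2[OF s(2)]) auto
        then show "ana_le r (\<lambda>x. F (a + x) (y0 + y x) + G (a + x) (y0 + y x)
             - (F (a + x) (y0 + y' x) + G (a + x) (y0 + y' x))
             - (\<Sum>j\<in>UNIV. (L1 j + L2 j) * (y x $ j - y' x $ j))) (\<eta> * B)"
          by (rule ana_le_mono[OF ana_le_cong]) (simp_all add: algebra_simps sum.distrib sum_subtractf)
      qed
    qed
  qed
qed

lemma strict_diff_mult:
  assumes "strict_diff a y0 F L1" "strict_diff a y0 G L2"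
  shows "strict_diff a y0 (\<lambda>x y. F x y * G x y) (\<lambda>j. F a y0 * L2 j + G a y0 * L1 j)"
  unfolding strict_diff_def
proof (intro allI impI)
  let ?F = "\<lambda>y x. F (a + x) (y0 + y x)" and ?G = "\<lambda>y x. G (a + x) (y0 + y x)"
  let ?d = "\<lambda>(L :: 'b \<Rightarrow> real) y y' x. \<Sum>j\<in>UNIV. L j * ((y x :: real^'b) $ j - y' x $ j)"
  fix \<eta> :: real assume \<eta>: "0 < \<eta>"
  define C1 C2 l1 l2 where "C1 = \<bar>F a y0\<bar>" "C2 = \<bar>G a y0\<bar>" "l1 = (\<Sum>j\<in>UNIV. \<bar>L1 j\<bar>)" "l2 = (\<Sum>j\<in>UNIV. \<bar>L2 j\<bar>)"
  note C_def = this
  have nn: "0 \<le> C1" "0 \<le> C2" "0 \<le> l1" "0 \<le> l2" by (auto simp: C_def intro: sum_nonneg)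
  \<comment> \<open>The sum of all factors of \<open>e\<close> in the remainder of the product:
    \<open>C1 + 1\<close> and \<open>C2 + 1\<close> bound \<open>F\<close> and \<open>G\<close>
    because \<open>e \<le> 1\<close>, and \<open>l1\<close>, \<open>l2\<close> bound the linear
    parts. The choice of \<open>e\<close> gives \<open>e * T \<le> \<eta>\<close>.\<close>
  define T where "T = C1 + C2 + 2 + l1 + l2"
  have T: "T > 0" using nn by (simp add: T_def)
  define e where "e = min 1 (\<eta> / T)"
  have e: "0 < e" "e \<le> 1" "e * T \<le> \<eta>" using \<eta> T by (auto simp: e_def min_def field_simps)
  have "small_diff a y0 F L1 e"
    "small_diff a y0 G L2 e"
    using assms e(1) unfolding strict_diff_def by auto
  then show "small_diff a y0 (\<lambda>x y. F x y * G x y) (\<lambda>j. F a y0 * L2 j + G a y0 * L1 j) \<eta>"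
  proof eventually_elim
    case (elim \<delta>)
    show ?case
    proof (intro allI impI)
      fix r assume r': "0 < r \<and> r \<le> \<delta>"
      then have r: "0 < r" and s: "strict_diff_bound a y0 F L1 e \<delta> r" "strict_diff_bound a y0 G L2 e \<delta> r" using elim by auto
      have d1: "ana_le r (\<lambda>x. ?F y x - F a y0) e" if "ana_vec r y \<delta>" for y
        using strict_diff_bound1[OF s(1)] that by blast
      have d2: "ana_le r (\<lambda>x. ?G y x - G a y0) e" if "ana_vec r y \<delta>" for y
        using strict_diff_bound1[OF s(2)] that by blast
      have b1: "ana_le r (\<lambda>x. ?F y x) (C1 + 1)" if "ana_vec r y \<delta>" for y
        using ana_le_add[OF r d1[OF that] ana_le_const[of r "F a y0"]] e(2)
        by (auto simp: C_def intro: ana_le_mono)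
      have b2: "ana_le r (\<lambda>x. ?G y x) (C2 + 1)" if "ana_vec r y \<delta>" for y
        using ana_le_add[OF r d2[OF that] ana_le_const[of r "G a y0"]] e(2)
        by (auto simp: C_def intro: ana_le_mono)
      show "strict_diff_bound a y0 (\<lambda>x y. F x y * G x y) (\<lambda>j. F a y0 * L2 j + G a y0 * L1 j) \<eta> \<delta> r"
        unfolding strict_diff_bound_def
      proof (intro conjI allI impI)
        fix y :: "real^'a \<Rightarrow> real^'b" assume y: "ana_vec r y \<delta>"
        have 1: "ana_le r (\<lambda>x. (?F y x - F a y0) * ?G y x +
            F a y0 * (?G y x - G a y0)) (e * (C2 + 1) + C1 * e)"
          unfolding C_def(1) by (rule ana_le_add[OF r ana_le_mult[OF r d1[OF y] b2[OF y]] ana_le_cmult[OF d2[OF y]]])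
        have "e * (C2 + 1) + C1 * e = e * (C1 + C2 + 1)" by (simp add: algebra_simps)
        also have "\<dots> \<le> e * T" using e nn by (intro mult_left_mono) (auto simp: T_def)
        also note e(3)
        finally have le: "e * (C2 + 1) + C1 * e \<le> \<eta>" .
        show "ana_le r (\<lambda>x. ?F y x * ?G y x - F a y0 * G a y0) \<eta>"
          by (rule ana_le_mono[OF ana_le_cong[OF 1] le]) (simp add: algebra_simps)
      next
        fix y y' :: "real^'a \<Rightarrow> real^'b" and B 
        assume y: "ana_vec r y \<delta>" "ana_vec r y' \<delta>" "\<forall>j. ana_le r (\<lambda>x. y x $ j - y' x $ j) B"
        have B: "0 \<le> B" using y(3) ana_le_nonneg[OF r] by blast
        define E where "E F L x = F (a + x) (y0 + y x) - F (a + x) (y0 + y' x) - (\<Sum>j\<in>UNIV. L j * (y x $ j - y' x $ j))"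
          for F :: "real^'a \<Rightarrow> real^'b \<Rightarrow> real" and L x
        have E1: "ana_le r (E F L1) (e * B)" unfolding E_def using y by (intro strict_diff_bound2[OF s(1)]) auto
        have E2: "ana_le r (E G L2) (e * B)" unfolding E_def using y by (intro strict_diff_bound2[OF s(2)]) auto
        have l: "ana_le r (\<lambda>x. \<Sum>j\<in>UNIV. L j * (y x $ j - y' x $ j)) ((\<Sum>j\<in>UNIV. \<bar>L j\<bar>) * B)" for L :: "'b \<Rightarrow> real"
          unfolding sum_distrib_right using y(3) by (intro ana_le_sum r ana_le_cmult) auto
        \<comment> \<open>The remainder of the product consists of the two remainders
          \<open>E\<close>, each times a bounded factor, and of two terms that pay for replacing
          \<open>?F y x\<close> and \<open>?G y' x\<close> by their values at the base point in
          front of a linear part.\<close>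
        have 1: "ana_le r (\<lambda>x. (?F y x * E G L2 x +
            (?F y x - F a y0) * ?d L2 y y' x) +
            (?G y' x * E F L1 x +
            (?G y' x - G a y0) * ?d L1 y y' x))
            (((C1 + 1) * (e * B) + e * (l2 * B)) + ((C2 + 1) * (e * B) + e * (l1 * B)))"
          unfolding C_def(3,4)
          by (intro ana_le_add ana_le_mult r E1 E2 b1 b2 d1 d2 y l)
        have "((C1 + 1) * (e * B) + e * (l2 * B)) + ((C2 + 1) * (e * B) + e * (l1 * B)) = e * T * B"
          by (simp add: T_def algebra_simps)
        also have "\<dots> \<le> \<eta> * B" using e(3) B by (rule mult_right_mono)
        finally have le: "((C1 + 1) * (e * B) + e * (l2 * B)) + ((C2 + 1) * (e * B) + e * (l1 * B)) \<le> \<eta> * B" .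
        show "ana_le r (\<lambda>x. ?F y x * ?G y x
             - ?F y' x * ?G y' x
             - ?d (\<lambda>j. F a y0 * L2 j + G a y0 * L1 j) y y' x) (\<eta> * B)"
        proof (rule ana_le_mono[OF ana_le_cong[OF 1] le])
          fix x
          have "?d (\<lambda>j. F a y0 * L2 j + G a y0 * L1 j) y y' x =
            F a y0 * ?d L2 y y' x + G a y0 * ?d L1 y y' x"
            by (simp add: sum_distrib_left sum.distrib[symmetric] algebra_simps)
          then show "?F y x * E G L2 x +
            (?F y x - F a y0) * ?d L2 y y' x +
            (?G y' x * E F L1 x +
            (?G y' x - G a y0) * ?d L1 y y' x) =
            ?F y x * ?G y x
             - ?F y' x * ?G y' x
             - ?d (\<lambda>j. F a y0 * L2 j + G a y0 * L1 j) y y' x"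
            unfolding E_def by algebra
        qed
      qed
    qed
  qed
qed

text \<open>A constant function has its absolute value as coefficient norm, so testing the operator
  estimates on constant \<open>y\<close> gives pointwise estimates, from which differentiability and
  continuity follow.\<close>

lemma strict_diff_const_bounds:
  assumes "strict_diff a y0 F L" "0 < \<eta>"
  shows "\<exists>\<delta>>0. \<forall>x c. (\<forall>i. \<bar>x $ i\<bar> \<le> \<delta>) \<longrightarrow> (\<forall>j. \<bar>c $ j\<bar> \<le> \<delta>) \<longrightarrow>
     \<bar>F (a + x) (y0 + c) - F a y0\<bar> \<le> \<eta> \<and>
     \<bar>F (a + x) (y0 + c) - F (a + x) y0 - (\<Sum>j\<in>UNIV. L j * c $ j)\<bar> \<le> \<eta> * norm c"
proof -
  have "small_diff a y0 F L \<eta>"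
    using assms by (simp add: strict_diff_def)
  then have "\<forall>\<^sub>F \<delta> in at_right 0. 0 < \<delta> \<and> (\<forall>r. 0 < r \<and> r \<le> \<delta> \<longrightarrow> strict_diff_bound a y0 F L \<eta> \<delta> r)"
    using eventually_at_right_less[of "0::real"] by eventually_elim auto
  then obtain \<delta> where \<delta>: "0 < \<delta>" "\<And>r. 0 < r \<and> r \<le> \<delta> \<Longrightarrow> strict_diff_bound a y0 F L \<eta> \<delta> r"
    using eventually_happens'[OF trivial_limit_at_right_real] by blast
  have s: "strict_diff_bound a y0 F L \<eta> \<delta> \<delta>" using \<delta> by simp
  show ?thesis
  proof (intro exI conjI allI impI)
    fix x :: "real^'a" and c :: "real^'b" assume x: "\<forall>i. \<bar>x $ i\<bar> \<le> \<delta>" and c: "\<forall>j. \<bar>c $ j\<bar> \<le> \<delta>"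
    have x: "x \<in> cube \<delta>" using x by (simp add: cube_def)
    have 1: "ana_le \<delta> (\<lambda>x. c $ j) \<delta>" for j using c by (blast intro: ana_le_mono[OF ana_le_const])
    have 2: "ana_le \<delta> (\<lambda>x. (0::real^'b) $ j) \<delta>" for j
      using \<delta>(1) by (simp, intro ana_le_mono[OF ana_le_const[of _ 0, simplified]]) simp
    have 3: "ana_le \<delta> (\<lambda>x. c $ j - (0::real^'b) $ j) (norm c)" for j
      by (simp, rule ana_le_mono[OF ana_le_const component_le_norm_cart])
    show "\<bar>F (a + x) (y0 + c) - F a y0\<bar> \<le> \<eta>"
      using ana_le_bound[OF strict_diff_bound1[OF s 1] x] by simp
    show "\<bar>F (a + x) (y0 + c) - F (a + x) y0 - (\<Sum>j\<in>UNIV. L j * c $ j)\<bar> \<le> \<eta> * norm c"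
      using ana_le_bound[OF strict_diff_bound2[OF s 1 2 3] x] by simp
  qed (rule \<delta>(1))
qed

lemma strict_diff_has_derivative:
  assumes "strict_diff a y0 F L"
  shows "(F a has_derivative (\<lambda>h. \<Sum>j\<in>UNIV. L j * h $ j)) (at y0)"
  unfolding has_derivative_at_alt
proof (intro conjI allI impI)
  show "bounded_linear (\<lambda>h. \<Sum>j\<in>UNIV. L j * h $ j)"
    by (intro bounded_linear_sum bounded_linear_const_mult bounded_linear_vec_nth)
  fix e :: real assume "0 < e"
  from strict_diff_const_bounds[OF assms this] obtain \<delta> where \<delta>: "\<delta> > 0"
    and *: "\<And>x c. (\<forall>i. \<bar>x $ i\<bar> \<le> \<delta>) \<Longrightarrow> (\<forall>j. \<bar>c $ j\<bar> \<le> \<delta>) \<Longrightarrow>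
       \<bar>F (a + x) (y0 + c) - F (a + x) y0 - (\<Sum>j\<in>UNIV. L j * c $ j)\<bar> \<le> e * norm c" by blast
  have "norm (F a y - F a y0 - (\<Sum>j\<in>UNIV. L j * (y - y0) $ j)) \<le> e * norm (y - y0)" if "norm (y - y0) < \<delta>" for y
  proof -
    have "\<forall>j. \<bar>(y - y0) $ j\<bar> \<le> \<delta>" using component_le_norm_cart[of "y - y0"] that
      by (meson less_imp_le order_trans)
    from *[OF _ this, of 0] \<delta> show ?thesis by simp
  qed
  then show "\<exists>d>0. \<forall>y. norm (y - y0) < d \<longrightarrow>
       norm (F a y - F a y0 - (\<Sum>j\<in>UNIV. L j * (y - y0) $ j)) \<le> e * norm (y - y0)"
    using \<delta> by blast
qed

lemma strict_diff_isCont: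
  assumes "strict_diff a y0 F L"
  shows "isCont (\<lambda>p. F (fst p) (snd p)) (a, y0)"
  unfolding continuous_at_eps_delta
proof (intro allI impI)
  fix e :: real assume "0 < e"
  then have "0 < e / 2" by simp
  from strict_diff_const_bounds[OF assms this] obtain \<delta> where \<delta>: "\<delta> > 0"
    and *: "\<And>x c. (\<forall>i. \<bar>x $ i\<bar> \<le> \<delta>) \<Longrightarrow> (\<forall>j. \<bar>c $ j\<bar> \<le> \<delta>) \<Longrightarrow>
       \<bar>F (a + x) (y0 + c) - F a y0\<bar> \<le> e / 2" by blast
  have "dist (F (fst p) (snd p)) (F a y0) < e" if "dist p (a, y0) < \<delta>" for p
  proof -
    have n: "norm (fst p - a) \<le> \<delta>" "norm (snd p - y0) \<le> \<delta>"
      using that dist_fst_le[of p "(a, y0)"] dist_snd_le[of p "(a, y0)"] by (auto simp: dist_norm)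
    have "\<forall>j. \<bar>(fst p - a) $ j\<bar> \<le> \<delta>" using component_le_norm_cart[of "fst p - a"] n
      by (meson order_trans)
    moreover have "\<forall>j. \<bar>(snd p - y0) $ j\<bar> \<le> \<delta>" using component_le_norm_cart[of "snd p - y0"] n
      by (meson order_trans)
    ultimately show ?thesis using *[of "fst p - a" "snd p - y0"] \<open>0 < e\<close> by (simp add: dist_real_def)
  qed
  then show "\<exists>d>0. \<forall>x'. dist x' (a, y0) < d \<longrightarrow> dist (F (fst x') (snd x')) (F (fst (a, y0)) (snd (a, y0))) < e"
    using \<delta> by auto
qed

text \<open>Polynomials in \<open>y\<close> whose coefficients are analytic at \<open>a\<close>. The
  class contains real and imaginary parts of determinants and is closed under derivatives in
  \<open>y\<close>, so both equations of the critical point system lie in it, and strict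
  differentiability passes through its four rules.\<close>

inductive poly_ana :: "real^'d \<Rightarrow> (real^'d \<Rightarrow> real^'m \<Rightarrow> real) \<Rightarrow> bool" for a where
  coef: "real_analytic_at h a \<Longrightarrow> poly_ana a (\<lambda>x y. h x)"
| var: "poly_ana a (\<lambda>x y. y $ j)"
| add: "poly_ana a F \<Longrightarrow> poly_ana a G \<Longrightarrow> poly_ana a (\<lambda>x y. F x y + G x y)"
| mult: "poly_ana a F \<Longrightarrow> poly_ana a G \<Longrightarrow> poly_ana a (\<lambda>x y. F x y * G x y)"

lemma poly_ana_strict_diff: "poly_ana a F \<Longrightarrow> \<exists>L. strict_diff a y0 F L"
proof (induction rule: poly_ana.induct)
  case (coef h) then show ?case using strict_diff_coef by blast
next
  case (var j) then show ?case using strict_diff_var by blast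
next
  case (add F G) then show ?case using strict_diff_add by blast
next
  case (mult F G) then show ?case using strict_diff_mult by blast
qed

lemma poly_ana_isCont: "poly_ana a F \<Longrightarrow> isCont (\<lambda>p. F (fst p) (snd p)) (a, y0)"
  using poly_ana_strict_diff[of a F y0] strict_diff_isCont by blast

text \<open>By uniqueness of derivatives the linear part may be computed by ordinary differentiation
  at \<open>y0\<close>; \<open>poly_ana_strict_diff\<close> only provides its existence.\<close>

lemma poly_ana_strict_diff_derivative:
  assumes "poly_ana a F" "(F a has_derivative (\<lambda>h. \<Sum>j\<in>UNIV. L j * h $ j)) (at y0)"
  shows "strict_diff a y0 F L"
proof -
  obtain L' where L': "strict_diff a y0 F L'" using poly_ana_strict_diff[OF assms(1)] by blast
  have eq: "(\<lambda>h::real^'b. \<Sum>j\<in>UNIV. L' j * h $ j) = (\<lambda>h. \<Sum>j\<in>UNIV. L j * h $ j)"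
    using has_derivative_unique[OF strict_diff_has_derivative[OF L'] assms(2)] .
  have "L' = L"
  proof
    fix k
    show "L' k = L k" using fun_cong[OF eq, of "axis k 1"] by (simp add: axis_def if_distrib cong: if_cong)
  qed
  then show ?thesis using L' by simp
qed

lemma poly_ana_const: "poly_ana a (\<lambda>x y. b)"
  by (rule poly_ana.coef, rule ana_le_imp_real_analytic_at[where r = 1, OF _ ana_le_const]) auto

text \<open>The derivative formula holds for all \<open>x\<close>, although the coefficients are
  controlled only near \<open>a\<close>: they do not involve \<open>y\<close>. As the partial
  derivatives stay in the class, second derivatives are obtained by a further application.\<close>

lemma poly_ana_deriv:
  "poly_ana a F \<Longrightarrow> \<exists>F'. (\<forall>j. poly_ana a (F' j)) \<and>
    (\<forall>x y. (F x has_derivative (\<lambda>h. \<Sum>j\<in>UNIV. F' j x y * h $ j)) (at y))"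
proof (induction rule: poly_ana.induct)
  case (coef h)
  then show ?case by (intro exI[of _ "\<lambda>j x y. 0"]) (auto intro: poly_ana_const)
next
  case (var k)
  have "((\<lambda>y. y $ k) has_derivative (\<lambda>h. \<Sum>j\<in>UNIV. (if j = k then 1 else 0) * h $ j)) (at y)" for y :: "real^'b"
    using bounded_linear_imp_has_derivative[OF bounded_linear_vec_nth[of k]]
    by (simp add: if_distrib[of "\<lambda>x. x * _"] cong: if_cong)
  then show ?case by (intro exI[of _ "\<lambda>j x y. if j = k then 1 else 0"]) (auto intro: poly_ana_const)
next
  case (add F G)
  then obtain D1 D2 where poly_ana: "\<And>j. poly_ana a (D1 j)" "\<And>j. poly_ana a (D2 j)" and
    d: "\<And>x y. (F x has_derivative (\<lambda>h. \<Sum>j\<in>UNIV. D1 j x y * h $ j)) (at y)"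
    "\<And>x y. (G x has_derivative (\<lambda>h. \<Sum>j\<in>UNIV. D2 j x y * h $ j)) (at y)" by blast
  show ?case
    by (intro exI[of _ "\<lambda>j x y. D1 j x y + D2 j x y"] conjI allI poly_ana.add poly_ana
        has_derivative_eq_rhs[OF has_derivative_add[OF d]]) (simp add: algebra_simps sum.distrib)
next
  case (mult F G)
  then obtain D1 D2 where poly_ana: "\<And>j. poly_ana a (D1 j)" "\<And>j. poly_ana a (D2 j)" and
    d: "\<And>x y. (F x has_derivative (\<lambda>h. \<Sum>j\<in>UNIV. D1 j x y * h $ j)) (at y)"
    "\<And>x y. (G x has_derivative (\<lambda>h. \<Sum>j\<in>UNIV. D2 j x y * h $ j)) (at y)" by blast
  show ?case
    by (intro exI[of _ "\<lambda>j x y. F x y * D2 j x y + D1 j x y * G x y"] conjI allI poly_ana.add poly_ana.mult poly_ana mult.hyps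
        has_derivative_eq_rhs[OF has_derivative_mult[OF d]])
      (simp add: algebra_simps sum.distrib sum_distrib_left sum_distrib_right)
qed

lemma poly_ana_minus: "poly_ana a F \<Longrightarrow> poly_ana a (\<lambda>x y. - F x y)"
  using poly_ana.mult[OF poly_ana_const[of a "-1"]] by simp

lemma poly_ana_diff: "poly_ana a F \<Longrightarrow> poly_ana a G \<Longrightarrow> poly_ana a (\<lambda>x y. F x y - G x y)"
  using poly_ana.add[OF _ poly_ana_minus] by fastforce

lemma poly_ana_sum: "(\<And>i. i \<in> A \<Longrightarrow> poly_ana a (F i)) \<Longrightarrow> poly_ana a (\<lambda>x y. \<Sum>i\<in>A. F i x y)"
  by (induction A rule: infinite_finite_induct) (auto intro: poly_ana_const poly_ana.add)

lemma poly_ana_power: "poly_ana a F \<Longrightarrow> poly_ana a (\<lambda>x y. F x y ^ n)"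
  by (induction n) (auto intro: poly_ana_const poly_ana.mult)

text \<open>Two radii are chosen in this order: \<open>\<rho>\<close> makes the map contract by 1/2
  on functions of norm at most \<open>\<rho>\<close>; with \<open>\<rho>\<close> fixed, a small
  enough cube makes the image of 0 at most \<open>\<rho> / 2\<close>. Iteration from 0 then never
  leaves the ball of radius \<open>\<rho>\<close>.\<close>

lemma poly_ana_contraction_bounds:
  fixes \<Phi> :: "'m \<Rightarrow> real^'d \<Rightarrow> real^'m \<Rightarrow> real"
  assumes poly_ana: "\<And>i. poly_ana a (\<Phi> i)" and zero: "\<And>i. \<Phi> i a y0 = 0"
    and deriv: "\<And>i. (\<Phi> i a has_derivative (\<lambda>h. 0)) (at y0)"
  shows "\<exists>\<rho>>0. \<exists>r>0.
    (\<forall>i. ana_le r (\<lambda>x. \<Phi> i (a + x) y0) (\<rho> / 2)) \<and>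
    (\<forall>y y' B i. ana_vec r y \<rho> \<longrightarrow> ana_vec r y' \<rho> \<longrightarrow>
       (\<forall>j. ana_le r (\<lambda>x. y x $ j - y' x $ j) B) \<longrightarrow>
       ana_le r (\<lambda>x. \<Phi> i (a + x) (y0 + y x) - \<Phi> i (a + x) (y0 + y' x)) (B / 2))"
proof -
  have strict_diff: "strict_diff a y0 (\<Phi> i) (\<lambda>_. 0)" for i
    by (rule poly_ana_strict_diff_derivative[OF poly_ana]) (simp add: deriv)
  have ev: "\<forall>\<^sub>F \<delta> in at_right 0. \<forall>i. \<forall>r. 0 < r \<and> r \<le> \<delta> \<longrightarrow> strict_diff_bound a y0 (\<Phi> i) (\<lambda>_. 0) \<eta> \<delta> r" if "0 < \<eta>" for \<eta>
    using strict_diff that unfolding strict_diff_def by (intro eventually_all_finite) auto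
  have ex: "\<exists>\<delta>>0. \<forall>i r. 0 < r \<and> r \<le> \<delta> \<longrightarrow> strict_diff_bound a y0 (\<Phi> i) (\<lambda>_. 0) \<eta> \<delta> r" if "0 < \<eta>" for \<eta>
    using eventually_happens'[OF trivial_limit_at_right_real
        eventually_conj[OF eventually_at_right_less[of "0::real"] ev[OF that]]] by blast
  obtain \<rho> where \<rho>: "\<rho> > 0" "\<And>i r. 0 < r \<Longrightarrow> r \<le> \<rho> \<Longrightarrow> strict_diff_bound a y0 (\<Phi> i) (\<lambda>_. 0) (1/2) \<rho> r"
    using ex[of "1/2"] by auto
  obtain \<delta> where \<delta>: "\<delta> > 0" "\<And>i r. 0 < r \<Longrightarrow> r \<le> \<delta> \<Longrightarrow> strict_diff_bound a y0 (\<Phi> i) (\<lambda>_. 0) (\<rho> / 2) \<delta> r"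
    using ex[of "\<rho> / 2"] \<rho>(1) by auto
  define r where "r = min \<rho> \<delta>"
  have r: "0 < r" "r \<le> \<rho>" "r \<le> \<delta>" using \<rho>(1) \<delta>(1) by (auto simp: r_def)
  have "ana_le r (\<lambda>x. \<Phi> i (a + x) y0) (\<rho> / 2)" for i
  proof -
    have z: "ana_le r (\<lambda>x. (0::real^'m) $ j) \<delta>" for j
      using \<delta>(1) by (simp, intro ana_le_mono[OF ana_le_const[of _ 0, simplified]]) simp
    show ?thesis using strict_diff_bound1[OF \<delta>(2)[OF r(1,3), of i], of "\<lambda>_. 0", OF z] by (simp add: zero)
  qed
  moreover have "ana_le r (\<lambda>x. \<Phi> i (a + x) (y0 + y x) - \<Phi> i (a + x) (y0 + y' x)) (B / 2)"
    if "ana_vec r y \<rho>" "ana_vec r y' \<rho>" "\<forall>j. ana_le r (\<lambda>x. y x $ j - y' x $ j) B"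
    for y y' :: "real^'d \<Rightarrow> real^'m" and B i
    using strict_diff_bound2[OF \<rho>(2)[OF r(1,2), of i], of y y' B] that by simp
  ultimately show ?thesis using \<rho>(1) r(1) by blast
qed

text \<open>Picard iteration from 0 in the coefficient norm yields the analytic solution. Uniqueness
  is claimed among points \<open>c\<close>, not among functions, so that a solution found at a
  single parameter by other means coincides with \<open>Z x\<close>.\<close>

lemma analytic_fixed_point:
  fixes \<Phi> :: "'m \<Rightarrow> real^'d \<Rightarrow> real^'m \<Rightarrow> real"
  assumes poly_ana: "\<And>i. poly_ana a (\<Phi> i)" and zero: "\<And>i. \<Phi> i a y0 = 0"
    and deriv: "\<And>i. (\<Phi> i a has_derivative (\<lambda>h. 0)) (at y0)"
  shows "\<exists>Z r \<rho>. 0 < r \<and> 0 < \<rho> \<and> (\<forall>i. ana_le r (\<lambda>x. Z x $ i) \<rho>) \<and>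
    (\<forall>x\<in>cube r. (\<forall>i. \<Phi> i (a + x) (y0 + Z x) = Z x $ i) \<and>
      (\<forall>c. (\<forall>i. \<bar>c $ i\<bar> \<le> \<rho>) \<longrightarrow> (\<forall>i. \<Phi> i (a + x) (y0 + c) = c $ i) \<longrightarrow> c = Z x))"
proof -
  from poly_ana_contraction_bounds[of a \<Phi> y0, OF assms] obtain \<rho> r where \<rho>: "\<rho> > 0" and r: "r > 0"
    and start: "\<forall>i. ana_le r (\<lambda>x. \<Phi> i (a + x) y0) (\<rho> / 2)"
    and contr': "\<forall>y y' B i. ana_vec r y \<rho> \<longrightarrow> ana_vec r y' \<rho> \<longrightarrow>
       (\<forall>j. ana_le r (\<lambda>x. y x $ j - y' x $ j) B) \<longrightarrow>
       ana_le r (\<lambda>x. \<Phi> i (a + x) (y0 + y x) - \<Phi> i (a + x) (y0 + y' x)) (B / 2)"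
    by (elim exE conjE) (rule that)
  have contr: "ana_le r (\<lambda>x. \<Phi> i (a + x) (y0 + y x) - \<Phi> i (a + x) (y0 + y' x)) (B / 2)"
    if "\<And>j. ana_le r (\<lambda>x. y x $ j) \<rho>" "\<And>j. ana_le r (\<lambda>x. y' x $ j) \<rho>" "\<And>j. ana_le r (\<lambda>x. y x $ j - y' x $ j) B"
    for y y' :: "real^'d \<Rightarrow> real^'m" and B i
    using contr' that by blast
  define T where "T y x = (\<chi> i. \<Phi> i (a + x) (y0 + y x))" for y :: "real^'d \<Rightarrow> real^'m" and x
  define Y where "Y n = (T ^^ n) (\<lambda>_. 0)" for n
  have Y_Suc: "Y (Suc n) x $ i = \<Phi> i (a + x) (y0 + Y n x)" for n x i
    by (simp add: Y_def T_def)
  \<comment> \<open>The bounds on the increments sum to \<open>\<rho> * (1 - (1/2) ^ n)\<close>, so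
    every iterate stays in the ball where \<open>contr\<close> applies.\<close>
  have step: "(\<forall>j. ana_le r (\<lambda>x. Y n x $ j) (\<rho> * (1 - (1/2) ^ n))) \<and>
      (\<forall>j. ana_le r (\<lambda>x. Y (Suc n) x $ j - Y n x $ j) (\<rho> * (1/2) ^ Suc n))" for n
  proof (induction n)
    case 0
    have "ana_le r (\<lambda>x. 0) 0" using ana_le_const[of r 0] by simp
    then show ?case using start by (simp add: Y_Suc) (simp add: Y_def)
  next
    case (Suc n)
    have a1: "ana_le r (\<lambda>x. Y (Suc n) x $ j) (\<rho> * (1 - (1/2) ^ Suc n))" for j
    proof -
      have "ana_le r (\<lambda>x. Y n x $ j + (Y (Suc n) x $ j - Y n x $ j)) (\<rho> * (1 - (1/2) ^ n) + \<rho> * (1/2) ^ Suc n)"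
        using Suc by (intro ana_le_add r) auto
      then show ?thesis by (simp add: algebra_simps)
    qed
    have le: "\<rho> * (1 - (1/2) ^ k) \<le> \<rho>" for k
      using \<rho> by (simp add: mult_left_le)
    have a2: "ana_le r (\<lambda>x. \<Phi> j (a + x) (y0 + Y (Suc n) x) - \<Phi> j (a + x) (y0 + Y n x)) (\<rho> * (1/2) ^ Suc n / 2)" for j
      by (rule contr) (use Suc in \<open>blast intro: ana_le_mono[OF a1 le] ana_le_mono[OF _ le]\<close>)+
    have "ana_le r (\<lambda>x. Y (Suc (Suc n)) x $ j - Y (Suc n) x $ j) (\<rho> * (1/2) ^ Suc (Suc n))" for j
      using a2[of j] unfolding Y_Suc[symmetric] by simp
    with a1 show ?case by blast
  qed
  have Y_le: "\<bar>Y n x $ j\<bar> \<le> \<rho>" if "x \<in> cube r" for n x j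
  proof -
    have "\<bar>Y n x $ j\<bar> \<le> \<rho> * (1 - (1/2) ^ n)" using step ana_le_bound[OF _ that] by blast
    also have "\<dots> \<le> \<rho>" using \<rho> by (simp add: mult_left_le)
    finally show ?thesis .
  qed
  define Z where "Z x = (\<chi> j. \<Sum>n. Y (Suc n) x $ j - Y n x $ j)" for x
  have geo: "(\<lambda>n. \<rho> * (1/2) ^ Suc n) sums \<rho>"
    using sums_mult[OF power_half_series, of \<rho>] by simp
  have Z: "ana_le r (\<lambda>x. Z x $ j) \<rho>" for j
  proof -
    have "ana_le r (\<lambda>x. \<Sum>n. Y (Suc n) x $ j - Y n x $ j) (\<Sum>n. \<rho> * (1/2) ^ Suc n)"
      by (rule ana_le_suminf[OF r]) (use step geo in \<open>auto simp only: sums_iff\<close>)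
    then show ?thesis using geo by (simp add: Z_def sums_iff)
  qed
  have lim: "(\<lambda>n. Y n x $ j) \<longlonglongrightarrow> Z x $ j" if x: "x \<in> cube r" for x j
  proof -
    have "summable (\<lambda>n. Y (Suc n) x $ j - Y n x $ j)"
    proof (rule summable_comparison_test[OF _ sums_summable[OF geo]])
      show "\<exists>N. \<forall>n\<ge>N. norm (Y (Suc n) x $ j - Y n x $ j) \<le> \<rho> * (1/2) ^ Suc n"
        using step ana_le_bound[OF _ x] unfolding real_norm_def by blast
    qed
    then have "(\<lambda>n. \<Sum>k<n. Y (Suc k) x $ j - Y k x $ j) \<longlonglongrightarrow> Z x $ j"
      unfolding Z_def using summable_LIMSEQ by simp
    moreover have "Y 0 x $ j = 0" by (simp add: Y_def)
    ultimately show ?thesis using sum_lessThan_telescope[of "\<lambda>k. Y k x $ j"] by simp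
  qed
  have pcontr: "\<bar>\<Phi> i (a + x) (y0 + c) - \<Phi> i (a + x) (y0 + c')\<bar> \<le> B / 2"
    if "x \<in> cube r" "\<And>j. \<bar>c $ j\<bar> \<le> \<rho>" "\<And>j. \<bar>c' $ j\<bar> \<le> \<rho>" "\<And>j. \<bar>c $ j - c' $ j\<bar> \<le> B" for x c c' B i
    by (rule ana_le_bound[OF contr[where y = "\<lambda>_. c" and y' = "\<lambda>_. c'"] that(1)])
      (use that in \<open>auto intro: ana_le_mono[OF ana_le_const]\<close>)
  have Z_le: "\<bar>Z x $ j\<bar> \<le> \<rho>" if "x \<in> cube r" for x j
    by (rule ana_le_bound[OF Z that])
  have fp: "\<Phi> i (a + x) (y0 + Z x) = Z x $ i" if x: "x \<in> cube r" for x i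
  proof -
    define B where "B n = (\<Sum>j\<in>UNIV. \<bar>Y n x $ j - Z x $ j\<bar>)" for n
    have "B \<longlonglongrightarrow> (\<Sum>j\<in>UNIV. \<bar>Z x $ j - Z x $ j\<bar>)"
      unfolding B_def by (intro tendsto_sum tendsto_rabs tendsto_diff lim[OF x] tendsto_const)
    then have "(\<lambda>n. B n / 2) \<longlonglongrightarrow> 0" using tendsto_divide[OF _ tendsto_const, of B 0 sequentially 2] by simp
    moreover have "\<bar>Y n x $ j - Z x $ j\<bar> \<le> B n" for n j
      unfolding B_def by (rule member_le_sum) auto
    then have "\<forall>n. norm (Y (Suc n) x $ i - \<Phi> i (a + x) (y0 + Z x)) \<le> B n / 2"
      unfolding Y_Suc real_norm_def using pcontr[OF x Y_le[OF x] Z_le[OF x]] by blast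
    ultimately have "(\<lambda>n. Y (Suc n) x $ i - \<Phi> i (a + x) (y0 + Z x)) \<longlonglongrightarrow> 0"
      by (rule Lim_null_comparison[OF always_eventually, rotated])
    then have "(\<lambda>n. Y (Suc n) x $ i) \<longlonglongrightarrow> \<Phi> i (a + x) (y0 + Z x)" by (simp add: LIM_zero_iff)
    then show ?thesis using LIMSEQ_unique[OF _ LIMSEQ_Suc[OF lim[OF x]]] by blast
  qed
  have uniq: "c = Z x" if x: "x \<in> cube r" and c: "\<forall>i. \<bar>c $ i\<bar> \<le> \<rho>" "\<forall>i. \<Phi> i (a + x) (y0 + c) = c $ i" for x c
  proof -
    define B where "B = Max (range (\<lambda>j. \<bar>c $ j - Z x $ j\<bar>))"
    have B: "\<bar>c $ j - Z x $ j\<bar> \<le> B" for j by (simp add: B_def)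
    have "\<bar>c $ j - Z x $ j\<bar> \<le> B / 2" for j
      using pcontr[OF x, of c "Z x" B j] c Z_le[OF x] B fp[OF x] by simp
    then have "B \<le> B / 2" unfolding B_def by (subst Max_le_iff) auto
    then have "\<bar>c $ j - Z x $ j\<bar> \<le> 0" for j using B[of j] by linarith
    then show ?thesis by (simp add: vec_eq_iff)
  qed
  show ?thesis using r \<rho> Z fp uniq by blast
qed

text \<open>Newton's iteration with the Jacobian frozen at the base point: with \<open>D\<close> the
  inverse of \<open>J\<close>, the map y - y0 - D F has derivative 0 at \<open>y0\<close> and is
  contracting nearby. In the unknown y - y0 its fixed points are the zeros of \<open>F\<close>,
  because \<open>D\<close> is injective.\<close>

lemma analytic_implicit_function:
  fixes F :: "'m \<Rightarrow> real^'d \<Rightarrow> real^'m \<Rightarrow> real"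
  assumes poly_ana: "\<And>i. poly_ana a (F i)" and zero: "\<And>i. F i a y0 = 0"
    and deriv: "\<And>i. (F i a has_derivative (\<lambda>h. (J *v h) $ i)) (at y0)" and J: "invertible J"
  shows "\<exists>Y \<delta>. \<delta> > 0 \<and> (\<forall>i. real_analytic_at (\<lambda>x. Y x $ i) a) \<and> Y a = y0 \<and>
    (\<forall>x\<in>ball a \<delta>. (\<forall>i. F i x (Y x) = 0) \<and> (\<forall>y\<in>ball y0 \<delta>. (\<forall>i. F i x y = 0) \<longrightarrow> y = Y x))"
proof -
  obtain D where D: "D ** J = mat 1" "J ** D = mat 1" using J unfolding invertible_def by blast
  define \<Phi> where "\<Phi> i x y = y $ i - y0 $ i - (\<Sum>j\<in>UNIV. D $ i $ j * F j x y)" for i x y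
  have poly_ana\<Phi>: "poly_ana a (\<Phi> i)" for i
    unfolding \<Phi>_def by (intro poly_ana_diff poly_ana_sum poly_ana.var poly_ana_const poly_ana.mult poly_ana)
  have zero\<Phi>: "\<Phi> i a y0 = 0" for i by (simp add: \<Phi>_def zero)
  have deriv\<Phi>: "(\<Phi> i a has_derivative (\<lambda>h. 0)) (at y0)" for i
  proof -
    have "(\<Phi> i a has_derivative (\<lambda>h. h $ i - 0 - (\<Sum>j\<in>UNIV. D $ i $ j * (J *v h) $ j))) (at y0)"
      unfolding \<Phi>_def
      by (intro has_derivative_diff has_derivative_sum has_derivative_mult_right deriv has_derivative_const
          bounded_linear_imp_has_derivative[OF bounded_linear_vec_nth])
    moreover have "(\<Sum>j\<in>UNIV. D $ i $ j * (J *v h) $ j) = h $ i" for h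
    proof -
      have "(\<Sum>j\<in>UNIV. D $ i $ j * (J *v h) $ j) = (D *v (J *v h)) $ i"
        by (simp add: matrix_vector_mult_def)
      also have "\<dots> = h $ i" by (simp add: matrix_vector_mul_assoc D)
      finally show ?thesis .
    qed
    ultimately show ?thesis by simp
  qed
  have fix_iff: "(\<forall>i. \<Phi> i x (y0 + c) = c $ i) \<longleftrightarrow> (\<forall>i. F i x (y0 + c) = 0)" for x c
  proof
    assume *: "\<forall>i. \<Phi> i x (y0 + c) = c $ i"
    have "D *v (\<chi> j. F j x (y0 + c)) = 0"
      using * by (simp add: \<Phi>_def vec_eq_iff matrix_vector_mult_def)
    then have "(J ** D) *v (\<chi> j. F j x (y0 + c)) = 0"
      by (simp add: matrix_vector_mul_assoc[symmetric])
    then show "\<forall>i. F i x (y0 + c) = 0" by (simp add: D vec_eq_iff)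
  qed (simp add: \<Phi>_def)
  from analytic_fixed_point[of a \<Phi> y0, OF poly_ana\<Phi> zero\<Phi> deriv\<Phi>] obtain Z r \<rho> where
    r: "0 < r" "0 < \<rho>" and Z: "\<forall>i. ana_le r (\<lambda>x. Z x $ i) \<rho>"
    and fp: "\<forall>x\<in>cube r. (\<forall>i. \<Phi> i (a + x) (y0 + Z x) = Z x $ i) \<and>
      (\<forall>c. (\<forall>i. \<bar>c $ i\<bar> \<le> \<rho>) \<longrightarrow> (\<forall>i. \<Phi> i (a + x) (y0 + c) = c $ i) \<longrightarrow> c = Z x)"
    by (elim exE conjE) (rule that)
  have sol: "\<forall>i. F i (a + x) (y0 + Z x) = 0" if "x \<in> cube r" for x
    using fp that fix_iff by blast
  have uniq: "c = Z x" if "x \<in> cube r" "\<forall>i. \<bar>c $ i\<bar> \<le> \<rho>" "\<forall>i. F i (a + x) (y0 + c) = 0" for x c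
    using fp that fix_iff by blast
  have sub: "x - a \<in> cube r" if "x \<in> ball a (min r \<rho>)" for x
    using ball_subset_cube[of r] that by (auto simp: dist_norm norm_minus_commute)
  have sub2: "\<forall>i. \<bar>(y - y0) $ i\<bar> \<le> \<rho>" if "y \<in> ball y0 (min r \<rho>)" for y
    using component_le_norm_cart[of "y - y0"] that
    by (auto simp: dist_norm norm_minus_commute intro: order_trans less_imp_le)
  show ?thesis
  proof (intro exI conjI allI ballI impI)
    show "min r \<rho> > 0" using r by simp
    show "real_analytic_at (\<lambda>x. (y0 + Z (x - a)) $ i) a" for i
      by (rule ana_le_imp_real_analytic_at[OF r(1) ana_le_add[OF r(1) ana_le_const Z[rule_format]]]) simp
    have "0 = Z 0" using uniq[of 0 0] r by (simp add: zero)
    then show "y0 + Z (a - a) = y0" by simp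
    show "F i x (y0 + Z (x - a)) = 0" if "x \<in> ball a (min r \<rho>)" for i x
      using sol[OF sub[OF that]] by simp
    show "y = y0 + Z (x - a)" if "x \<in> ball a (min r \<rho>)" "y \<in> ball y0 (min r \<rho>)" "\<forall>i. F i x y = 0" for x y
      using uniq[OF sub[OF that(1)] sub2[OF that(2)]] that(3) by (simp add: algebra_simps)
  qed
qed

section \<open>Complex-valued functions of this class and determinants\<close>

definition cpoly_ana :: "real^'d \<Rightarrow> (real^'d \<Rightarrow> real^'m \<Rightarrow> complex) \<Rightarrow> bool" where
  "cpoly_ana a F \<longleftrightarrow> poly_ana a (\<lambda>x y. Re (F x y)) \<and> poly_ana a (\<lambda>x y. Im (F x y))"

lemma cpoly_ana_const: "cpoly_ana a (\<lambda>x y. b)"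
  by (simp add: cpoly_ana_def poly_ana_const)

lemma cpoly_ana_of_real: "poly_ana a F \<Longrightarrow> cpoly_ana a (\<lambda>x y. complex_of_real (F x y))"
  by (simp add: cpoly_ana_def poly_ana_const)

lemma cpoly_ana_add: "cpoly_ana a F \<Longrightarrow> cpoly_ana a G \<Longrightarrow> cpoly_ana a (\<lambda>x y. F x y + G x y)"
  by (simp add: cpoly_ana_def poly_ana.add)

lemma cpoly_ana_diff: "cpoly_ana a F \<Longrightarrow> cpoly_ana a G \<Longrightarrow> cpoly_ana a (\<lambda>x y. F x y - G x y)"
  by (simp add: cpoly_ana_def poly_ana_diff)

lemma cpoly_ana_mult: "cpoly_ana a F \<Longrightarrow> cpoly_ana a G \<Longrightarrow> cpoly_ana a (\<lambda>x y. F x y * G x y)"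
  by (simp add: cpoly_ana_def poly_ana.add poly_ana.mult poly_ana_diff)

lemma cpoly_ana_cnj: "cpoly_ana a F \<Longrightarrow> cpoly_ana a (\<lambda>x y. cnj (F x y))"
  by (simp add: cpoly_ana_def poly_ana_minus)

lemma cpoly_ana_sum: "(\<And>i. i \<in> A \<Longrightarrow> cpoly_ana a (F i)) \<Longrightarrow> cpoly_ana a (\<lambda>x y. \<Sum>i\<in>A. F i x y)"
  by (simp add: cpoly_ana_def poly_ana_sum)

lemma cpoly_ana_prod: "(\<And>i. i \<in> A \<Longrightarrow> cpoly_ana a (F i)) \<Longrightarrow> cpoly_ana a (\<lambda>x y. \<Prod>i\<in>A. F i x y)"
  by (induction A rule: infinite_finite_induct) (auto intro: cpoly_ana_const cpoly_ana_mult)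

lemma cpoly_ana_power: "cpoly_ana a F \<Longrightarrow> cpoly_ana a (\<lambda>x y. F x y ^ n)"
  by (induction n) (auto intro: cpoly_ana_const cpoly_ana_mult)

lemma cpoly_ana_det:
  assumes "\<And>i j. cpoly_ana a (\<lambda>x y. A x y $ i $ j)"
  shows "cpoly_ana a (\<lambda>x y. det (A x y :: complex^'n^'n))"
  unfolding det_def by (intro cpoly_ana_sum cpoly_ana_mult cpoly_ana_prod cpoly_ana_const assms)

subsection \<open>Smallest singular values\<close>

lemma inner_complex_Re: "(a::complex) \<bullet> b = Re (cnj a * b)"
  by (simp add: inner_complex_def)

lemma inner_cadjoint: "(A *v x) \<bullet> y = x \<bullet> (cadjoint A *v y)" for A :: "complex^'n^'m"
proof -
  have "(A *v x) \<bullet> y = (\<Sum>i\<in>UNIV. \<Sum>j\<in>UNIV. Re (cnj (A $ i $ j) * cnj (x $ j) * y $ i))"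
    by (simp add: inner_vec_def matrix_vector_mult_def inner_complex_Re sum_distrib_right cnj_sum Re_sum)
  also have "\<dots> = (\<Sum>j\<in>UNIV. \<Sum>i\<in>UNIV. Re (cnj (A $ i $ j) * cnj (x $ j) * y $ i))"
    by (rule sum.swap)
  also have "\<dots> = x \<bullet> (cadjoint A *v y)"
    by (simp add: inner_vec_def matrix_vector_mult_def inner_complex_Re sum_distrib_left Re_sum cadjoint_def
        map_matrix_def transpose_def mult_ac)
  finally show ?thesis .
qed

lemma cadjoint_cadjoint [simp]: "cadjoint (cadjoint A) = A"
  by (simp add: cadjoint_def map_matrix_def transpose_def vec_eq_iff)

lemma norm_matrix_vector_le: "norm (A *v x) \<le> norm A * norm x" for A :: "complex^'n^'m"
proof -
  have "norm ((A *v x) $ i) \<le> norm (A $ i) * norm x" for i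
  proof -
    have "norm ((A *v x) $ i) \<le> (\<Sum>j\<in>UNIV. \<bar>norm (A $ i $ j)\<bar> * \<bar>norm (x $ j)\<bar>)"
      unfolding matrix_vector_mult_def by (simp, rule order_trans[OF norm_sum]) (simp add: norm_mult)
    also have "\<dots> \<le> norm (A $ i) * norm x"
      unfolding norm_vec_def by (rule L2_set_mult_ineq)
    finally show ?thesis .
  qed
  then have "norm (A *v x) \<le> L2_set (\<lambda>i. norm (A $ i) * norm x) UNIV"
    unfolding norm_vec_def[of "A *v x"] by (intro L2_set_mono) auto
  also have "\<dots> = norm A * norm x"
    by (simp add: norm_vec_def[of A] L2_set_left_distrib)
  finally show ?thesis .
qed

lemma bounded_bilinear_matrix_vector:
  "bounded_bilinear (\<lambda>(A::complex^'n^'m) x. A *v x)"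
proof
  show "\<exists>K. \<forall>(A::complex^'n^'m) x. norm (A *v x) \<le> norm A * norm x * K"
    using norm_matrix_vector_le by (intro exI[of _ 1]) auto
qed (simp_all add: matrix_vector_mult_def vec_eq_iff scaleR_sum_right sum.distrib algebra_simps)

lemma scale_eq_scaleR: "complex_of_real c *s x = c *\<^sub>R x" for x :: "complex^'n"
  by (simp add: vec_eq_iff scaleR_conv_of_real[where 'a = complex])

lemma quadratic_nonneg_imp_linear_zero:
  fixes p c :: real
  assumes "\<And>t. 0 \<le> 2 * t * p + t\<^sup>2 * c"
  shows "p = 0"
proof (rule ccontr)
  assume "p \<noteq> 0"
  \<comment> \<open>A positive upper bound of \<open>c\<close>, so that the value at
    \<open>t = - p / q\<close> is at most \<open>- (p\<^sup>2 / q)\<close>.\<close>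
  define q where "q = \<bar>c\<bar> + 1"
  have q: "q > 0" "c \<le> q" by (auto simp: q_def)
  have "0 \<le> 2 * (- p / q) * p + (- p / q)\<^sup>2 * c" by (rule assms)
  also have "\<dots> \<le> 2 * (- p / q) * p + (- p / q)\<^sup>2 * q"
    using q by (intro add_left_mono mult_left_mono) auto
  also have "\<dots> = - (p\<^sup>2 / q)" using q by (simp add: power2_eq_square field_simps)
  also have "\<dots> < 0" using \<open>p \<noteq> 0\<close> q by simp
  finally show False by simp
qed

lemma norm_add_scaleR_sq:
  "(norm (a + t *\<^sub>R b))\<^sup>2 = (norm a)\<^sup>2 + 2 * t * (a \<bullet> b) + t\<^sup>2 * (norm (b::'a::real_inner))\<^sup>2"
  unfolding power2_norm_eq_inner
  by (simp add: inner_add_left inner_add_right inner_commute power2_eq_square algebra_simps)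

text \<open>The norm of \<open>A *v v\<close> attains a minimum \<open>m\<close> on the unit sphere
  by compactness. The first-order condition makes a minimizer an eigenvector of
  \<open>cadjoint A ** A\<close>, and every singular value is a quotient
  \<open>norm (A *v x) / norm x\<close>, hence at least \<open>m\<close>. In particular the
  \<open>LEAST\<close> in \<open>sigma_min\<close> denotes.\<close>

lemma sigma_min_attained:
  fixes A :: "complex^'n^'n"
  obtains v where "norm v = 1" "norm (A *v v) = sigma_min A" "v \<in> singular_space A (sigma_min A)"
    "\<And>x. sigma_min A * norm x \<le> norm (A *v x)"
proof -
  interpret bb: bounded_bilinear "\<lambda>(A::complex^'n^'n) x. A *v x" by (rule bounded_bilinear_matrix_vector)
  have "continuous_on (sphere 0 1) (\<lambda>v::complex^'n. norm (A *v v))"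
    by (intro continuous_on_norm bb.continuous_on continuous_on_const continuous_on_id)
  moreover have "(axis undefined 1 :: complex^'n) \<in> sphere 0 1"
    by simp
  ultimately obtain v :: "complex^'n" where v: "norm v = 1" and min: "\<And>x. norm x = 1 \<Longrightarrow> norm (A *v v) \<le> norm (A *v x)"
    using continuous_attains_inf[of "sphere 0 1" "\<lambda>v::complex^'n. norm (A *v v)"] by auto
  define m where "m = norm (A *v v)"
  have m: "m * norm x \<le> norm (A *v x)" for x
  proof (cases "x = 0")
    case False
    have "m \<le> norm (A *v (inverse (norm x) *\<^sub>R x))" unfolding m_def using False by (intro min) simp
    then show ?thesis using False by (simp add: bb.scaleR_right field_simps)
  qed simp
  \<comment> \<open>The residual of the eigenvalue equation. Perturbing \<open>v\<close> in the
    direction \<open>z\<close> itself produces \<open>z \<bullet> z\<close> as the linear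
    coefficient, which must vanish at a minimum.\<close>
  define z where "z = (cadjoint A ** A) *v v - (m\<^sup>2) *\<^sub>R v"
  have "0 \<le> 2 * t * (z \<bullet> z) + t\<^sup>2 * ((norm (A *v z))\<^sup>2 - m\<^sup>2 * (norm z)\<^sup>2)" for t
  proof -
    have "(m * norm (v + t *\<^sub>R z))\<^sup>2 \<le> (norm (A *v (v + t *\<^sub>R z)))\<^sup>2"
      by (rule power_mono[OF m]) (simp add: m_def)
    moreover have "(norm (A *v (v + t *\<^sub>R z)))\<^sup>2 = m\<^sup>2 + 2 * t * ((A *v v) \<bullet> (A *v z)) + t\<^sup>2 * (norm (A *v z))\<^sup>2"
      unfolding bb.add_right bb.scaleR_right m_def by (rule norm_add_scaleR_sq)
    moreover have "(norm (v + t *\<^sub>R z))\<^sup>2 = 1 + 2 * t * (v \<bullet> z) + t\<^sup>2 * (norm z)\<^sup>2"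
      using v by (simp add: norm_add_scaleR_sq)
    moreover have "(A *v v) \<bullet> (A *v z) = (z + (m\<^sup>2) *\<^sub>R v) \<bullet> z"
    proof -
      have "(A *v v) \<bullet> (A *v z) = z \<bullet> (cadjoint A *v (A *v v))"
        by (subst inner_commute) (rule inner_cadjoint)
      also have "cadjoint A *v (A *v v) = z + (m\<^sup>2) *\<^sub>R v"
        by (simp add: z_def matrix_vector_mul_assoc)
      finally show ?thesis by (simp add: inner_commute)
    qed
    ultimately show ?thesis
      by (simp add: power_mult_distrib inner_add_left algebra_simps)
  qed
  from quadratic_nonneg_imp_linear_zero[OF this] have "z = 0" by simp
  then have sp: "v \<in> singular_space A m" by (simp add: singular_space_def z_def)
  have "sigma_min A = m"
    unfolding sigma_min_def
  proof (rule Least_equality)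
    have "v \<noteq> 0" using v by auto
    then show "m \<in> singular_values A" using sp by (auto simp: singular_values_def m_def)
    fix s assume "s \<in> singular_values A"
    then obtain x where s: "s \<ge> 0" and x: "x \<noteq> 0" "(cadjoint A ** A) *v x = (s\<^sup>2) *\<^sub>R x"
      by (auto simp: singular_values_def singular_space_def)
    have "(norm (A *v x))\<^sup>2 = (A *v x) \<bullet> (A *v x)" by (simp add: power2_norm_eq_inner)
    also have "\<dots> = x \<bullet> ((cadjoint A ** A) *v x)" by (simp add: inner_cadjoint matrix_vector_mul_assoc)
    also have "\<dots> = (s * norm x)\<^sup>2" by (simp add: x power_mult_distrib power2_norm_eq_inner)
    finally have "norm (A *v x) = s * norm x" using s by (simp add: power2_eq_iff_nonneg)
    then show "m \<le> s" using m[of x] x by simp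
  qed
  then show ?thesis using that[of v] v sp m by (simp add: m_def)
qed

lemma sigma_min_le: "sigma_min A * norm x \<le> norm (A *v x)"
  using sigma_min_attained[of A] by metis

lemma sigma_min_Lipschitz: "sigma_min A \<le> sigma_min B + norm (A - B)"
proof -
  interpret bb: bounded_bilinear "\<lambda>(A::complex^'a^'a) x. A *v x" by (rule bounded_bilinear_matrix_vector)
  obtain v where v: "norm v = 1" "norm (B *v v) = sigma_min B" using sigma_min_attained[of B] by metis
  have "sigma_min A \<le> norm (A *v v)" using sigma_min_le[of A v] v by simp
  also have "A *v v = B *v v + (A - B) *v v" by (simp add: bb.diff_left)
  also have "norm \<dots> \<le> norm (B *v v) + norm ((A - B) *v v)" by (rule norm_triangle_ineq)
  also have "\<dots> \<le> sigma_min B + norm (A - B)" using v norm_matrix_vector_le[of "A - B" v] by simp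
  finally show ?thesis .
qed

lemma isCont_sigma_min: "isCont sigma_min A"
  unfolding continuous_at_eps_delta
proof (intro allI impI)
  fix e :: real assume "0 < e"
  have "\<bar>sigma_min B - sigma_min A\<bar> \<le> norm (B - A)" for B
    using sigma_min_Lipschitz[of A B] sigma_min_Lipschitz[of B A] by (simp add: norm_minus_commute abs_le_iff)
  then show "\<exists>d>0. \<forall>B. dist B A < d \<longrightarrow> dist (sigma_min B) (sigma_min A) < e"
    using \<open>0 < e\<close> by (auto simp: dist_norm intro: le_less_trans intro!: exI[of _ e])
qed

lemmas tendsto_sigma_min = isCont_tendsto_compose[OF isCont_sigma_min]

text \<open>Up to sign the characteristic polynomial of \<open>cadjoint A ** A\<close>: its roots
  are the squared singular values, and unlike \<open>sigma_min\<close> it is polynomial in the real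
  and imaginary parts of the entries of \<open>A\<close>.\<close>

definition gram_det :: "complex^'n^'n \<Rightarrow> real \<Rightarrow> complex" where
  "gram_det A t = det (cadjoint A ** A - mat (complex_of_real t))"

lemma gram_det_vector: "(cadjoint A ** A - mat (complex_of_real t)) *v x = (cadjoint A ** A) *v x - t *\<^sub>R x"
proof -
  have "mat (complex_of_real t) *v x = t *\<^sub>R x"
    unfolding scale_eq_scaleR[symmetric]
    by (simp add: mat_def matrix_vector_mult_def vec_eq_iff if_distrib[of "\<lambda>c. c * _"] cong: if_cong)
  then show ?thesis by (simp add: matrix_vector_mult_diff_rdistrib)
qed

lemma det_zero_iff_kernel: "det (A::'a::field^'n^'n) = 0 \<longleftrightarrow> (\<exists>x. x \<noteq> 0 \<and> A *v x = 0)"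
  using invertible_det_nz[of A] matrix_left_invertible_ker[of A] invertible_left_inverse[of A] by blast

lemma gram_det_sigma_min: "gram_det A ((sigma_min A)\<^sup>2) = 0"
proof -
  obtain v where "norm v = 1" "v \<in> singular_space A (sigma_min A)" using sigma_min_attained[of A] by metis
  then show ?thesis
    unfolding gram_det_def det_zero_iff_kernel by (intro exI[of _ v]) (auto simp: gram_det_vector singular_space_def simp del: of_real_power)
qed

lemma cnj_det: "cnj (det A) = det (map_matrix cnj A)"
  by (simp add: det_def map_matrix_def)

text \<open>The matrix is Hermitian, so conjugating it amounts to transposing it, which fixes the
  determinant. Hence taking \<open>Re\<close> in the definitions of \<open>X\<close> and
  \<open>H\<close> loses nothing.\<close>

lemma gram_det_real: "Im (gram_det A t) = 0"
proof -
  let ?N = "cadjoint A ** A - mat (complex_of_real t)"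
  have "map_matrix cnj ?N = transpose ?N"
    by (auto simp: vec_eq_iff map_matrix_def transpose_def cadjoint_def matrix_matrix_mult_def mat_def mult.commute)
  then have "cnj (gram_det A t) = gram_det A t" unfolding gram_det_def cnj_det by (simp add: det_transpose)
  then show ?thesis by (simp add: complex_eq_iff)
qed

lemma simple_singular_space:
  assumes "simple_singular_value A \<sigma>"
  obtains v where "v \<noteq> 0" "v \<in> singular_space A \<sigma>" "\<And>x. x \<in> singular_space A \<sigma> \<Longrightarrow> \<exists>c. x = c *s v"
proof -
  obtain B where B: "B \<subseteq> singular_space A \<sigma>" "vec.independent B" "singular_space A \<sigma> \<subseteq> vec.span B"
    "card B = vec.dim (singular_space A \<sigma>)"
    using vec.basis_exists[of "singular_space A \<sigma>"] by blast
  then have "card B = 1" using assms by (simp add: simple_singular_value_def)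
  then obtain v where v: "B = {v}" by (auto simp: card_1_singleton_iff)
  show ?thesis
  proof (rule that)
    show "v \<noteq> 0" using B(2) v vec.dependent_zero[of B] by auto
    show "v \<in> singular_space A \<sigma>" using B v by auto
    show "\<exists>c. x = c *s v" if "x \<in> singular_space A \<sigma>" for x
      using B(3) that by (auto simp: v vec.span_singleton)
  qed
qed

text \<open>Replacing column \<open>k\<close> of \<open>N\<close> by \<open>N *v x\<close>
  multiplies the determinant by \<open>x $ k\<close>, as in Cramer's rule; for an eigenvector the
  eigenvalue comes out of that column. This splits the factor \<open>c\<close> off the
  determinant.\<close>

lemma det_replace_column_scaled:
  fixes N :: "'a::field^'n^'n"
  assumes "N *v x = c *s x"
  shows "x $ k * det N = c * det (\<chi> i j. if j = k then x $ i else N $ i $ j)"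
proof -
  let ?L = "\<chi> i j. if j = k then (N *v x) $ i else N $ i $ j"
  let ?Y = "\<chi> i j. if j = k then x $ i else N $ i $ j"
  have L: "transpose ?L = (\<chi> j. if j = k then c *s x else column j N)"
    by (simp add: transpose_def column_def vec_eq_iff assms)
  have Y: "transpose ?Y = (\<chi> j. if j = k then x else column j N)"
    by (simp add: transpose_def column_def vec_eq_iff)
  have "det (transpose ?L) = c * det (transpose ?Y)"
    unfolding L Y by (rule det_row_mul)
  then show ?thesis using cramer_lemma[of k N x] by (simp only: det_transpose)
qed

text \<open>The eigenvector splits off a factor: \<open>gram_det A t\<close> equals
  \<open>(\<sigma>\<^sup>2 - t) * G t\<close>, so the derivative at \<open>\<sigma>\<^sup>2\<close>
  is \<open>- G (\<sigma>\<^sup>2)\<close>. Simplicity enters in showing that this is nonzero, that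
  is, that \<open>Y (\<sigma>\<^sup>2)\<close> is invertible.\<close>

lemma gram_det_simple_derivative:
  fixes A :: "complex^'n^'n"
  assumes "simple_singular_value A \<sigma>"
  shows "\<exists>D. D \<noteq> 0 \<and> ((\<lambda>t. Re (gram_det A t)) has_real_derivative D) (at (\<sigma>\<^sup>2))"
proof -
  interpret bb: bounded_bilinear "\<lambda>(A::complex^'n^'n) x. A *v x" by (rule bounded_bilinear_matrix_vector)
  obtain x where x: "x \<noteq> 0" "x \<in> singular_space A \<sigma>" and span: "\<And>y. y \<in> singular_space A \<sigma> \<Longrightarrow> \<exists>c. y = c *s x"
    using simple_singular_space[OF assms] by metis
  obtain k where k: "x $ k \<noteq> 0" using x(1) by (auto simp: vec_eq_iff)
  define N where "N t = cadjoint A ** A - mat (complex_of_real t)" for t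
  define Y :: "real \<Rightarrow> complex^'n^'n" where "Y t = (\<chi> i j. if j = k then x $ i else N t $ i $ j)" for t
  have Nx: "N t *v x = complex_of_real (\<sigma>\<^sup>2 - t) *s x" for t
    using x(2) unfolding N_def gram_det_vector singular_space_def scale_eq_scaleR by (simp add: scaleR_diff_left)
  have eq: "gram_det A t = complex_of_real (\<sigma>\<^sup>2 - t) * (det (Y t) / x $ k)" for t
    using det_replace_column_scaled[OF Nx, of k t] k by (simp add: gram_det_def N_def[symmetric] Y_def[symmetric] field_simps)
  have "det (Y (\<sigma>\<^sup>2)) \<noteq> 0"
  proof
    assume "det (Y (\<sigma>\<^sup>2)) = 0"
    then obtain z where z: "z \<noteq> 0" "Y (\<sigma>\<^sup>2) *v z = 0" unfolding det_zero_iff_kernel by blast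
    \<comment> \<open>Clearing the k-th entry of a kernel vector \<open>z\<close> gives
      \<open>N (\<sigma>\<^sup>2) *v z' = - (z $ k *s x)\<close>. Since
      \<open>N (\<sigma>\<^sup>2)\<close> is self-adjoint and annihilates \<open>x\<close>, the
      right side is orthogonal to itself, so \<open>z $ k = 0\<close>. Then \<open>z'\<close> lies
      in the eigenspace and is a multiple of \<open>x\<close> with vanishing k-th entry, hence
      0.\<close>
    define z' where "z' = (\<chi> i. if i = k then 0 else z $ i)"
    have Yz: "Y (\<sigma>\<^sup>2) *v z = N (\<sigma>\<^sup>2) *v z' + z $ k *s x"
    proof (simp add: vec_eq_iff matrix_vector_mult_def Y_def z'_def, intro allI)
      fix i
      have "(\<Sum>j\<in>UNIV. (if j = k then x $ i else N (\<sigma>\<^sup>2) $ i $ j) * z $ j) =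
        (\<Sum>j\<in>UNIV. N (\<sigma>\<^sup>2) $ i $ j * (if j = k then 0 else z $ j) + (if j = k then z $ k * x $ i else 0))"
        by (rule sum.cong) auto
      then show "(\<Sum>j\<in>UNIV. (if j = k then x $ i else N (\<sigma>\<^sup>2) $ i $ j) * z $ j) =
        (\<Sum>j\<in>UNIV. N (\<sigma>\<^sup>2) $ i $ j * (if j = k then 0 else z $ j)) + z $ k * x $ i"
        by (simp add: sum.distrib)
    qed
    have sa: "(N t *v p) \<bullet> q = p \<bullet> (N t *v q)" for t p q
      unfolding N_def gram_det_vector by (simp add: inner_diff_left inner_diff_right matrix_vector_mul_assoc[symmetric] inner_cadjoint)
    have "N (\<sigma>\<^sup>2) *v (z $ k *s x) = 0"
      using Nx[of "\<sigma>\<^sup>2"] by (simp add: vector_scalar_commute)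
    then have "(N (\<sigma>\<^sup>2) *v z') \<bullet> (z $ k *s x) = 0" unfolding sa by simp
    moreover have "N (\<sigma>\<^sup>2) *v z' = - (z $ k *s x)" using Yz z(2) by (simp add: eq_neg_iff_add_eq_0)
    ultimately have "z $ k *s x = 0" by simp
    then have zk: "z $ k = 0" using x(1) by simp
    then have "N (\<sigma>\<^sup>2) *v z' = 0" using Yz z(2) by simp
    then have "z' \<in> singular_space A \<sigma>" unfolding N_def gram_det_vector singular_space_def by simp
    then obtain c where c: "z' = c *s x" using span by blast
    have "z' $ k = 0" by (simp add: z'_def)
    then have "z' = 0" using c k by simp
    then have "z $ i = 0" for i using zk by (cases "i = k") (auto simp: z'_def vec_eq_iff split: if_splits)
    then show False using z(1) by (simp add: vec_eq_iff)
  qed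
  then have nz: "det (Y (\<sigma>\<^sup>2)) / x $ k \<noteq> 0" using k by simp
  define G where "G t = det (Y t) / x $ k" for t
  have "isCont (\<lambda>t. Y t $ i $ j) t" for i j t
    by (cases "j = k"; cases "i = j") (simp_all add: Y_def N_def mat_def)
  then have contY: "isCont (\<lambda>t. det (Y t)) t" for t
    unfolding det_def by (intro continuous_sum continuous_mult continuous_const continuous_prod)
  have "isCont G t" for t
    unfolding G_def by (intro continuous_divide contY continuous_const) (use k in auto)
  then have contG: "isCont (\<lambda>t. - Re (G t)) t" for t
    unfolding isCont_def by (intro tendsto_minus tendsto_Re) blast
  have Re: "Re (gram_det A t) - Re (gram_det A (\<sigma>\<^sup>2)) = (- Re (G t)) * (t - \<sigma>\<^sup>2)" for t
    by (simp add: eq G_def[symmetric] algebra_simps)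
  \<comment> \<open>\<open>G\<close> is real away from \<open>\<sigma>\<^sup>2\<close> because
    \<open>gram_det\<close> is, and by continuity also there; its nonzero value then has a nonzero
    real part.\<close>
  have "Im (G t) = 0" if "t \<noteq> \<sigma>\<^sup>2" for t
    using gram_det_real[of A t] that by (simp add: eq G_def[symmetric])
  then have "((\<lambda>t. Im (G t)) \<longlongrightarrow> 0) (at (\<sigma>\<^sup>2))"
    by (intro tendsto_eventually) (auto simp: eventually_at_filter)
  moreover have "((\<lambda>t. Im (G t)) \<longlongrightarrow> Im (G (\<sigma>\<^sup>2))) (at (\<sigma>\<^sup>2))"
    using \<open>isCont G (\<sigma>\<^sup>2)\<close> by (intro tendsto_intros) (simp add: isCont_def)
  ultimately have "Im (G (\<sigma>\<^sup>2)) = 0" by (metis LIM_unique)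
  then have "- Re (G (\<sigma>\<^sup>2)) \<noteq> 0" using nz by (auto simp: G_def complex_eq_iff)
  moreover have "((\<lambda>t. Re (gram_det A t)) has_real_derivative - Re (G (\<sigma>\<^sup>2))) (at (\<sigma>\<^sup>2))"
    unfolding DERIV_caratheodory_within
    by (intro exI[of _ "\<lambda>t. - Re (G t)"] conjI allI Re contG refl)
  ultimately show ?thesis by blast
qed

lemma Re_sesq: "Re (sesq u B v) = u \<bullet> (B *v v)"
  by (simp add: sesq_def inner_vec_def inner_complex_Re Re_sum)

text \<open>The upper bound \<open>sigma_min (B t) \<le> norm (B t *v v)\<close> is an equality at \<open>t = 0\<close>, so both sides
  have the same derivative there; no differentiability of singular vectors is needed.\<close>

lemma sigma_min_path_derivative:
  fixes B :: "real \<Rightarrow> complex^'n^'n"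
  assumes uv: "consistent_singular_vectors (B 0) (sigma_min (B 0)) u v" and pos: "sigma_min (B 0) > 0"
    and B: "(B has_vector_derivative B') (at 0)"
    and d: "((\<lambda>t. sigma_min (B t)) has_real_derivative d) (at 0)"
  shows "d = Re (sesq u B' v)"
proof -
  interpret bb: bounded_bilinear "\<lambda>(A::complex^'n^'n) x. A *v x" by (rule bounded_bilinear_matrix_vector)
  have v: "norm v = 1" and u: "norm u = 1" and Bv: "B 0 *v v = sigma_min (B 0) *\<^sub>R u"
    using uv by (auto simp: consistent_singular_vectors_def)
  have "((\<lambda>t. B t *v v) has_vector_derivative B' *v v) (at 0)"
    by (rule bounded_linear.has_vector_derivative[OF bb.bounded_linear_left B])
  then have Bd: "((\<lambda>t. B t *v v) has_derivative (\<lambda>h. h *\<^sub>R (B' *v v))) (at 0)"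
    by (simp add: has_vector_derivative_def)
  have nz: "B 0 *v v \<noteq> 0" using Bv u pos by auto
  have N: "((\<lambda>t. norm (B t *v v)) has_derivative (\<lambda>h. inner (h *\<^sub>R (B' *v v)) (sgn (B 0 *v v)))) (at 0)"
    using has_derivative_compose[OF Bd, of norm] GDERIV_norm[OF nz, unfolded gderiv_def] by blast
  have S: "sgn (B 0 *v v) = u" using Bv u pos by (simp add: sgn_div_norm)
  have "((\<lambda>t. norm (B t *v v)) has_real_derivative (u \<bullet> (B' *v v))) (at 0)"
    unfolding has_field_derivative_def
    by (rule has_derivative_eq_rhs[OF N]) (simp add: S fun_eq_iff inner_commute)
  from DERIV_diff[OF this d]
  have "((\<lambda>t. norm (B t *v v) - sigma_min (B t)) has_real_derivative (u \<bullet> (B' *v v) - d)) (at 0)" .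
  then have "u \<bullet> (B' *v v) - d = 0"
  proof (rule DERIV_local_min[where d = 1])
    show "\<forall>y. \<bar>0 - y\<bar> < 1 \<longrightarrow> norm (B 0 *v v) - sigma_min (B 0) \<le> norm (B y *v v) - sigma_min (B y)"
      using sigma_min_le[of _ v] v u Bv pos by simp
  qed simp
  then show ?thesis by (simp add: Re_sesq)
qed

subsection \<open>Boundedness of pseudospectra\<close>

lemma cscale_nth [simp]: "cscale c A $ i $ j = c * A $ i $ j"
  by (simp add: cscale_def map_matrix_def)

lemma cscale_cscale: "cscale a (cscale b A) = cscale (a * b) A"
  by (simp add: vec_eq_iff mult.assoc)

lemma cscale_vector: "cscale c A *v x = c *s (A *v x)"
  by (simp add: vec_eq_iff matrix_vector_mult_def sum_distrib_left mult.assoc)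

lemma norm_scale: "norm (c *s x) = cmod c * norm x" for x :: "complex^'n"
  by (simp add: norm_vec_def norm_mult L2_set_right_distrib)

lemma norm_cscale: "norm (cscale c A) = cmod c * norm A"
proof -
  have "cscale c A $ i = c *s A $ i" for i by (simp add: vec_eq_iff)
  then have "norm (cscale c A) = L2_set (\<lambda>i. cmod c * norm (A $ i)) UNIV"
    unfolding norm_vec_def[of "cscale c A"] by (simp add: norm_scale)
  then show ?thesis by (simp add: L2_set_right_distrib norm_vec_def[of A])
qed

lemma bounded_bilinear_cscale: "bounded_bilinear (cscale :: complex \<Rightarrow> complex^'n^'m \<Rightarrow> complex^'n^'m)"
proof
  show "\<exists>K. \<forall>a (b::complex^'n^'m). norm (cscale a b) \<le> norm a * norm b * K"
    by (intro exI[of _ 1]) (simp add: norm_cscale)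
qed (simp_all add: vec_eq_iff algebra_simps)

lemma norm_sum_cnj_le: "cmod (\<Sum>k\<in>UNIV. cnj (x $ k) * y $ k) \<le> norm x * norm y" for x y :: "complex^'n"
proof -
  have "cmod (\<Sum>k\<in>UNIV. cnj (x $ k) * y $ k) \<le> (\<Sum>k\<in>UNIV. \<bar>norm (x $ k)\<bar> * \<bar>norm (y $ k)\<bar>)"
    by (rule order_trans[OF norm_sum]) (simp add: norm_mult)
  also have "\<dots> \<le> norm x * norm y"
    unfolding norm_vec_def by (rule L2_set_mult_ineq)
  finally show ?thesis .
qed

lemma p_w_nonneg: "0 \<le> p_w w x"
  by (cases w) simp

lemma p_w_lower: "0 \<le> wm \<Longrightarrow> wm * x\<^sup>2 \<le> p_w (wm, wc, wk) x"
proof -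
  assume "0 \<le> wm"
  have "(wm * x\<^sup>2)\<^sup>2 = wm\<^sup>2 * x ^ 4" by (simp add: power_mult_distrib flip: power_mult)
  then show ?thesis by (simp add: real_le_rsqrt)
qed

lemma p_w_upper:
  assumes "0 \<le> wm" "0 \<le> wc" "0 \<le> wk" "0 \<le> x"
  shows "p_w (wm, wc, wk) x \<le> wm * x\<^sup>2 + wc * x + wk"
proof -
  have "wm\<^sup>2 * x ^ 4 + wc\<^sup>2 * x\<^sup>2 + wk\<^sup>2 \<le> (wm * x\<^sup>2)\<^sup>2 + (wc * x)\<^sup>2 + wk\<^sup>2"
    by (simp add: power_mult_distrib flip: power_mult)
  also have "\<dots> \<le> (wm * x\<^sup>2 + wc * x + wk)\<^sup>2"
    using assms by (simp add: power2_sum)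
  finally show ?thesis using assms by (simp add: real_le_lsqrt)
qed

text \<open>A bounded pseudospectrum gives \<open>sigma_min (M + w C + w\<^sup>2 K) > \<epsilon> w\<^sub>m\<close> for all small
  \<open>w = 1/z \<noteq> 0\<close>. Equality at \<open>w = 0\<close> would be a strict maximum at \<open>0\<close> of the modulus of a
  matrix element of the inverse, which is holomorphic in \<open>w\<close>.\<close>

lemma bounded_pseudospectrum_sigma_min:
  fixes M C K :: "complex^'n^'n"
  assumes eps: "\<epsilon> > 0" and wm: "wm > 0"
    and bdd: "bounded (pseudospectrum (wm, wc, wk) \<epsilon> (quad_poly M C K))"
  shows "\<epsilon> * wm < sigma_min M"
proof (rule ccontr)
  assume not: "\<not> \<epsilon> * wm < sigma_min M"
  define m where "m = \<epsilon> * wm"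
  have m: "m > 0" using eps wm by (simp add: m_def)
  \<comment> \<open>The reversed polynomial: the matrix polynomial at \<open>1 / w\<close> is
    \<open>Q w\<close> divided by the square of \<open>w\<close>, so large \<open>z\<close>
    correspond to \<open>w\<close> near 0.\<close>
  define Q where "Q w = M + cscale w C + cscale (w\<^sup>2) K" for w
  interpret cs: bounded_bilinear "cscale :: complex \<Rightarrow> complex^'n^'n \<Rightarrow> complex^'n^'n"
    by (rule bounded_bilinear_cscale)
  obtain R where R: "R > 0" "\<And>z. z \<in> pseudospectrum (wm, wc, wk) \<epsilon> (quad_poly M C K) \<Longrightarrow> cmod z \<le> R"
    using bdd unfolding bounded_pos by blast
  define r where "r = 1 / R"
  have r: "r > 0" using R by (simp add: r_def)
  have Qs: "m < sigma_min (Q w)" if w: "w \<noteq> 0" "cmod w < r" for w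
  proof -
    have "cmod (1 / w) > R" using w R(1) by (simp add: r_def norm_divide field_simps)
    then have "1 / w \<notin> pseudospectrum (wm, wc, wk) \<epsilon> (quad_poly M C K)" using R(2) by force
    then have "\<epsilon> * p_w (wm, wc, wk) (cmod (1 / w)) < sigma_min (quad_poly M C K (1 / w))"
      by (simp add: pseudospectrum_def)
    moreover have "\<epsilon> * (wm * (cmod (1 / w))\<^sup>2) \<le> \<epsilon> * p_w (wm, wc, wk) (cmod (1 / w))"
      using eps p_w_lower[of wm "cmod (1 / w)" wc wk] wm by (intro mult_left_mono) auto
    ultimately have "m * (cmod (1 / w))\<^sup>2 < sigma_min (quad_poly M C K (1 / w))"
      by (simp add: m_def mult.assoc)
    moreover have "quad_poly M C K (1 / w) = cscale ((1 / w)\<^sup>2) (Q w)"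
      using w(1) by (simp add: quad_poly_def Q_def cs.add_right cscale_cscale power2_eq_square) (simp add: vec_eq_iff)
    moreover obtain v where v: "norm v = 1" "norm (Q w *v v) = sigma_min (Q w)"
      using sigma_min_attained[of "Q w"] by metis
    ultimately have "m * (cmod (1 / w))\<^sup>2 < norm (cscale ((1 / w)\<^sup>2) (Q w) *v v)"
      using sigma_min_le[of "cscale ((1 / w)\<^sup>2) (Q w)" v] by simp
    also have "\<dots> = (cmod (1 / w))\<^sup>2 * sigma_min (Q w)"
      by (simp only: cscale_vector norm_scale v norm_power)
    finally show ?thesis using w(1) by (simp add: mult.commute)
  qed
  have Q0: "Q 0 = M" by (simp add: Q_def cs.zero_left)
  have "isCont Q 0" unfolding Q_def
    by (intro continuous_intros cs.continuous)
  then have lim: "((\<lambda>w. sigma_min (Q w)) \<longlongrightarrow> sigma_min M) (at 0)"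
    by (intro tendsto_sigma_min) (simp add: isCont_def Q0)
  have "\<forall>\<^sub>F w in at 0. m \<le> sigma_min (Q w)"
    unfolding eventually_at using Qs r by (intro exI[of _ r]) (auto intro: less_imp_le)
  then have "m \<le> sigma_min M" by (rule tendsto_lowerbound[OF lim]) simp
  \<comment> \<open>The strict bound for \<open>w \<noteq> 0\<close> passes to the limit as
    \<open>m \<le> sigma_min M\<close>. Under the negated claim only equality is left, and then
    \<open>Q w\<close> is invertible on the whole disc, its centre included.\<close>
  then have sM: "sigma_min M = m" using not by (simp add: m_def)
  have detQ: "det (Q w) \<noteq> 0" if "cmod w < r" for w
  proof
    assume "det (Q w) = 0"
    then obtain x where x: "x \<noteq> 0" "Q w *v x = 0" unfolding det_zero_iff_kernel by blast
    have "0 < sigma_min (Q w)" using Qs[OF _ that] m sM Q0 by (cases "w = 0") auto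
    then show False using sigma_min_le[of "Q w" x] x by (simp add: mult_le_0_iff)
  qed
  obtain v where v: "norm v = 1" "norm (M *v v) = m"
    using sigma_min_attained[of M] sM by metis
  define u where "u = complex_of_real (1 / m) *s (M *v v)"
  have u: "norm u = 1" using v m by (simp add: u_def norm_scale norm_divide)
  \<comment> \<open>The solution of \<open>Q w *v x w = u\<close> by Cramer's rule, so that its
    entries are quotients of polynomials in \<open>w\<close>.\<close>
  define x where "x w = (\<chi> k. det (\<chi> i j. if j = k then u $ i else Q w $ i $ j) / det (Q w))" for w
  have Qx: "Q w *v x w = u" if "cmod w < r" for w
    using cramer[OF detQ[OF that]] by (simp add: x_def)
  have x0: "x 0 = complex_of_real (1 / m) *s v"
  proof -
    have "Q 0 *v (complex_of_real (1 / m) *s v) = u"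
      unfolding u_def Q0 by (rule vector_scalar_commute)
    then show ?thesis using cramer[OF detQ[of 0]] r by (simp add: x_def)
  qed
  define h where "h w = (\<Sum>k\<in>UNIV. cnj (v $ k) * x w $ k)" for w
  have "(\<Sum>k\<in>UNIV. cnj (v $ k) * v $ k) = complex_of_real ((norm v)\<^sup>2)"
    by (simp add: power2_norm_eq_inner inner_vec_def complex_eq_iff inner_complex_Re Re_sum Im_sum)
  then have h0: "h 0 = complex_of_real (1 / m)"
    using v(1) by (simp add: h_def x0 mult.left_commute flip: sum_distrib_left sum_divide_distrib)
  have hw: "cmod (h w) < 1 / m" if w: "w \<noteq> 0" "cmod w < r" for w
  proof -
    have "x w \<noteq> 0" using Qx[OF w(2)] u by auto
    then have "m * norm (x w) < sigma_min (Q w) * norm (x w)" using Qs[OF w] by simp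
    also have "\<dots> \<le> norm (Q w *v x w)" by (rule sigma_min_le)
    also have "\<dots> = 1" using Qx[OF w(2)] u by simp
    finally have "norm (x w) < 1 / m" using m by (simp add: field_simps)
    moreover have "cmod (h w) \<le> norm v * norm (x w)" unfolding h_def by (rule norm_sum_cnj_le)
    ultimately show ?thesis using v(1) by simp
  qed
  have ent: "(\<lambda>w. Q w $ i $ j) holomorphic_on S" for i j S
    unfolding Q_def by (auto intro!: holomorphic_intros)
  have ent': "(\<lambda>w. (if j = k then u $ i else Q w $ i $ j)) holomorphic_on S" for i j k S
    using ent by (cases "j = k") auto
  have hol: "h holomorphic_on ball 0 r"
    unfolding h_def x_def vec_lambda_beta
  proof (intro holomorphic_on_sum holomorphic_on_mult holomorphic_on_divide holomorphic_on_const)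
    show "(\<lambda>w. det (\<chi> i j. if j = k then u $ i else Q w $ i $ j)) holomorphic_on ball 0 r" for k
      unfolding det_def vec_lambda_beta
      by (intro holomorphic_on_sum holomorphic_on_mult holomorphic_on_prod holomorphic_on_const ent')
    show "(\<lambda>w. det (Q w)) holomorphic_on ball 0 r"
      unfolding det_def
      by (intro holomorphic_on_sum holomorphic_on_mult holomorphic_on_prod holomorphic_on_const ent)
    show "det (Q w) \<noteq> 0" if "w \<in> ball 0 r" for w using detQ that by simp
  qed
  have "h constant_on ball 0 r"
  proof (rule maximum_modulus_principle[OF hol open_ball connected_ball open_ball order_refl])
    show "0 \<in> ball (0::complex) r" using r by simp
    show "cmod (h z) \<le> cmod (h 0)" if "z \<in> ball 0 r" for z
      using hw[of z] that m h0 by (cases "z = 0") (auto simp: norm_divide intro: less_imp_le)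
  qed
  then obtain c where c: "\<And>z. z \<in> ball 0 r \<Longrightarrow> h z = c" unfolding constant_on_def by blast
  have "h (complex_of_real (r / 2)) = h 0"
    using c[of 0] c[of "complex_of_real (r / 2)"] r by simp
  moreover have "cmod (h (complex_of_real (r / 2))) < 1 / m" using r by (intro hw) auto
  ultimately show False using h0 m by (simp add: norm_divide)
qed

text \<open>At modulus \<open>\<rho>\<close> the leading term gives a lower bound with main part
  \<open>\<rho>\<^sup>2 * (\<epsilon> * wm + \<delta>)\<close>, whereas the pseudospectrum allows
  only \<open>\<epsilon> * wm * \<rho>\<^sup>2\<close> at that order. The gap
  \<open>\<delta> * \<rho>\<^sup>2\<close> must be covered by terms of lower order, which forces
  \<open>\<rho> \<le> max 1 (S / \<delta>)\<close> uniformly in the parameter.\<close>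

lemma eventually_bounded_pseudospectrum:
  fixes M C K :: "'a \<Rightarrow> complex^'n^'n"
  assumes w: "0 \<le> wm" "0 \<le> wc" "0 \<le> wk" and eps: "\<epsilon> > 0" and M0: "\<epsilon> * wm < sigma_min M0"
    and lim: "(M \<longlongrightarrow> M0) F" "(C \<longlongrightarrow> C0) F" "(K \<longlongrightarrow> K0) F"
  shows "\<exists>R. \<forall>\<^sub>F \<nu> in F. \<forall>z\<in>pseudospectrum (wm, wc, wk) \<epsilon> (quad_poly (M \<nu>) (C \<nu>) (K \<nu>)). cmod z \<le> R"
proof -
  define \<delta> where "\<delta> = (sigma_min M0 - \<epsilon> * wm) / 2"
  have \<delta>: "\<delta> > 0" using M0 by (simp add: \<delta>_def)
  define c k where "c = norm C0 + 1" and "k = norm K0 + 1"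
  define S where "S = c + k + \<epsilon> * wc + \<epsilon> * wk"
  have ck: "c > 0" "k > 0" by (auto simp: c_def k_def intro: add_nonneg_pos)
  have "\<epsilon> * wm + \<delta> < sigma_min M0" using M0 by (simp add: \<delta>_def field_simps)
  then have "\<forall>\<^sub>F \<nu> in F. \<epsilon> * wm + \<delta> < sigma_min (M \<nu>)"
    by (rule order_tendstoD(1)[OF tendsto_sigma_min[OF lim(1)]])
  moreover have "\<forall>\<^sub>F \<nu> in F. norm (C \<nu>) < c"
    by (rule order_tendstoD(2)[OF tendsto_norm[OF lim(2)]]) (simp add: c_def)
  moreover have "\<forall>\<^sub>F \<nu> in F. norm (K \<nu>) < k"
    by (rule order_tendstoD(2)[OF tendsto_norm[OF lim(3)]]) (simp add: k_def)
  ultimately have "\<forall>\<^sub>F \<nu> in F. \<forall>z\<in>pseudospectrum (wm, wc, wk) \<epsilon> (quad_poly (M \<nu>) (C \<nu>) (K \<nu>)). cmod z \<le> max 1 (S / \<delta>)"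
  proof eventually_elim
    case (elim \<nu>)
    show ?case
    proof (rule ballI, rule ccontr)
      fix z assume z: "z \<in> pseudospectrum (wm, wc, wk) \<epsilon> (quad_poly (M \<nu>) (C \<nu>) (K \<nu>))"
        and "\<not> cmod z \<le> max 1 (S / \<delta>)"
      then have z1: "1 < cmod z" "S / \<delta> < cmod z" by auto
      define \<rho> where "\<rho> = cmod z"
      have \<rho>: "1 < \<rho>" "S < \<delta> * \<rho>" using z1 \<delta> by (auto simp: \<rho>_def field_simps)
      let ?P = "quad_poly (M \<nu>) (C \<nu>) (K \<nu>) z"
      obtain v where v: "norm v = 1" "norm (?P *v v) = sigma_min ?P"
        using sigma_min_attained[of ?P] by metis
      have Pv: "?P *v v = (z\<^sup>2) *s (M \<nu> *v v) + (z *s (C \<nu> *v v) + K \<nu> *v v)"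
        by (simp add: quad_poly_def matrix_vector_mult_add_rdistrib cscale_vector add.assoc)
      have "\<rho>\<^sup>2 * norm (M \<nu> *v v) - norm (z *s (C \<nu> *v v) + K \<nu> *v v) \<le> norm (?P *v v)"
        unfolding Pv using norm_diff_ineq[of "(z\<^sup>2) *s (M \<nu> *v v)"] by (simp add: norm_scale norm_power \<rho>_def)
      moreover have "norm (z *s (C \<nu> *v v) + K \<nu> *v v) \<le> \<rho> * c + k"
      proof -
        have "norm (z *s (C \<nu> *v v) + K \<nu> *v v) \<le> \<rho> * norm (C \<nu> *v v) + norm (K \<nu> *v v)"
          using norm_triangle_ineq[of "z *s (C \<nu> *v v)"] by (simp add: norm_scale \<rho>_def)
        also have "\<dots> \<le> \<rho> * c + k"
          using norm_matrix_vector_le[of "C \<nu>" v] norm_matrix_vector_le[of "K \<nu>" v] v(1) elim \<rho>(1)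
          by (intro add_mono mult_left_mono) auto
        finally show ?thesis .
      qed
      moreover have "\<rho>\<^sup>2 * (\<epsilon> * wm + \<delta>) \<le> \<rho>\<^sup>2 * norm (M \<nu> *v v)"
        using sigma_min_le[of "M \<nu>" v] v(1) elim by (intro mult_left_mono) auto
      moreover have "norm (?P *v v) \<le> \<epsilon> * (wm * \<rho>\<^sup>2 + wc * \<rho> + wk)"
      proof -
        have "norm (?P *v v) \<le> \<epsilon> * p_w (wm, wc, wk) \<rho>"
          using z v(2) by (simp add: pseudospectrum_def \<rho>_def)
        also have "\<dots> \<le> \<epsilon> * (wm * \<rho>\<^sup>2 + wc * \<rho> + wk)"
          using eps p_w_upper[OF w, of \<rho>] \<rho>(1) by (intro mult_left_mono) auto
        finally show ?thesis .
      qed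
      ultimately have "\<delta> * \<rho>\<^sup>2 \<le> \<rho> * (c + \<epsilon> * wc) + (k + \<epsilon> * wk)" by (simp add: algebra_simps)
      also have "\<dots> \<le> \<rho> * (c + \<epsilon> * wc) + \<rho> * (k + \<epsilon> * wk)"
      proof (rule add_left_mono)
        have "0 \<le> k + \<epsilon> * wk" using ck eps w by simp
        then show "k + \<epsilon> * wk \<le> \<rho> * (k + \<epsilon> * wk)" using \<rho>(1) mult_right_mono[of 1 \<rho> "k + \<epsilon> * wk"] by simp
      qed
      also have "\<dots> = \<rho> * S" by (simp add: S_def algebra_simps)
      also have "\<dots> < \<rho> * (\<delta> * \<rho>)" using \<rho> by simp
      finally show False by (simp add: power2_eq_square algebra_simps)
    qed
  qed
  then show ?thesis by blast
qed

subsection \<open>Optimality conditions\<close>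

lemma has_derivative_vec_nth: "((\<lambda>y. y $ i) has_derivative (\<lambda>h. h $ i)) (at (y::real^'k))"
  by (rule bounded_linear_imp_has_derivative[OF bounded_linear_vec_nth])

text \<open>Differentiates a given continuous branch of solutions; later the branch is
  \<open>sigma_min\<close>, a root of the determinant. Continuity makes the increment
  \<open>k\<close> of \<open>S\<close> small, the linear expansion of \<open>f\<close> then bounds
  \<open>k\<close> by a multiple of the increment of the argument, and the remainder becomes
  negligible.\<close>

lemma implicit_derivative:
  fixes f :: "'a::real_normed_vector \<times> real \<Rightarrow> real"
  assumes f: "(f has_derivative f') (at (x, S x))" and c: "f' (0, 1) \<noteq> 0"
    and S: "isCont S x" and zero: "\<forall>\<^sub>F z in nhds x. f (z, S z) = 0"
  shows "(S has_derivative (\<lambda>h. - f' (h, 0) / f' (0, 1))) (at x)"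
proof -
  define c where "c = f' (0, 1)"
  have bl: "bounded_linear f'" using f by (rule has_derivative_bounded_linear)
  interpret f': bounded_linear f' by (rule bl)
  have bl1: "bounded_linear (\<lambda>h. f' (h, 0))"
    using bounded_linear_compose[OF bl bounded_linear_Pair[OF bounded_linear_ident bounded_linear_zero]] by simp
  then obtain L where L: "L > 0" "\<And>h. norm (f' (h, 0)) \<le> norm h * L"
    using bounded_linear.pos_bounded by blast
  have split: "f' (h, k) = f' (h, 0) + k * c" for h k
    using f'.add[of "(h, 0)" "(0, k)"] f'.scaleR[of k "(0, 1)"] by (simp add: c_def)
  have fx: "f (x, S x) = 0" using zero by (rule eventually_nhds_x_imp_x)
  show ?thesis
    unfolding has_derivative_at_alt
  proof (intro conjI allI impI)
    show "bounded_linear (\<lambda>h. - f' (h, 0) / f' (0, 1))"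
      using bounded_linear_compose[OF bounded_linear_mult_right[of "- 1 / f' (0, 1)"] bl1] by simp
    fix e :: real assume e: "0 < e"
    \<comment> \<open>From \<open>\<eta> \<le> 1/2\<close> follows
      \<open>\<bar>k\<bar> \<le> 2 * P + norm (z - x)\<close>, hence
      \<open>norm (z - x) + \<bar>k\<bar> \<le> T * norm (z - x)\<close>, and
      \<open>\<eta> * T \<le> e\<close> closes the estimate.\<close>
    define T where "T = 2 * L / \<bar>c\<bar> + 2"
    have cp: "\<bar>c\<bar> > 0" using assms(2) by (simp add: c_def)
    have T: "T > 0" using L cp by (simp add: T_def add_pos_pos)
    define \<eta> where "\<eta> = min (1/2) (e / T)"
    have \<eta>: "\<eta> > 0" "\<eta> \<le> 1/2" "\<eta> * T \<le> e" using e T by (auto simp: \<eta>_def min_def field_simps)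
    have "\<eta> * \<bar>c\<bar> > 0" using \<eta> cp by simp
    then obtain d where d: "d > 0" "\<And>y. norm (y - (x, S x)) < d \<Longrightarrow>
        norm (f y - f (x, S x) - f' (y - (x, S x))) \<le> \<eta> * \<bar>c\<bar> * norm (y - (x, S x))"
      using f unfolding has_derivative_at_alt by blast
    have "((\<lambda>z. (z, S z)) \<longlongrightarrow> (x, S x)) (nhds x)"
      using S by (intro tendsto_Pair) (auto simp: isCont_def tendsto_at_iff_tendsto_nhds filterlim_ident)
    then have "\<forall>\<^sub>F z in nhds x. norm ((z, S z) - (x, S x)) < d"
      using d(1) by (auto simp: tendsto_iff dist_norm)
    with zero have "\<forall>\<^sub>F z in nhds x. norm (S z - S x - - f' (z - x, 0) / f' (0, 1)) \<le> e * norm (z - x)"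
    proof eventually_elim
      case (elim z)
      define k where "k = S z - S x"
      define l where "l = f' (z - x, 0) / c"
      have nn: "norm ((z, S z) - (x, S x)) \<le> norm (z - x) + \<bar>k\<bar>"
        using norm_Pair_le[of "z - x" k] by (simp add: k_def)
      have "norm (f' (z - x, k)) \<le> \<eta> * \<bar>c\<bar> * norm ((z, S z) - (x, S x))"
        using d(2)[OF elim(2)] elim(1) fx by (simp add: k_def)
      also have "\<dots> \<le> \<eta> * \<bar>c\<bar> * (norm (z - x) + \<bar>k\<bar>)"
        using nn \<eta>(1) by (intro mult_left_mono) auto
      finally have "\<bar>c * (k + l)\<bar> \<le> \<eta> * \<bar>c\<bar> * (norm (z - x) + \<bar>k\<bar>)"
        using cp by (simp add: split[of _ k] l_def algebra_simps)
      then have "\<bar>c\<bar> * \<bar>k + l\<bar> \<le> \<bar>c\<bar> * (\<eta> * (norm (z - x) + \<bar>k\<bar>))"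
        by (simp add: abs_mult mult.assoc mult.left_commute)
      then have 1: "\<bar>k + l\<bar> \<le> \<eta> * (norm (z - x) + \<bar>k\<bar>)" using cp by simp
      define P where "P = L / \<bar>c\<bar> * norm (z - x)"
      have "\<bar>l\<bar> \<le> P"
        unfolding P_def using L(2)[of "z - x"] cp by (simp add: l_def field_simps)
      moreover have "\<eta> * (norm (z - x) + \<bar>k\<bar>) \<le> 1/2 * (norm (z - x) + \<bar>k\<bar>)"
        using \<eta>(2) by (intro mult_right_mono) auto
      ultimately have "\<bar>k\<bar> \<le> 2 * P + norm (z - x)"
        using 1 by (simp add: abs_if split: if_splits)
      then have "norm (z - x) + \<bar>k\<bar> \<le> T * norm (z - x)" by (simp add: P_def T_def algebra_simps)
      then have "\<eta> * (norm (z - x) + \<bar>k\<bar>) \<le> \<eta> * (T * norm (z - x))"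
        using \<eta>(1) by (intro mult_left_mono) auto
      also have "\<dots> \<le> e * norm (z - x)" using \<eta>(3) by (simp add: mult.assoc[symmetric] mult_right_mono)
      finally have "\<bar>k + l\<bar> \<le> e * norm (z - x)" using 1 by linarith
      then show ?case by (simp add: k_def l_def c_def)
    qed
    then show "\<exists>d>0. \<forall>y. norm (y - x) < d \<longrightarrow> norm (S y - S x - - f' (y - x, 0) / f' (0, 1)) \<le> e * norm (y - x)"
      by (simp add: eventually_nhds_metric dist_norm)
  qed
qed

section \<open>Differentiation along graphs over the s-plane\<close>

definition emb3 :: "real^2 \<Rightarrow> real \<Rightarrow> real^3" where
  "emb3 s \<tau> = vector [s $ 1, s $ 2, \<tau>]"

lemma emb3_nth [simp]: "emb3 s \<tau> $ 1 = s $ 1" "emb3 s \<tau> $ 2 = s $ 2" "emb3 s \<tau> $ 3 = \<tau>"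
  by (simp_all add: emb3_def)

lemma bounded_linear_emb3: "bounded_linear (\<lambda>p. emb3 (fst p) (snd p))"
  unfolding linear_conv_bounded_linear[symmetric]
  by (rule linearI) (simp_all add: vec_eq_iff forall_3)

lemma has_derivative_emb3:
  assumes "(f has_derivative f') (at s)"
  shows "((\<lambda>s. emb3 s (f s)) has_derivative (\<lambda>h. emb3 h (f' h))) (at s)"
  using bounded_linear.has_derivative[OF bounded_linear_emb3 has_derivative_Pair[OF has_derivative_ident assms]]
  by simp

lemma chain_emb3:
  assumes X: "\<And>y. (X has_derivative (\<lambda>h. \<Sum>j\<in>UNIV. X' j y * h $ j)) (at (y::real^3))"
    and f: "(f has_derivative f') (at s)"
  shows "((\<lambda>s. X (emb3 s (f s))) has_derivative
      (\<lambda>h. X' 1 (emb3 s (f s)) * h $ 1 + X' 2 (emb3 s (f s)) * h $ 2 + X' 3 (emb3 s (f s)) * f' h)) (at s)"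
  using has_derivative_compose[OF has_derivative_emb3[OF f] X] by (simp add: sum_3)

lemma has_derivative_axis_unique:
  fixes f :: "real^2 \<Rightarrow> real"
  assumes "(f has_derivative (\<lambda>h. a1 * h $ 1 + a2 * h $ 2)) (at s)"
    "(f has_derivative (\<lambda>h. b1 * h $ 1 + b2 * h $ 2)) (at s)"
  shows "a1 = b1" "a2 = b2"
proof -
  have eq: "(\<lambda>h::real^2. a1 * h $ 1 + a2 * h $ 2) = (\<lambda>h. b1 * h $ 1 + b2 * h $ 2)"
    by (rule has_derivative_unique[OF assms])
  show "a1 = b1" using fun_cong[OF eq, of "axis 1 1"] by (simp add: axis_def)
  show "a2 = b2" using fun_cong[OF eq, of "axis 2 1"] by (simp add: axis_def)
qed

text \<open>The formula is established on a whole neighbourhood of \<open>s0\<close>, because it is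
  differentiated once more at \<open>s0\<close>.\<close>

lemma implicit_emb3_derivative:
  assumes X: "\<And>y. (X has_derivative (\<lambda>h. \<Sum>j\<in>UNIV. X' j y * h $ j)) (at (y::real^3))"
    and X'3: "isCont (X' 3) (emb3 s0 (S s0))" "X' 3 (emb3 s0 (S s0)) \<noteq> 0"
    and S: "continuous_on UNIV S" and zero: "\<And>s. X (emb3 s (S s)) = 0"
  shows "\<forall>\<^sub>F s in nhds s0. (S has_derivative (\<lambda>h. - X' 1 (emb3 s (S s)) / X' 3 (emb3 s (S s)) * h $ 1
      + - X' 2 (emb3 s (S s)) / X' 3 (emb3 s (S s)) * h $ 2)) (at s)"
proof -
  have cS: "isCont S s" for s using S by (simp add: continuous_on_eq_continuous_at)
  have "((\<lambda>s. emb3 s (S s)) \<longlongrightarrow> emb3 s0 (S s0)) (nhds s0)"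
    using bounded_linear.tendsto[OF bounded_linear_emb3 tendsto_Pair[of "\<lambda>s. s" s0 "nhds s0" S "S s0"]] cS[of s0]
    by (simp add: isCont_def tendsto_at_iff_tendsto_nhds filterlim_ident)
  then have "((\<lambda>s. X' 3 (emb3 s (S s))) \<longlongrightarrow> X' 3 (emb3 s0 (S s0))) (nhds s0)"
    by (rule isCont_tendsto_compose[OF X'3(1)])
  then have "\<forall>\<^sub>F s in nhds s0. X' 3 (emb3 s (S s)) \<noteq> 0"
    using X'3(2) tendsto_imp_eventually_ne by blast
  then show ?thesis
  proof eventually_elim
    case (elim s)
    have "((\<lambda>p. X (emb3 (fst p) (snd p))) has_derivative
      (\<lambda>h. \<Sum>j\<in>UNIV. X' j (emb3 s (S s)) * emb3 (fst h) (snd h) $ j)) (at (s, S s))"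
      using has_derivative_compose[OF bounded_linear_imp_has_derivative[OF bounded_linear_emb3] X] by fastforce
    from implicit_derivative[where S = S and x = s, OF this] elim cS zero
    have "(S has_derivative (\<lambda>h. - (X' 1 (emb3 s (S s)) * h $ 1 + X' 2 (emb3 s (S s)) * h $ 2) / X' 3 (emb3 s (S s)))) (at s)"
      by (simp add: sum_3)
    then show ?case
      by (rule has_derivative_eq_rhs) (simp add: fun_eq_iff field_simps elim)
  qed
qed

lemma has_derivative_eventually_eq:
  assumes "(f has_derivative F) (at x)" "\<forall>\<^sub>F y in nhds x. g y = f y"
  shows "(g has_derivative F) (at x)"
proof -
  obtain U where "open U" "x \<in> U" "\<And>y. y \<in> U \<Longrightarrow> g y = f y"
    using assms(2) unfolding eventually_nhds by blast
  then show ?thesis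
    using has_derivative_transform_within_open[OF assms(1)] by metis
qed

text \<open>The second derivative of \<open>f\<close> occurs only in the last summand; all the
  others depend on \<open>f s0\<close> and \<open>f2 s0\<close> alone, so they cancel between two
  functions that agree to first order in the second coordinate.\<close>

lemma second_order_chain:
  fixes X' :: "3 \<Rightarrow> real^3 \<Rightarrow> real"
  assumes X': "\<And>j y. (X' j has_derivative (\<lambda>h. \<Sum>k\<in>UNIV. X'' j k y * h $ k)) (at (y::real^3))"
    and f: "(f has_derivative (\<lambda>h. f1 s0 * h $ 1 + f2 s0 * h $ 2)) (at s0)"
    and f2: "(f2 has_derivative D) (at s0)"
  shows "\<exists>\<Phi>'. ((\<lambda>s. X' 2 (emb3 s (f s)) + X' 3 (emb3 s (f s)) * f2 s) has_derivative \<Phi>') (at s0) \<and>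
     \<Phi>' (axis 2 1) = X'' 2 2 (emb3 s0 (f s0)) + X'' 2 3 (emb3 s0 (f s0)) * f2 s0
        + (X'' 3 2 (emb3 s0 (f s0)) + X'' 3 3 (emb3 s0 (f s0)) * f2 s0) * f2 s0 + X' 3 (emb3 s0 (f s0)) * D (axis 2 1)"
  by (rule exI, rule conjI, rule has_derivative_add[OF chain_emb3[where X = "X' 2" and X' = "X'' 2", OF X' f]
        has_derivative_mult[OF chain_emb3[where X = "X' 3" and X' = "X'' 3", OF X' f] f2]])
    (simp add: axis_def algebra_simps)

text \<open>The chain rule is applied to \<open>X (emb3 s (q s))\<close>, which is \<open>H\<close>,
  and to \<open>X (emb3 s (S s))\<close>, which is 0, and the results are subtracted. Where
  \<open>q\<close> and \<open>S\<close> agree, and for the second derivative also \<open>q2\<close>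
  and \<open>S2\<close>, everything cancels except \<open>X' 3\<close> times the difference of
  derivatives. As g is \<open>S - q\<close>, these are the derivatives of g times
  \<open>- X' 3\<close>.\<close>

lemma reduced_equation_derivatives:
  fixes X :: "real^3 \<Rightarrow> real" and H :: "real^2 \<Rightarrow> real"
  assumes X: "\<And>y. (X has_derivative (\<lambda>h. \<Sum>j\<in>UNIV. X' j y * h $ j)) (at y)"
    and X': "\<And>j y. (X' j has_derivative (\<lambda>h. \<Sum>k\<in>UNIV. X'' j k y * h $ k)) (at y)"
    and S: "\<forall>\<^sub>F s in nhds s0. (S has_derivative (\<lambda>h. S1 s * h $ 1 + S2 s * h $ 2)) (at s)"
    and q: "\<forall>\<^sub>F s in nhds s0. (q has_derivative (\<lambda>h. q1 s * h $ 1 + q2 s * h $ 2)) (at s)"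
    and S2: "(S2 has_derivative DS) (at s0)" and q2: "(q2 has_derivative Dq) (at s0)"
    and zero: "\<And>s. X (emb3 s (S s)) = 0" and eq: "q s0 = S s0"
    and H: "\<And>s. H s = X (emb3 s (q s))"
    and H': "\<And>s. (H has_derivative (\<lambda>h. \<Sum>j\<in>UNIV. H' j s * h $ j)) (at s)"
    and H2': "(H' 2 has_derivative (\<lambda>h. \<Sum>j\<in>UNIV. H2' j * h $ j)) (at s0)"
  shows "H' 1 s0 = X' 3 (emb3 s0 (S s0)) * (q1 s0 - S1 s0)"
    and "H' 2 s0 = X' 3 (emb3 s0 (S s0)) * (q2 s0 - S2 s0)"
    and "q2 s0 = S2 s0 \<Longrightarrow> H2' 2 = X' 3 (emb3 s0 (S s0)) * (Dq (axis 2 1) - DS (axis 2 1))"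
proof -
  have Heq: "\<forall>\<^sub>F s in nhds s0. H' 1 s = X' 1 (emb3 s (q s)) + X' 3 (emb3 s (q s)) * q1 s \<and>
      H' 2 s = X' 2 (emb3 s (q s)) + X' 3 (emb3 s (q s)) * q2 s"
    using q
  proof eventually_elim
    case (elim s)
    have "(H has_derivative (\<lambda>h. (X' 1 (emb3 s (q s)) + X' 3 (emb3 s (q s)) * q1 s) * h $ 1
       + (X' 2 (emb3 s (q s)) + X' 3 (emb3 s (q s)) * q2 s) * h $ 2)) (at s)"
      unfolding H using has_derivative_eq_rhs[OF chain_emb3[OF X elim]] by (simp add: fun_eq_iff algebra_simps)
    moreover have "(H has_derivative (\<lambda>h. H' 1 s * h $ 1 + H' 2 s * h $ 2)) (at s)"
      using H'[of s] by (simp add: sum_2)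
    ultimately show ?case using has_derivative_axis_unique by blast
  qed
  have Seq: "\<forall>\<^sub>F s in nhds s0. 0 = X' 1 (emb3 s (S s)) + X' 3 (emb3 s (S s)) * S1 s \<and>
      0 = X' 2 (emb3 s (S s)) + X' 3 (emb3 s (S s)) * S2 s"
    using S
  proof eventually_elim
    case (elim s)
    have "((\<lambda>s. 0) has_derivative (\<lambda>h. (X' 1 (emb3 s (S s)) + X' 3 (emb3 s (S s)) * S1 s) * h $ 1
       + (X' 2 (emb3 s (S s)) + X' 3 (emb3 s (S s)) * S2 s) * h $ 2)) (at s)"
      using has_derivative_eq_rhs[OF chain_emb3[OF X elim]] by (simp add: zero fun_eq_iff algebra_simps)
    moreover have "((\<lambda>s::real^2. 0::real) has_derivative (\<lambda>h. 0 * h $ 1 + 0 * h $ 2)) (at s)"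
      by simp
    ultimately show ?case using has_derivative_axis_unique by blast
  qed
  note H0 = eventually_nhds_x_imp_x[OF Heq] and S0 = eventually_nhds_x_imp_x[OF Seq]
  show "H' 1 s0 = X' 3 (emb3 s0 (S s0)) * (q1 s0 - S1 s0)"
    "H' 2 s0 = X' 3 (emb3 s0 (S s0)) * (q2 s0 - S2 s0)"
    using H0 S0 by (simp_all add: eq algebra_simps)
  assume m: "q2 s0 = S2 s0"
  let ?\<Phi> = "\<lambda>f f2 s. X' 2 (emb3 s (f s)) + X' 3 (emb3 s (f s)) * f2 s"
  let ?c = "\<lambda>f f2. X'' 2 2 (emb3 s0 (f s0)) + X'' 2 3 (emb3 s0 (f s0)) * f2 s0
        + (X'' 3 2 (emb3 s0 (f s0)) + X'' 3 3 (emb3 s0 (f s0)) * f2 s0) * f2 s0"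
  obtain \<Phi>q where \<Phi>q: "(?\<Phi> q q2 has_derivative \<Phi>q) (at s0)"
    "\<Phi>q (axis 2 1) = ?c q q2 + X' 3 (emb3 s0 (q s0)) * Dq (axis 2 1)"
    using second_order_chain[where X' = X' and X'' = X'' and f = q and ?f1.0 = q1 and ?f2.0 = q2 and D = Dq and ?s0.0 = s0, OF X' eventually_nhds_x_imp_x[OF q] q2] by blast
  obtain \<Phi>S where \<Phi>S: "(?\<Phi> S S2 has_derivative \<Phi>S) (at s0)"
    "\<Phi>S (axis 2 1) = ?c S S2 + X' 3 (emb3 s0 (S s0)) * DS (axis 2 1)"
    using second_order_chain[where X' = X' and X'' = X'' and f = S and ?f1.0 = S1 and ?f2.0 = S2 and D = DS and ?s0.0 = s0, OF X' eventually_nhds_x_imp_x[OF S] S2] by blast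
  have "(H' 2 has_derivative \<Phi>q) (at s0)"
    by (rule has_derivative_eventually_eq[OF \<Phi>q(1)]) (use Heq in \<open>auto elim: eventually_mono\<close>)
  then have "\<Phi>q = (\<lambda>h. \<Sum>j\<in>UNIV. H2' j * h $ j)" using has_derivative_unique H2' by blast
  then have "\<Phi>q (axis 2 1) = H2' 2" by (simp add: sum_2 axis_def)
  moreover have "((\<lambda>s. 0) has_derivative \<Phi>S) (at s0)"
    by (rule has_derivative_eventually_eq[OF \<Phi>S(1)]) (use Seq in \<open>auto elim: eventually_mono\<close>)
  then have "\<Phi>S = (\<lambda>h. 0)" using has_derivative_unique has_derivative_const by blast
  then have "\<Phi>S (axis 2 1) = 0" by simp
  ultimately show "H2' 2 = X' 3 (emb3 s0 (S s0)) * (Dq (axis 2 1) - DS (axis 2 1))"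
    using \<Phi>q(2) \<Phi>S(2) by (simp add: m eq algebra_simps)
qed

section \<open>Gradient and Hessian of the Lagrangian\<close>

lemma gradient_eq:
  assumes "GDERIV f x :> D" shows "gradient f x = D"
  unfolding gradient_def
proof (rule the_equality)
  show "GDERIV f x :> D" by (rule assms)
  fix D' assume "GDERIV f x :> D'"
  then have eq: "(\<lambda>h. h \<bullet> D') = (\<lambda>h. h \<bullet> D)"
    using assms has_derivative_unique unfolding gderiv_def by blast
  have "(D' - D) \<bullet> D' = (D' - D) \<bullet> D" using fun_cong[OF eq, of "D' - D"] by simp
  then have "(D' - D) \<bullet> (D' - D) = 0" by (simp add: inner_diff_right)
  then show "D' = D" by simp
qed

lemma gderiv_vec2:
  fixes f :: "real^2 \<Rightarrow> real"
  shows "GDERIV f s :> vector [a, b] \<longleftrightarrow> (f has_derivative (\<lambda>h. a * h $ 1 + b * h $ 2)) (at s)"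
proof -
  have "(\<lambda>h::real^2. h \<bullet> vector [a, b]) = (\<lambda>h. a * h $ 1 + b * h $ 2)"
    by (simp add: inner_vec_def sum_2 fun_eq_iff mult.commute)
  then show ?thesis by (simp add: gderiv_def)
qed

definition proj2 :: "real^3 \<Rightarrow> real^2" where "proj2 y = vector [y $ 1, y $ 2]"

lemma proj2_nth [simp]: "proj2 y $ 1 = y $ 1" "proj2 y $ 2 = y $ 2"
  by (simp_all add: proj2_def)

lemma proj2_vector [simp]: "proj2 (vector [s $ 1, s $ 2, \<mu>]) = s"
  by (simp add: vec_eq_iff forall_2)

lemma bounded_linear_proj2: "bounded_linear proj2"
  unfolding linear_conv_bounded_linear[symmetric]
  by (rule linearI) (simp_all add: vec_eq_iff forall_2)

lemma gradient_lagrangian: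
  assumes "(constraint w \<epsilon> A has_derivative (\<lambda>h. a * h $ 1 + b * h $ 2)) (at (proj2 y))"
  shows "GDERIV (lagrangian w \<epsilon> A) y :> vector [1 - y $ 3 * a, - (y $ 3 * b), - constraint w \<epsilon> A (proj2 y)]"
proof -
  have g: "((\<lambda>y. constraint w \<epsilon> A (proj2 y)) has_derivative (\<lambda>h. a * proj2 h $ 1 + b * proj2 h $ 2)) (at y)"
    by (rule has_derivative_compose[OF bounded_linear_imp_has_derivative[OF bounded_linear_proj2] assms])
  have L: "lagrangian w \<epsilon> A = (\<lambda>y. y $ 1 - y $ 3 * constraint w \<epsilon> A (proj2 y))"
    by (simp add: lagrangian_def proj2_def fun_eq_iff)
  show ?thesis
    unfolding gderiv_def L
    by (rule has_derivative_eq_rhs[OF has_derivative_diff[OF has_derivative_vec_nth has_derivative_mult[OF has_derivative_vec_nth g]]])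
      (simp add: fun_eq_iff inner_vec_def sum_3 algebra_simps)
qed

lemma multiplier_eq:
  assumes opt: "optimizer w \<epsilon> A = s"
    and g: "(constraint w \<epsilon> A has_derivative (\<lambda>h. a * h $ 1 + 0 * h $ 2)) (at s)" "a \<noteq> 0" "constraint w \<epsilon> A s = 0"
  shows "multiplier w \<epsilon> A = 1 / a"
proof -
  have gr: "gradient (lagrangian w \<epsilon> A) (kkt_point w \<epsilon> A \<mu>) = vector [1 - \<mu> * a, 0, 0]" for \<mu>
    using gradient_eq[OF gradient_lagrangian[of w \<epsilon> A a 0 "kkt_point w \<epsilon> A \<mu>"]] g
    by (simp add: kkt_point_def opt)
  have "gradient (lagrangian w \<epsilon> A) (kkt_point w \<epsilon> A \<mu>) = 0 \<longleftrightarrow> \<mu> = 1 / a" for \<mu>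
    unfolding gr using g(2) by (auto simp: vec_eq_iff forall_3 field_simps)
  then show ?thesis by (simp add: multiplier_def)
qed

text \<open>If \<open>D2 (axis 2 1) = 0\<close> then the second and third column of the Hessian are both multiples
  of the first unit vector.\<close>

lemma hessian_lagrangian_invertible:
  assumes g: "\<forall>\<^sub>F s in nhds s0. (constraint w \<epsilon> A has_derivative (\<lambda>h. g1 s * h $ 1 + g2 s * h $ 2)) (at s)"
    and D: "(g1 has_derivative D1) (at s0)" "(g2 has_derivative D2) (at s0)"
    and g0: "g1 s0 \<noteq> 0" "g2 s0 = 0"
    and inv: "invertible (hessian (lagrangian w \<epsilon> A) (vector [s0 $ 1, s0 $ 2, \<mu>]))"
  shows "D2 (axis 2 1) \<noteq> 0"
proof
  assume D2: "D2 (axis 2 1) = 0"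
  let ?k = "vector [s0 $ 1, s0 $ 2, \<mu>] :: real^3"
  let ?G = "\<lambda>y::real^3. vector [1 - y $ 3 * g1 (proj2 y), - (y $ 3 * g2 (proj2 y)), - constraint w \<epsilon> A (proj2 y)] :: real^3"
  have pk: "proj2 ?k = s0" by simp
  have lim: "filterlim proj2 (nhds s0) (nhds ?k)"
    using bounded_linear.tendsto[OF bounded_linear_proj2 filterlim_ident[of "nhds ?k"]] by simp
  have ev: "\<forall>\<^sub>F y in nhds ?k. ?G y = gradient (lagrangian w \<epsilon> A) y"
    using eventually_compose_filterlim[OF g lim]
    by eventually_elim (rule gradient_eq[OF gradient_lagrangian, symmetric])
  have p: "((\<lambda>y. f (proj2 y)) has_derivative (\<lambda>h. f' (proj2 h))) (at ?k)" if "(f has_derivative f') (at s0)"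
    for f :: "real^2 \<Rightarrow> real" and f'
    by (rule has_derivative_compose[OF bounded_linear_imp_has_derivative[OF bounded_linear_proj2]]) (simp add: that)
  define G' where "G' h = (vector [- (\<mu> * D1 (proj2 h) + h $ 3 * g1 s0), - (\<mu> * D2 (proj2 h) + h $ 3 * g2 s0),
      - (g1 s0 * h $ 1 + g2 s0 * h $ 2)] :: real^3)" for h :: "real^3"
  have lin: "G' h $ 1 = - (\<mu> * D1 (proj2 h) + h $ 3 * g1 s0)" "G' h $ 2 = - (\<mu> * D2 (proj2 h) + h $ 3 * g2 s0)"
    "G' h $ 3 = - (g1 s0 * h $ 1 + g2 s0 * h $ 2)" for h
    by (simp_all add: G'_def)
  have "(?G has_derivative G') (at ?k)"
    unfolding has_derivative_componentwise_within[of ?G]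
  proof
    fix i :: "real^3" assume "i \<in> Basis"
    then obtain j where j: "i = axis j 1" by (auto simp: Basis_vec_def)
    have 1: "((\<lambda>y. 1 - y $ 3 * g1 (proj2 y)) has_derivative (\<lambda>h. G' h $ 1)) (at ?k)"
      by (rule has_derivative_eq_rhs[OF has_derivative_diff[OF has_derivative_const has_derivative_mult[OF has_derivative_vec_nth p[OF D(1)]]]])
        (simp add: lin fun_eq_iff)
    have 2: "((\<lambda>y. - (y $ 3 * g2 (proj2 y))) has_derivative (\<lambda>h. G' h $ 2)) (at ?k)"
      by (rule has_derivative_eq_rhs[OF has_derivative_minus[OF has_derivative_mult[OF has_derivative_vec_nth p[OF D(2)]]]])
        (simp add: lin fun_eq_iff)
    have 3: "((\<lambda>y. - constraint w \<epsilon> A (proj2 y)) has_derivative (\<lambda>h. G' h $ 3)) (at ?k)"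
      by (rule has_derivative_eq_rhs[OF has_derivative_minus[OF p[OF eventually_nhds_x_imp_x[OF g]]]])
        (simp add: lin fun_eq_iff)
    show "((\<lambda>y. ?G y \<bullet> i) has_derivative (\<lambda>h. G' h \<bullet> i)) (at ?k)"
      using exhaust_3[of j] 1 2 3 by (auto simp: j inner_axis)
  qed
  then have G': "(gradient (lagrangian w \<epsilon> A) has_derivative G') (at ?k)"
    by (rule has_derivative_eventually_eq) (use ev in \<open>auto elim: eventually_mono\<close>)
  \<comment> \<open>A combination of the second and third unit vectors in which the first entries of
    the corresponding columns cancel; its second entry \<open>g1 s0\<close> keeps it
    nonzero.\<close>
  define a where "a = (vector [0, g1 s0, - (\<mu> * D1 (axis 2 1))] :: real^3)"
  have pa: "proj2 a = g1 s0 *\<^sub>R axis 2 1" by (simp add: vec_eq_iff forall_2 a_def axis_def)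
  interpret D1: bounded_linear D1 by (rule has_derivative_bounded_linear[OF D(1)])
  interpret D2: bounded_linear D2 by (rule has_derivative_bounded_linear[OF D(2)])
  have "G' a = 0"
    by (simp add: vec_eq_iff forall_3 lin pa D1.scaleR D2.scaleR D2 g0(2)) (simp add: a_def)
  moreover have "hessian (lagrangian w \<epsilon> A) ?k *v a = G' a"
    using jacobian_works[of "gradient (lagrangian w \<epsilon> A)" "at ?k"] has_derivative_unique[OF _ G']
      differentiableI[OF G'] by (metis hessian_def)
  ultimately have "hessian (lagrangian w \<epsilon> A) ?k *v a = 0" by simp
  moreover obtain B where "B ** hessian (lagrangian w \<epsilon> A) ?k = mat 1"
    using inv unfolding invertible_def by blast
  ultimately have "a = 0" using matrix_left_invertible_ker by blast
  then have "a $ 2 = 0" by simp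
  then show False using g0(1) by (simp add: a_def)
qed

section \<open>Feasible points and maximizers at nearby parameters\<close>

lemma norm_emb3_le: "norm (emb3 s \<tau>) \<le> norm s + \<bar>\<tau>\<bar>"
proof -
  have "norm (emb3 s \<tau>) = sqrt (((s $ 1)\<^sup>2 + (s $ 2)\<^sup>2) + \<tau>\<^sup>2)"
    by (simp add: norm_vec_def L2_set_def sum_3)
  also have "\<dots> \<le> sqrt ((s $ 1)\<^sup>2 + (s $ 2)\<^sup>2) + sqrt (\<tau>\<^sup>2)"
    by (rule sqrt_add_le_add_sqrt) auto
  also have "\<dots> = norm s + \<bar>\<tau>\<bar>" by (simp add: norm_vec_def L2_set_def sum_2)
  finally show ?thesis .
qed

lemma emb3_diff: "emb3 s \<tau> - emb3 s' \<tau>' = emb3 (s - s') (\<tau> - \<tau>')"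
  by (simp add: vec_eq_iff forall_3)

lemma DERIV_emb3:
  assumes "\<And>y. (X has_derivative (\<lambda>h. \<Sum>j\<in>UNIV. X' j y * h $ j)) (at (y::real^3))"
  shows "((\<lambda>\<tau>. X (emb3 s \<tau>)) has_real_derivative X' 3 (emb3 s \<tau>)) (at \<tau>)"
proof -
  have "((\<lambda>\<tau>. emb3 s \<tau>) has_derivative (\<lambda>h. emb3 0 h)) (at \<tau>)"
    using bounded_linear.has_derivative[OF bounded_linear_emb3 has_derivative_Pair[OF has_derivative_const has_derivative_ident]]
    by simp
  from has_derivative_compose[OF this assms] show ?thesis
    unfolding has_field_derivative_def by (rule has_derivative_eq_rhs) (simp add: sum_3 fun_eq_iff)
qed

lemma isCont_eventually_pos:
  fixes f :: "'a::t2_space \<Rightarrow> real"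
  assumes "isCont f x" "0 < f x"
  shows "\<forall>\<^sub>F y in nhds x. 0 < f y"
  using assms order_tendstoD(1) unfolding isCont_def tendsto_at_iff_tendsto_nhds by blast

text \<open>Near the base point \<open>X' 3\<close> has the sign of \<open>\<kappa>\<close>, so
  \<open>\<kappa> * X\<close> increases in the third coordinate and vanishes at
  \<open>S \<nu> s\<close>: a positive value at \<open>q s\<close> puts \<open>q s\<close> above
  \<open>S \<nu> s\<close>. Continuity of \<open>S\<close> and \<open>q\<close> keeps the segment
  between the two values inside that neighbourhood.\<close>

lemma reduced_equation_sign:
  fixes X :: "real^'d \<Rightarrow> real^3 \<Rightarrow> real"
  assumes X: "\<And>\<nu> y. (X \<nu> has_derivative (\<lambda>h. \<Sum>j\<in>UNIV. X' j \<nu> y * h $ j)) (at y)"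
    and X'3: "isCont (\<lambda>p. X' 3 (fst p) (snd p)) (\<nu>0, emb3 s0 (q s0))" "X' 3 \<nu>0 (emb3 s0 (q s0)) \<noteq> 0"
    and S: "isCont (\<lambda>p. S (fst p) (snd p)) (\<nu>0, s0)" and q: "isCont q s0" and eq: "S \<nu>0 s0 = q s0"
    and zero: "\<And>\<nu> s. X \<nu> (emb3 s (S \<nu> s)) = 0"
  shows "\<exists>\<kappa> \<delta>. \<kappa> \<noteq> 0 \<and> \<delta> > 0 \<and>
    (\<forall>\<nu>\<in>ball \<nu>0 \<delta>. \<forall>s\<in>ball s0 \<delta>. \<kappa> * X \<nu> (emb3 s (q s)) > 0 \<longrightarrow> S \<nu> s < q s)"
proof -
  define \<kappa> where "\<kappa> = X' 3 \<nu>0 (emb3 s0 (q s0))"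
  have \<kappa>: "\<kappa> \<noteq> 0" using X'3(2) by (simp add: \<kappa>_def)
  have "isCont (\<lambda>p. \<kappa> * X' 3 (fst p) (snd p)) (\<nu>0, emb3 s0 (q s0))"
    by (intro continuous_mult X'3(1) continuous_const)
  moreover have "0 < \<kappa> * X' 3 (fst (\<nu>0, emb3 s0 (q s0))) (snd (\<nu>0, emb3 s0 (q s0)))"
    using \<kappa> by (simp add: \<kappa>_def[symmetric]) (metis not_real_square_gt_zero)
  ultimately have "\<forall>\<^sub>F p in nhds (\<nu>0, emb3 s0 (q s0)). 0 < \<kappa> * X' 3 (fst p) (snd p)"
    by (rule isCont_eventually_pos)
  then obtain d where d: "d > 0" "\<And>p. dist p (\<nu>0, emb3 s0 (q s0)) < d \<Longrightarrow> 0 < \<kappa> * X' 3 (fst p) (snd p)"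
    unfolding eventually_nhds_metric by blast
  \<comment> \<open>Parameter, point and third coordinate may each deviate by at most
    \<open>d / 4\<close>, which keeps the combined distance below \<open>d\<close>.\<close>
  have d4: "d / 4 > 0" using d(1) by simp
  obtain d1 where d1: "d1 > 0" "\<And>p. dist p (\<nu>0, s0) < d1 \<Longrightarrow> dist (S (fst p) (snd p)) (q s0) < d / 4"
    using S d4 unfolding continuous_at_eps_delta by (metis eq fst_conv snd_conv)
  obtain d2 where d2: "d2 > 0" "\<And>s. dist s s0 < d2 \<Longrightarrow> dist (q s) (q s0) < d / 4"
    using q d4 unfolding continuous_at_eps_delta by blast
  define \<delta> where "\<delta> = min (d / 4) (min (d1 / 2) d2)"
  have \<delta>: "\<delta> > 0" "\<delta> \<le> d / 4" "\<delta> \<le> d1 / 2" "\<delta> \<le> d2" using d4 d1 d2 by (auto simp: \<delta>_def)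
  have "S \<nu> s < q s" if \<nu>: "\<nu> \<in> ball \<nu>0 \<delta>" and s: "s \<in> ball s0 \<delta>" and pos: "\<kappa> * X \<nu> (emb3 s (q s)) > 0" for \<nu> s
  proof (rule ccontr)
    assume "\<not> S \<nu> s < q s"
    moreover have "q s \<noteq> S \<nu> s" using pos zero[of \<nu> s] by auto
    ultimately have lt: "q s < S \<nu> s" by simp
    have n: "dist \<nu> \<nu>0 < \<delta>" "dist s s0 < \<delta>" using \<nu> s by (auto simp: dist_commute)
    have "dist (\<nu>, s) (\<nu>0, s0) \<le> dist \<nu> \<nu>0 + dist s s0"
      unfolding dist_Pair_Pair by (rule sqrt_sum_squares_le_sum) auto
    then have "dist (\<nu>, s) (\<nu>0, s0) < d1" using n \<delta>(3) by linarith
    from d1(2)[OF this] have S1: "\<bar>S \<nu> s - q s0\<bar> < d / 4" by (simp add: dist_real_def)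
    have q1: "\<bar>q s - q s0\<bar> < d / 4" using d2(2)[of s] n(2) \<delta>(4) by (simp add: dist_real_def)
    have der: "\<exists>y. ((\<lambda>\<tau>. \<kappa> * X \<nu> (emb3 s \<tau>)) has_real_derivative y) (at \<tau>) \<and> 0 < y" if "q s \<le> \<tau>" "\<tau> \<le> S \<nu> s" for \<tau>
    proof (intro exI conjI)
      show "((\<lambda>\<tau>. \<kappa> * X \<nu> (emb3 s \<tau>)) has_real_derivative \<kappa> * X' 3 \<nu> (emb3 s \<tau>)) (at \<tau>)"
        by (rule DERIV_cmult[OF DERIV_emb3]) (rule X)
      have "dist (emb3 s \<tau>) (emb3 s0 (q s0)) \<le> dist s s0 + \<bar>\<tau> - q s0\<bar>"
        using norm_emb3_le[of "s - s0" "\<tau> - q s0"] by (simp add: dist_norm emb3_diff)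
      moreover have "\<bar>\<tau> - q s0\<bar> < d / 4" using that S1 q1 by linarith
      moreover have "dist (\<nu>, emb3 s \<tau>) (\<nu>0, emb3 s0 (q s0)) \<le> dist \<nu> \<nu>0 + dist (emb3 s \<tau>) (emb3 s0 (q s0))"
        unfolding dist_Pair_Pair by (rule sqrt_sum_squares_le_sum) auto
      ultimately have "dist (\<nu>, emb3 s \<tau>) (\<nu>0, emb3 s0 (q s0)) < d" using n \<delta>(2) d4 by linarith
      from d(2)[OF this] show "0 < \<kappa> * X' 3 \<nu> (emb3 s \<tau>)" by simp
    qed
    have "\<kappa> * X \<nu> (emb3 s (q s)) < \<kappa> * X \<nu> (emb3 s (S \<nu> s))"
      by (rule DERIV_pos_imp_increasing[OF lt der])
    then show False using pos zero[of \<nu> s] by simp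
  qed
  then show ?thesis using \<kappa> \<delta>(1) by blast
qed

text \<open>Two halves. By compactness, for \<nu> near \<open>\<nu>0\<close> every feasible point
  with first coordinate at least \<open>s0 $ 1 - \<eta>\<close> lies in the ball, since otherwise a
  limit point would be a second optimizer at \<open>\<nu>0\<close>. Conversely, a strictly feasible
  point close to \<open>s0\<close> stays feasible for nearby \<nu>, so the maximum cannot drop below
  \<open>s0 $ 1 - \<eta>\<close>.\<close>

lemma maximizers_converge:
  fixes g :: "'a::metric_space \<Rightarrow> real^2 \<Rightarrow> real"
  assumes cont0: "\<And>s. isCont (\<lambda>p. g (fst p) (snd p)) (\<nu>0, s)"
    and cont: "\<And>\<nu>. continuous_on UNIV (g \<nu>)"
    and bdd: "\<forall>\<^sub>F \<nu> in nhds \<nu>0. \<forall>s. g \<nu> s \<le> 0 \<longrightarrow> norm s \<le> R"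
    and opt: "\<And>t. g \<nu>0 t \<le> 0 \<Longrightarrow> t $ 1 \<le> s0 $ 1" and uniq: "\<And>t. g \<nu>0 t \<le> 0 \<Longrightarrow> t $ 1 = s0 $ 1 \<Longrightarrow> t = s0"
    and strict: "\<And>e. e > 0 \<Longrightarrow> \<exists>s\<in>ball s0 e. g \<nu>0 s < 0" and e: "e > 0"
  shows "\<forall>\<^sub>F \<nu> in nhds \<nu>0. \<exists>t\<in>ball s0 e. g \<nu> t \<le> 0 \<and> (\<forall>t'. g \<nu> t' \<le> 0 \<longrightarrow> t' $ 1 \<le> t $ 1)"
proof -
  have "\<exists>\<eta>>0. \<forall>\<^sub>F \<nu> in nhds \<nu>0. \<forall>s. g \<nu> s \<le> 0 \<and> s0 $ 1 - \<eta> \<le> s $ 1 \<longrightarrow> s \<in> ball s0 e"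
  proof (rule ccontr)
    assume neg: "\<not> (\<exists>\<eta>>0. \<forall>\<^sub>F \<nu> in nhds \<nu>0. \<forall>s. g \<nu> s \<le> 0 \<and> s0 $ 1 - \<eta> \<le> s $ 1 \<longrightarrow> s \<in> ball s0 e)"
    define h where "h n = 1 / real (Suc n)" for n
    have h: "h n > 0" for n by (simp add: h_def)
    have h0: "h \<longlonglongrightarrow> 0" unfolding h_def by (rule LIMSEQ_Suc[OF lim_1_over_n])
    let ?Q = "\<lambda>n p. dist (fst p) \<nu>0 < h n \<and> norm (snd p) \<le> R \<and> g (fst p) (snd p) \<le> 0 \<and>
      s0 $ 1 - h n \<le> snd p $ 1 \<and> snd p \<notin> ball s0 e"
    have "\<exists>p. ?Q n p" for n
    proof (rule ccontr)
      assume no: "\<nexists>p. ?Q n p"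
      have "\<forall>\<^sub>F \<nu> in nhds \<nu>0. dist \<nu> \<nu>0 < h n" using h[of n] by (auto simp: eventually_nhds_metric)
      with bdd have "\<forall>\<^sub>F \<nu> in nhds \<nu>0. \<forall>s. g \<nu> s \<le> 0 \<and> s0 $ 1 - h n \<le> s $ 1 \<longrightarrow> s \<in> ball s0 e"
        by eventually_elim (use no in fastforce)
      then show False using neg h by blast
    qed
    then have "\<forall>n. \<exists>p. ?Q n p"
      by blast
    from choice[OF this] obtain p where p: "\<And>n. dist (fst (p n)) \<nu>0 < h n" "\<And>n. norm (snd (p n)) \<le> R"
      "\<And>n. g (fst (p n)) (snd (p n)) \<le> 0" "\<And>n. s0 $ 1 - h n \<le> snd (p n) $ 1" "\<And>n. snd (p n) \<notin> ball s0 e"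
      by blast
    have "\<forall>n. (snd \<circ> p) n \<in> cball 0 R" using p(2) by simp
    then obtain l r where l: "strict_mono r" "((snd \<circ> p) \<circ> r) \<longlonglongrightarrow> l"
      using compact_cball[of "0::real^2" R] unfolding compact_def by blast
    have s: "(\<lambda>n. snd (p (r n))) \<longlonglongrightarrow> l" using l(2) by (simp add: o_def)
    have hr: "(\<lambda>n. h (r n)) \<longlonglongrightarrow> 0" using LIMSEQ_subseq_LIMSEQ[OF h0 l(1)] by (simp add: o_def)
    have \<nu>: "(\<lambda>n. fst (p (r n))) \<longlonglongrightarrow> \<nu>0"
      unfolding tendsto_dist_iff[of _ \<nu>0]
      by (rule tendsto_sandwich[OF _ _ tendsto_const hr]) (auto intro!: always_eventually less_imp_le p(1))
    have "(\<lambda>n. (fst (p (r n)), snd (p (r n)))) \<longlonglongrightarrow> (\<nu>0, l)" by (rule tendsto_Pair[OF \<nu> s])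
    then have "(\<lambda>n. g (fst (p (r n))) (snd (p (r n)))) \<longlonglongrightarrow> g \<nu>0 l"
      using isCont_tendsto_compose[OF cont0] by fastforce
    then have g0: "g \<nu>0 l \<le> 0"
      by (rule tendsto_upperbound) (auto intro!: always_eventually p(3))
    have "s0 $ 1 - 0 \<le> l $ 1"
      by (rule tendsto_le[OF _ tendsto_vec_nth[OF s] tendsto_diff[OF tendsto_const hr]])
        (auto intro!: always_eventually p(4))
    then have "l = s0" using opt[OF g0] uniq[OF g0] by simp
    moreover have "e \<le> dist s0 l"
      by (rule tendsto_lowerbound[OF tendsto_dist[OF tendsto_const s]])
        (use p(5) in \<open>auto intro!: always_eventually simp: not_less\<close>)
    ultimately show False using e by simp
  qed
  then obtain \<eta> where \<eta>: "\<eta> > 0"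
    "\<forall>\<^sub>F \<nu> in nhds \<nu>0. \<forall>s. g \<nu> s \<le> 0 \<and> s0 $ 1 - \<eta> \<le> s $ 1 \<longrightarrow> s \<in> ball s0 e" by blast
  obtain s' where s': "s' \<in> ball s0 \<eta>" "g \<nu>0 s' < 0" using strict[OF \<eta>(1)] by blast
  have s'1: "s0 $ 1 - \<eta> \<le> s' $ 1"
    using component_le_norm_cart[of "s0 - s'" 1] s'(1) by (simp add: dist_norm)
  have "((\<lambda>\<nu>. (\<nu>, s')) \<longlongrightarrow> (\<nu>0, s')) (nhds \<nu>0)" by (intro tendsto_Pair tendsto_const filterlim_ident)
  then have "((\<lambda>\<nu>. g \<nu> s') \<longlongrightarrow> g \<nu>0 s') (nhds \<nu>0)"
    using isCont_tendsto_compose[OF cont0[of s']] by fastforce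
  then have "\<forall>\<^sub>F \<nu> in nhds \<nu>0. g \<nu> s' < 0" using s'(2) by (rule order_tendstoD(2))
  with \<eta>(2) bdd show ?thesis
  proof eventually_elim
    case (elim \<nu>)
    have eqF: "{s. g \<nu> s \<le> 0} = g \<nu> -` {..0}" by auto
    have "closed {s. g \<nu> s \<le> 0}" unfolding eqF
      by (rule continuous_closed_vimage[OF closed_atMost]) (use cont[of \<nu>] in \<open>simp add: continuous_on_eq_continuous_at\<close>)
    moreover have "bounded {s. g \<nu> s \<le> 0}" using elim(2) by (auto simp: bounded_iff)
    ultimately have "compact {s. g \<nu> s \<le> 0}" by (simp add: compact_eq_bounded_closed)
    moreover have "s' \<in> {s. g \<nu> s \<le> 0}" using elim(3) by simp
    moreover have "continuous_on {s. g \<nu> s \<le> 0} (\<lambda>s. s $ 1)" by (intro continuous_intros)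
    ultimately obtain t where t: "g \<nu> t \<le> 0" "\<And>t'. g \<nu> t' \<le> 0 \<Longrightarrow> t' $ 1 \<le> t $ 1"
      using continuous_attains_sup[of "{s. g \<nu> s \<le> 0}" "\<lambda>s. s $ 1"] by blast
    have "s0 $ 1 - \<eta> \<le> t $ 1" using t(2)[of s'] elim(3) s'1 by simp
    then have "t \<in> ball s0 e" using elim(1) t(1) by blast
    then show ?case using t by blast
  qed
qed

subsection \<open>Analyticity of the optimizer\<close>

lemma real_analytic_at_imp_ana_le_shift:
  assumes "real_analytic_at h a"
  shows "\<exists>r0>0. \<exists>B. \<forall>r. 0 < r \<and> r \<le> r0 \<longrightarrow> ana_le r (\<lambda>x. h (a + x)) B"
proof -
  obtain r0 where r0: "r0 > 0" "\<And>r. 0 < r \<Longrightarrow> r \<le> r0 \<Longrightarrow> ana_le r (\<lambda>x. h (a + x) - h a) 1"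
    using real_analytic_at_imp_ana_le[OF assms zero_less_one] by blast
  have "ana_le r (\<lambda>x. h (a + x)) (1 + \<bar>h a\<bar>)" if "0 < r" "r \<le> r0" for r
    using ana_le_add[OF that(1) r0(2)[OF that] ana_le_const[of r "h a"]] by simp
  then show ?thesis using r0(1) by blast
qed

lemma real_analytic_at_const: "real_analytic_at (\<lambda>_. b) a"
  by (rule ana_le_imp_real_analytic_at[where r = 1, OF _ ana_le_const]) auto

lemma real_analytic_at_add:
  assumes "real_analytic_at f a" "real_analytic_at g a"
  shows "real_analytic_at (\<lambda>x. f x + g x) a"
proof -
  obtain r1 B1 where 1: "r1 > 0" "\<And>r. 0 < r \<Longrightarrow> r \<le> r1 \<Longrightarrow> ana_le r (\<lambda>x. f (a + x)) B1"
    using real_analytic_at_imp_ana_le_shift[OF assms(1)] by blast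
  obtain r2 B2 where 2: "r2 > 0" "\<And>r. 0 < r \<Longrightarrow> r \<le> r2 \<Longrightarrow> ana_le r (\<lambda>x. g (a + x)) B2"
    using real_analytic_at_imp_ana_le_shift[OF assms(2)] by blast
  have r: "min r1 r2 > 0" using 1(1) 2(1) by simp
  show ?thesis
    by (rule ana_le_imp_real_analytic_at[OF r ana_le_add[OF r 1(2) 2(2)]]) (use 1(1) 2(1) in auto)
qed

lemma real_analytic_at_cmult:
  assumes "real_analytic_at f a"
  shows "real_analytic_at (\<lambda>x. b * f x) a"
proof -
  obtain r1 B1 where 1: "r1 > 0" "\<And>r. 0 < r \<Longrightarrow> r \<le> r1 \<Longrightarrow> ana_le r (\<lambda>x. f (a + x)) B1"
    using real_analytic_at_imp_ana_le_shift[OF assms(1)] by blast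
  show ?thesis
    by (rule ana_le_imp_real_analytic_at[OF 1(1) ana_le_cmult[OF 1(2)]]) (use 1(1) in auto)
qed

lemma real_analytic_at_sum:
  "(\<And>i. i \<in> A \<Longrightarrow> real_analytic_at (f i) a) \<Longrightarrow> real_analytic_at (\<lambda>x. \<Sum>i\<in>A. f i x) a"
  by (induction A rule: infinite_finite_induct) (auto intro: real_analytic_at_const real_analytic_at_add)

lemma real_analytic_at_eventually_eq:
  assumes f: "real_analytic_at f a" and eq: "\<forall>\<^sub>F x in nhds a. g x = f x"
  shows "real_analytic_at g a"
proof -
  obtain r1 B1 where 1: "r1 > 0" "\<And>r. 0 < r \<Longrightarrow> r \<le> r1 \<Longrightarrow> ana_le r (\<lambda>x. f (a + x)) B1"
    using real_analytic_at_imp_ana_le_shift[OF f] by blast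
  obtain d where d: "d > 0" "\<And>x. dist x a < d \<Longrightarrow> g x = f x"
    using eq unfolding eventually_nhds_metric by blast
  have r: "min r1 d > 0" using 1(1) d(1) by simp
  show ?thesis
    by (rule ana_le_imp_real_analytic_at[OF r 1(2)[OF r]]) (use d in \<open>auto simp: dist_norm\<close>)
qed

lemma real_analytic_at_isCont:
  assumes "real_analytic_at f a"
  shows "isCont f a"
proof -
  have "((\<lambda>x. (x, 0 :: real^2)) \<longlongrightarrow> (a, 0)) (at a)" by (intro tendsto_Pair tendsto_const tendsto_ident_at)
  from isCont_tendsto_compose[OF poly_ana_isCont[OF poly_ana.coef[OF assms]] this]
  show ?thesis by (simp add: isCont_def)
qed

definition matrix_analytic_at :: "(real^'d \<Rightarrow> complex^'n^'m) \<Rightarrow> real^'d \<Rightarrow> bool" where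
  "matrix_analytic_at M a \<longleftrightarrow> (\<forall>i j. real_analytic_at (\<lambda>\<nu>. Re (M \<nu> $ i $ j)) a \<and> real_analytic_at (\<lambda>\<nu>. Im (M \<nu> $ i $ j)) a)"

lemma matrix_analytic_at_sum:
  assumes "\<And>i. i < n \<Longrightarrow> real_analytic_at (\<psi> i) a"
  shows "matrix_analytic_at (\<lambda>\<nu>. \<Sum>i<n. \<psi> i \<nu> *\<^sub>R Mi i) a"
proof -
  have "real_analytic_at (\<lambda>\<nu>. \<Sum>i<n. \<psi> i \<nu> * c i) a" for c
    unfolding mult.commute[of _ "c _"] by (intro real_analytic_at_sum real_analytic_at_cmult assms) simp
  then show ?thesis
    unfolding matrix_analytic_at_def by (simp add: Re_sum Im_sum)
qed

lemma cpoly_ana_matrix_analytic: "matrix_analytic_at M a \<Longrightarrow> cpoly_ana a (\<lambda>\<nu> y. M \<nu> $ i $ j)"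
  unfolding matrix_analytic_at_def cpoly_ana_def by (auto intro: poly_ana.coef)

lemma isCont_tendsto_nhds: "isCont f x \<Longrightarrow> (f \<longlongrightarrow> f x) (nhds x)"
  unfolding isCont_def tendsto_at_iff_tendsto_nhds .

lemma tendsto_matrixI:
  "(\<And>i j. ((\<lambda>x. F x $ i $ j) \<longlongrightarrow> A $ i $ j) net) \<Longrightarrow> (F \<longlongrightarrow> A) net"
  by (intro vec_tendstoI)

lemma matrix_analytic_at_tendsto: "matrix_analytic_at M a \<Longrightarrow> (M \<longlongrightarrow> M a) (nhds a)"
proof (rule tendsto_matrixI)
  fix i j assume "matrix_analytic_at M a"
  then have "isCont (\<lambda>\<nu>. Re (M \<nu> $ i $ j)) a" "isCont (\<lambda>\<nu>. Im (M \<nu> $ i $ j)) a"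
    unfolding matrix_analytic_at_def by (auto intro: real_analytic_at_isCont)
  then have "isCont (\<lambda>\<nu>. Complex (Re (M \<nu> $ i $ j)) (Im (M \<nu> $ i $ j))) a"
    unfolding isCont_def by (rule tendsto_Complex)
  then have "isCont (\<lambda>\<nu>. M \<nu> $ i $ j) a" by simp
  then show "((\<lambda>\<nu>. M \<nu> $ i $ j) \<longlongrightarrow> M a $ i $ j) (nhds a)"
    by (rule isCont_tendsto_nhds)
qed

lemma matrix_analytic_at_path:
  fixes M :: "real^'d \<Rightarrow> complex^'n^'m"
  assumes "matrix_analytic_at M a"
  shows "\<exists>M'. ((\<lambda>t. M (a + t *\<^sub>R axis k 1)) has_vector_derivative M') (at 0)"
proof -
  have "\<exists>D E. ((\<lambda>t. Re (M (a + t *\<^sub>R axis k 1) $ i $ j)) has_real_derivative D) (at 0) \<and>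
     ((\<lambda>t. Im (M (a + t *\<^sub>R axis k 1) $ i $ j)) has_real_derivative E) (at 0)" for i j
    using assms real_analytic_at_imp_DERIV unfolding matrix_analytic_at_def by blast
  then obtain D E where DE: "\<And>i j. ((\<lambda>t. Re (M (a + t *\<^sub>R axis k 1) $ i $ j)) has_real_derivative D i j) (at 0)"
     "\<And>i j. ((\<lambda>t. Im (M (a + t *\<^sub>R axis k 1) $ i $ j)) has_real_derivative E i j) (at 0)" by metis
  have "((\<lambda>t. M (a + t *\<^sub>R axis k 1)) has_derivative (\<lambda>h. h *\<^sub>R (\<chi> i j. Complex (D i j) (E i j)))) (at 0)"
    unfolding has_derivative_componentwise_within[of "\<lambda>t. M (a + t *\<^sub>R axis k 1)"]
  proof
    fix b :: "complex^'n^'m" assume "b \<in> Basis"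
    then obtain i j c where b: "b = axis i (axis j c)" "c = 1 \<or> c = \<i>"
      by (auto simp: Basis_vec_def Basis_complex_def)
    show "((\<lambda>t. M (a + t *\<^sub>R axis k 1) \<bullet> b) has_derivative (\<lambda>h. (h *\<^sub>R (\<chi> i j. Complex (D i j) (E i j))) \<bullet> b)) (at 0)"
      using b(2) DE[of i j] by (auto simp: b(1) inner_axis has_field_derivative_def inner_complex_def mult_commute_abs)
  qed
  then show ?thesis unfolding has_vector_derivative_def by blast
qed

lemma quad_poly_nth: "quad_poly M C K z $ i $ j = z\<^sup>2 * M $ i $ j + z * C $ i $ j + K $ i $ j"
  by (simp add: quad_poly_def)

text \<open>The coordinates \<open>k\<close> and \<open>l\<close> are left free so that the result
  serves both \<open>X\<close> on \<open>real^3\<close> and \<open>H\<close> on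
  \<open>real^2\<close>.\<close>

lemma cpoly_ana_quad_poly:
  assumes "matrix_analytic_at M a" "matrix_analytic_at C a" "matrix_analytic_at K a"
  shows "cpoly_ana a (\<lambda>\<nu> y. quad_poly (M \<nu>) (C \<nu>) (K \<nu>) (Complex (y $ k) (y $ l)) $ i $ j)"
proof -
  have z: "cpoly_ana a (\<lambda>\<nu> y. Complex (y $ k) (y $ l))" by (simp add: cpoly_ana_def poly_ana.var)
  show ?thesis
    unfolding quad_poly_nth by (intro cpoly_ana_add cpoly_ana_mult cpoly_ana_power z cpoly_ana_matrix_analytic assms)
qed

lemma poly_ana_gram_det:
  assumes A: "\<And>i j. cpoly_ana a (\<lambda>\<nu> y. A \<nu> y $ i $ j)" and q: "poly_ana a q"
  shows "poly_ana a (\<lambda>\<nu> y. Re (gram_det (A \<nu> y) (q \<nu> y)))"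
proof -
  have m: "cpoly_ana a (\<lambda>\<nu> y. mat (complex_of_real (q \<nu> y)) $ i $ j)" for i j
    by (cases "i = j") (simp_all add: mat_def cpoly_ana_of_real q cpoly_ana_const)
  have "cpoly_ana a (\<lambda>\<nu> y. (\<Sum>l\<in>UNIV. cnj (A \<nu> y $ l $ i) * A \<nu> y $ l $ j) - mat (complex_of_real (q \<nu> y)) $ i $ j)" for i j
    by (intro cpoly_ana_diff cpoly_ana_sum cpoly_ana_mult cpoly_ana_cnj A m)
  then have "cpoly_ana a (\<lambda>\<nu> y. (cadjoint (A \<nu> y) ** A \<nu> y - mat (complex_of_real (q \<nu> y))) $ i $ j)" for i j
    by (simp add: matrix_matrix_mult_def cadjoint_def map_matrix_def transpose_def)
  then have "cpoly_ana a (\<lambda>\<nu> y. det (cadjoint (A \<nu> y) ** A \<nu> y - mat (complex_of_real (q \<nu> y))))"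
    by (rule cpoly_ana_det)
  then show ?thesis unfolding gram_det_def by (simp add: cpoly_ana_def)
qed

lemma cmod_cplx: "cmod (cplx s) = norm s"
  by (simp add: cplx_def cmod_def norm_vec_def L2_set_def sum_2)

lemma tendsto_quad_poly:
  assumes "(M \<longlongrightarrow> M0) F" "(C \<longlongrightarrow> C0) F" "(K \<longlongrightarrow> K0) F" "(z \<longlongrightarrow> z0) F"
  shows "((\<lambda>x. quad_poly (M x) (C x) (K x) (z x)) \<longlongrightarrow> quad_poly M0 C0 K0 z0) F"
  unfolding quad_poly_def
  by (intro tendsto_add bounded_bilinear.tendsto[OF bounded_bilinear_cscale] tendsto_power assms)

lemma tendsto_cplx: "(f \<longlongrightarrow> s) F \<Longrightarrow> ((\<lambda>x. cplx (f x)) \<longlongrightarrow> cplx s) F"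
  unfolding cplx_def by (intro tendsto_Complex tendsto_vec_nth)

lemma quad_poly_path_derivative:
  assumes "(M has_vector_derivative M') (at 0)" "(C has_vector_derivative C') (at 0)" "(K has_vector_derivative K') (at 0)"
    and z: "(z has_vector_derivative z') (at (0::real))"
  shows "((\<lambda>t. quad_poly (M t) (C t) (K t) (z t)) has_vector_derivative
     quad_poly M' C' K' (z 0) + cscale z' (quad_poly' (M 0) (C 0) (z 0))) (at 0)"
proof -
  interpret cs: bounded_bilinear "cscale :: complex \<Rightarrow> complex^'b^'b \<Rightarrow> complex^'b^'b"
    by (rule bounded_bilinear_cscale)
  have "((\<lambda>t. z t * z t) has_vector_derivative z 0 * z' + z' * z 0) (at 0)"
    by (rule bounded_bilinear.has_vector_derivative[OF bounded_bilinear_mult z z])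
  then have z2: "((\<lambda>t. (z t)\<^sup>2) has_vector_derivative 2 * z 0 * z') (at 0)"
    by (simp add: power2_eq_square mult.commute mult.left_commute)
  have "((\<lambda>t. quad_poly (M t) (C t) (K t) (z t)) has_vector_derivative
     (cscale ((z 0)\<^sup>2) M' + cscale (2 * z 0 * z') (M 0)) + (cscale (z 0) C' + cscale z' (C 0)) + K') (at 0)"
    unfolding quad_poly_def
    by (intro has_vector_derivative_add cs.has_vector_derivative assms z2)
  then show ?thesis
    by (simp add: quad_poly_def quad_poly'_def cs.add_right cscale_cscale algebra_simps)
qed

section \<open>The weight function in the coordinates of s\<close>

definition pw2 :: "real \<Rightarrow> real \<Rightarrow> real \<Rightarrow> real^2 \<Rightarrow> real" where
  "pw2 wm wc wk s = wm\<^sup>2 * ((s $ 1)\<^sup>2 + (s $ 2)\<^sup>2)\<^sup>2 + wc\<^sup>2 * ((s $ 1)\<^sup>2 + (s $ 2)\<^sup>2) + wk\<^sup>2"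

lemma norm_vec2_sq: "(norm (s::real^2))\<^sup>2 = (s $ 1)\<^sup>2 + (s $ 2)\<^sup>2"
  by (simp add: norm_vec_def L2_set_def sum_2)

lemma p_w_norm: "p_w (wm, wc, wk) (norm s) = sqrt (pw2 wm wc wk s)"
proof -
  have "norm s ^ 4 = ((norm s)\<^sup>2)\<^sup>2" by (simp flip: power_mult)
  then show ?thesis by (simp add: pw2_def norm_vec2_sq)
qed

lemma pw2_nonneg: "0 \<le> pw2 wm wc wk s"
  by (simp add: pw2_def)

text \<open>The partial derivatives of \<open>sqrt (pw2 wm wc wk s)\<close>. In this form they are
  also correct at \<open>s = 0\<close> when \<open>wk\<close> is nonzero, where a formula through
  the derivative of the norm breaks down.\<close>

definition pw_partial :: "real \<Rightarrow> real \<Rightarrow> real \<Rightarrow> 2 \<Rightarrow> real^2 \<Rightarrow> real" where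
  "pw_partial wm wc wk j s = (2 * wm\<^sup>2 * ((s $ 1)\<^sup>2 + (s $ 2)\<^sup>2) + wc\<^sup>2) * s $ j / sqrt (pw2 wm wc wk s)"

lemma p_w_has_derivative:
  assumes "0 < pw2 wm wc wk s"
  shows "((\<lambda>s. sqrt (pw2 wm wc wk s)) has_derivative
     (\<lambda>h. pw_partial wm wc wk 1 s * h $ 1 + pw_partial wm wc wk 2 s * h $ 2)) (at s)"
  unfolding pw2_def
  by (rule derivative_eq_intros has_derivative_vec_nth refl assms[unfolded pw2_def])+
    (use assms in \<open>simp add: fun_eq_iff pw_partial_def pw2_def field_simps power2_eq_square\<close>)

lemma pw_partial_has_derivative:
  assumes "0 < pw2 wm wc wk s"
  shows "\<exists>D. (pw_partial wm wc wk j has_derivative D) (at s)"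
proof -
  have "\<exists>D. ((\<lambda>s. (2 * wm\<^sup>2 * ((s $ 1)\<^sup>2 + (s $ 2)\<^sup>2) + wc\<^sup>2) * s $ j) has_derivative D) (at s)"
    by (rule exI) (rule derivative_intros has_derivative_vec_nth)+
  then obtain D where "((\<lambda>s. (2 * wm\<^sup>2 * ((s $ 1)\<^sup>2 + (s $ 2)\<^sup>2) + wc\<^sup>2) * s $ j) has_derivative D) (at s)" by blast
  from has_derivative_divide[OF this p_w_has_derivative[OF assms]] assms
  show ?thesis unfolding pw_partial_def[abs_def] by auto
qed

lemma pw_partial_1_eq:
  assumes "0 < pw2 wm wc wk s"
  shows "s $ 1 / norm s * deriv (p_w (wm, wc, wk)) (norm s) = pw_partial wm wc wk 1 s"
\<comment> \<open>At the origin the left side is 0 because division by 0 yields 0, and 0 is the true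
  partial derivative there; so the quotient in the final formula is right even for an optimizer at
  the origin.\<close>
proof (cases "s = 0")
  case False
  define \<rho> where "\<rho> = norm s"
  have \<rho>: "\<rho> > 0" using False by (simp add: \<rho>_def)
  have sq: "wm\<^sup>2 * \<rho> ^ 4 + wc\<^sup>2 * \<rho>\<^sup>2 + wk\<^sup>2 = pw2 wm wc wk s"
  proof -
    have "\<rho> ^ 4 = (\<rho>\<^sup>2)\<^sup>2" by (simp flip: power_mult)
    then show ?thesis by (simp add: pw2_def norm_vec2_sq \<rho>_def)
  qed
  have "(p_w (wm, wc, wk) has_real_derivative
      (wm\<^sup>2 * (4 * \<rho> ^ 3) + wc\<^sup>2 * (2 * \<rho>)) / (2 * sqrt (pw2 wm wc wk s))) (at \<rho>)"
  proof -
    have inner: "((\<lambda>z. wm\<^sup>2 * z ^ 4 + wc\<^sup>2 * z\<^sup>2 + wk\<^sup>2) has_real_derivative wm\<^sup>2 * (4 * \<rho> ^ 3) + wc\<^sup>2 * (2 * \<rho>)) (at \<rho>)"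
      by (auto intro!: derivative_eq_intros)
    have "0 < wm\<^sup>2 * \<rho> ^ 4 + wc\<^sup>2 * \<rho>\<^sup>2 + wk\<^sup>2" using assms sq by simp
    from DERIV_chain2[OF DERIV_real_sqrt[OF this] inner] show ?thesis
      unfolding sq p_w.simps[abs_def] by (simp add: field_simps)
  qed
  then have "deriv (p_w (wm, wc, wk)) \<rho> = (wm\<^sup>2 * (4 * \<rho> ^ 3) + wc\<^sup>2 * (2 * \<rho>)) / (2 * sqrt (pw2 wm wc wk s))"
    by (rule DERIV_imp_deriv)
  moreover have "wm\<^sup>2 * (4 * \<rho> ^ 3) + wc\<^sup>2 * (2 * \<rho>) = 2 * \<rho> * (2 * wm\<^sup>2 * \<rho>\<^sup>2 + wc\<^sup>2)"
    by (simp add: power2_eq_square power3_eq_cube algebra_simps)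
  moreover have "pw_partial wm wc wk 1 s = (2 * wm\<^sup>2 * \<rho>\<^sup>2 + wc\<^sup>2) * s $ 1 / sqrt (pw2 wm wc wk s)"
    by (simp add: pw_partial_def \<rho>_def norm_vec2_sq)
  ultimately show ?thesis using \<rho> by (simp add: \<rho>_def[symmetric])
qed (simp add: pw_partial_def)

lemma pseudospectral_abscissa_eq:
  assumes "constraint w \<epsilon> A t \<le> 0" "\<And>t'. constraint w \<epsilon> A t' \<le> 0 \<Longrightarrow> t' $ 1 \<le> t $ 1"
  shows "pseudospectral_abscissa w \<epsilon> A = t $ 1"
  unfolding pseudospectral_abscissa_def
proof (rule cSup_eq_maximum)
  have "cplx t \<in> pseudospectrum w \<epsilon> A"
    using assms(1) by (simp add: pseudospectrum_def constraint_def cmod_cplx)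
  then show "t $ 1 \<in> Re ` pseudospectrum w \<epsilon> A" by (force simp: cplx_def)
  fix x assume "x \<in> Re ` pseudospectrum w \<epsilon> A"
  then obtain z where z: "z \<in> pseudospectrum w \<epsilon> A" "x = Re z" by blast
  define t' :: "real^2" where "t' = vector [Re z, Im z]"
  have "cplx t' = z" by (simp add: t'_def cplx_def complex_eq_iff)
  then have "constraint w \<epsilon> A t' \<le> 0"
    using z(1) cmod_cplx[of t'] by (simp add: pseudospectrum_def constraint_def)
  from assms(2)[OF this] show "x \<le> t $ 1" by (simp add: z(2) t'_def)
qed

lemma negative_not_maximizer:
  fixes f :: "real^2 \<Rightarrow> real"
  assumes "continuous_on UNIV f" "f t < 0"
  shows "\<exists>t'. f t' \<le> 0 \<and> t $ 1 < t' $ 1"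
proof -
  have "isCont f t" using assms(1) by (simp add: continuous_on_eq_continuous_at)
  then obtain d where d: "d > 0" "\<And>x. dist x t < d \<Longrightarrow> dist (f x) (f t) < - f t"
    using assms(2) unfolding continuous_at_eps_delta by (metis neg_0_less_iff_less)
  have "dist (t + (d / 2) *\<^sub>R axis 1 1) t < d" using d(1) by (simp add: dist_norm)
  from d(2)[OF this] have "f (t + (d / 2) *\<^sub>R axis 1 1) \<le> 0" by (simp add: dist_real_def)
  then show ?thesis using d(1) by (intro exI[of _ "t + (d / 2) *\<^sub>R axis 1 1"]) (simp add: axis_def)
qed

declare p_w.simps [simp del]

section \<open>The problem at a non-degenerate point\<close>

definition poly_ana_grad :: "real^'d \<Rightarrow> (real^'d \<Rightarrow> real^'m \<Rightarrow> real) \<Rightarrow> 'm \<Rightarrow> real^'d \<Rightarrow> real^'m \<Rightarrow> real" where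
  "poly_ana_grad a \<Psi> = (SOME \<Psi>'. (\<forall>j. poly_ana a (\<Psi>' j)) \<and>
    (\<forall>x y. (\<Psi> x has_derivative (\<lambda>h. \<Sum>j\<in>UNIV. \<Psi>' j x y * h $ j)) (at y)))"

lemma poly_ana_grad:
  assumes "poly_ana a \<Psi>"
  shows "poly_ana a (poly_ana_grad a \<Psi> j)"
    and "(\<Psi> x has_derivative (\<lambda>h. \<Sum>j\<in>UNIV. poly_ana_grad a \<Psi> j x y * h $ j)) (at y)"
  using someI_ex[OF poly_ana_deriv[OF assms]] unfolding poly_ana_grad_def by blast+

text \<open>The parameter dependence enters only through analyticity at \<open>\<nu>0\<close> and a
  bound \<open>R\<close> on the feasible sets that is uniform near \<open>\<nu>0\<close>; this
  treats zero and positive leading weight alike.\<close>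

locale nondegenerate_point =
  fixes wm wc wk \<epsilon> :: real and M C K :: "real^'d \<Rightarrow> complex^'n^'n"
    and \<nu>0 :: "real^'d" and s0 :: "real^2" and R :: real
  assumes eps: "\<epsilon> > 0"
    and ana_le: "matrix_analytic_at M \<nu>0" "matrix_analytic_at C \<nu>0" "matrix_analytic_at K \<nu>0"
    and bdd: "\<forall>\<^sub>F \<nu> in nhds \<nu>0. \<forall>s. constraint (wm, wc, wk) \<epsilon> (quad_poly (M \<nu>) (C \<nu>) (K \<nu>)) s \<le> 0 \<longrightarrow> norm s \<le> R"
    and nondeg: "non_degenerate (wm, wc, wk) \<epsilon> (quad_poly (M \<nu>0) (C \<nu>0) (K \<nu>0))"
    and s0: "s0 = optimizer (wm, wc, wk) \<epsilon> (quad_poly (M \<nu>0) (C \<nu>0) (K \<nu>0))"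
    and pw: "p_w (wm, wc, wk) (norm s0) \<noteq> 0"
    and grad: "gradient (constraint (wm, wc, wk) \<epsilon> (quad_poly (M \<nu>0) (C \<nu>0) (K \<nu>0))) s0 \<noteq> 0"
begin

abbreviation "w \<equiv> (wm, wc, wk)"
abbreviation "P \<nu> \<equiv> quad_poly (M \<nu>) (C \<nu>) (K \<nu>)"
abbreviation "S \<nu> s \<equiv> sigma_min (P \<nu> (cplx s))"
abbreviation "q (s :: real^2) \<equiv> \<epsilon> * p_w w (norm s)"
abbreviation "g \<nu> \<equiv> constraint w \<epsilon> (P \<nu>)"

text \<open>The equation saying that \<open>y $ 3\<close> is a singular value at the point with
  coordinates \<open>y $ 1\<close>, \<open>y $ 2\<close>. The third coordinate is squared so that
  inserting \<open>q s\<close> gives the polynomial \<open>H\<close>; in return its derivative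
  carries the factor \<open>2 * y $ 3\<close>.\<close>

definition X :: "real^'d \<Rightarrow> real^3 \<Rightarrow> real" where
  "X \<nu> y = Re (gram_det (P \<nu> (Complex (y $ 1) (y $ 2))) ((y $ 3)\<^sup>2))"

definition H :: "real^'d \<Rightarrow> real^2 \<Rightarrow> real" where
  "H \<nu> s = Re (gram_det (P \<nu> (Complex (s $ 1) (s $ 2))) (\<epsilon>\<^sup>2 * pw2 wm wc wk s))"

abbreviation "X' \<equiv> poly_ana_grad \<nu>0 X"
abbreviation "X'' j \<equiv> poly_ana_grad \<nu>0 (X' j)"
abbreviation "H' \<equiv> poly_ana_grad \<nu>0 H"
abbreviation "H2' \<equiv> poly_ana_grad \<nu>0 (H' 2)"

abbreviation "q1 s \<equiv> \<epsilon> * pw_partial wm wc wk 1 s"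
abbreviation "q2 s \<equiv> \<epsilon> * pw_partial wm wc wk 2 s"

definition S1 :: "real^2 \<Rightarrow> real" where
  "S1 s = - X' 1 \<nu>0 (emb3 s (S \<nu>0 s)) / X' 3 \<nu>0 (emb3 s (S \<nu>0 s))"

definition S2 :: "real^2 \<Rightarrow> real" where
  "S2 s = - X' 2 \<nu>0 (emb3 s (S \<nu>0 s)) / X' 3 \<nu>0 (emb3 s (S \<nu>0 s))"

lemma poly_ana_X: "poly_ana \<nu>0 X"
  unfolding X_def[abs_def] by (intro poly_ana_gram_det cpoly_ana_quad_poly ana_le poly_ana_power poly_ana.var)

lemma poly_ana_H: "poly_ana \<nu>0 H"
  unfolding H_def[abs_def] pw2_def
  by (intro poly_ana_gram_det cpoly_ana_quad_poly ana_le poly_ana.mult poly_ana.add poly_ana_power poly_ana.var poly_ana_const)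

lemma g_eq: "g \<nu> s = S \<nu> s - q s"
  by (simp add: constraint_def)

lemma pw2_pos: "0 < pw2 wm wc wk s0"
  using pw pw2_nonneg[of wm wc wk s0] unfolding p_w_norm by (simp add: less_le)

lemma q_pos: "0 < q s0"
  using pw p_w_nonneg[of w "norm s0"] eps by (simp add: less_le)

lemma optimal: "g \<nu>0 s0 \<le> 0" "g \<nu>0 t \<le> 0 \<Longrightarrow> t $ 1 \<le> s0 $ 1"
  and optimal_unique: "g \<nu>0 t \<le> 0 \<Longrightarrow> t $ 1 = s0 $ 1 \<Longrightarrow> t = s0"
proof -
  have ex1: "\<exists>!s. is_optimizer w \<epsilon> (P \<nu>0) s" using nondeg by (simp add: non_degenerate_def)
  have opt: "is_optimizer w \<epsilon> (P \<nu>0) s0" unfolding s0 optimizer_def by (rule theI'[OF ex1])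
  then show "g \<nu>0 s0 \<le> 0" and o: "g \<nu>0 t \<le> 0 \<Longrightarrow> t $ 1 \<le> s0 $ 1" for t
    by (auto simp: is_optimizer_def)
  assume "g \<nu>0 t \<le> 0" "t $ 1 = s0 $ 1"
  then have "is_optimizer w \<epsilon> (P \<nu>0) t" using o by (auto simp: is_optimizer_def)
  then show "t = s0" using ex1 opt by blast
qed

lemma isCont_q: "isCont q s"
  unfolding p_w_norm pw2_def by (intro continuous_intros)

lemma isCont_S0: "isCont (\<lambda>p. S (fst p) (snd p)) (\<nu>0, s)"
proof -
  have c: "((\<lambda>p. N (fst p)) \<longlongrightarrow> N \<nu>0) (at (\<nu>0, s))" if "matrix_analytic_at N \<nu>0" for N :: "real^'d \<Rightarrow> complex^'n^'n"
    by (rule filterlim_compose[OF matrix_analytic_at_tendsto[OF that]])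
      (use tendsto_fst[OF tendsto_ident_at, of "(\<nu>0, s)"] in simp)
  have "((\<lambda>p. snd p) \<longlongrightarrow> s) (at (\<nu>0, s))"
    using tendsto_snd[OF tendsto_ident_at, of "(\<nu>0, s)"] by simp
  then show ?thesis
    unfolding isCont_def
    by (simp, intro tendsto_sigma_min tendsto_quad_poly c ana_le tendsto_cplx)
qed

lemma isCont_g0: "isCont (\<lambda>p. g (fst p) (snd p)) (\<nu>0, s)"
proof -
  have "((\<lambda>p. snd p) \<longlongrightarrow> s) (at (\<nu>0, s))"
    using tendsto_snd[OF tendsto_ident_at, of "(\<nu>0, s)"] by simp
  from isCont_tendsto_compose[OF isCont_q this] have "isCont (\<lambda>p. q (snd p)) (\<nu>0, s)"
    by (simp add: isCont_def)
  then show ?thesis unfolding g_eq by (intro continuous_diff isCont_S0)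
qed

lemma continuous_S: "continuous_on UNIV (S \<nu>)"
  unfolding continuous_on_def
  by (intro ballI tendsto_sigma_min tendsto_quad_poly tendsto_const tendsto_cplx tendsto_ident_at)

lemma continuous_g: "continuous_on UNIV (g \<nu>)"
  unfolding g_eq using isCont_q
  by (intro continuous_on_diff continuous_S) (simp add: continuous_on_eq_continuous_at)

lemma maximizer_zero:
  assumes "g \<nu> t \<le> 0" "\<And>t'. g \<nu> t' \<le> 0 \<Longrightarrow> t' $ 1 \<le> t $ 1"
  shows "g \<nu> t = 0"
  using negative_not_maximizer[OF continuous_g, of \<nu> t] assms by force

lemma g0: "g \<nu>0 s0 = 0"
  using maximizer_zero optimal by blast

lemma S_eq_q: "S \<nu>0 s0 = q s0"
  using g0 by (simp add: g_eq)

lemma X_zero: "X \<nu> (emb3 s (S \<nu> s)) = 0"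
  by (simp add: X_def gram_det_sigma_min flip: cplx_def)

lemma X_emb_q: "X \<nu> (emb3 s (q s)) = H \<nu> s"
proof -
  have "(q s)\<^sup>2 = \<epsilon>\<^sup>2 * pw2 wm wc wk s"
    unfolding p_w_norm by (simp add: power_mult_distrib pw2_nonneg)
  then show ?thesis by (simp add: X_def H_def)
qed

text \<open>By the chain rule this is the derivative of \<open>gram_det\<close> at the root times
  \<open>2 * q s0\<close>. Simplicity of the singular value makes the first factor nonzero, the
  assumption on \<open>p_w\<close> the second.\<close>

lemma X'3_nz: "X' 3 \<nu>0 (emb3 s0 (q s0)) \<noteq> 0"
proof -
  have "simple_singular_value (P \<nu>0 (cplx s0)) (S \<nu>0 s0)"
    using nondeg by (simp add: non_degenerate_def s0)
  then obtain D where D: "D \<noteq> 0"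
    "((\<lambda>t. Re (gram_det (P \<nu>0 (cplx s0)) t)) has_real_derivative D) (at ((q s0)\<^sup>2))"
    using gram_det_simple_derivative S_eq_q by metis
  have sq: "((\<lambda>\<tau>. \<tau>\<^sup>2) has_real_derivative 2 * q s0) (at (q s0))"
    by (auto intro!: derivative_eq_intros)
  have "((\<lambda>\<tau>. X \<nu>0 (emb3 s0 \<tau>)) has_real_derivative D * (2 * q s0)) (at (q s0))"
    unfolding X_def emb3_nth cplx_def[symmetric] by (rule DERIV_chain2[OF D(2) sq])
  moreover have "((\<lambda>\<tau>. X \<nu>0 (emb3 s0 \<tau>)) has_real_derivative X' 3 \<nu>0 (emb3 s0 (q s0))) (at (q s0))"
    using DERIV_emb3[of "X \<nu>0" "\<lambda>j. X' j \<nu>0", OF poly_ana_grad(2)[OF poly_ana_X]] .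
  ultimately have "X' 3 \<nu>0 (emb3 s0 (q s0)) = D * (2 * q s0)" by (rule DERIV_unique[THEN sym])
  then show ?thesis using D(1) q_pos by auto
qed

lemma S_deriv: "\<forall>\<^sub>F s in nhds s0. (S \<nu>0 has_derivative (\<lambda>h. S1 s * h $ 1 + S2 s * h $ 2)) (at s)"
proof -
  have c: "isCont (X' 3 \<nu>0) (emb3 s0 (S \<nu>0 s0))"
    using has_derivative_continuous[OF poly_ana_grad(2)[OF poly_ana_grad(1)[OF poly_ana_X]]] .
  show ?thesis
    unfolding S1_def S2_def
    by (rule implicit_emb3_derivative[of "X \<nu>0" "\<lambda>j. X' j \<nu>0"])
      (use poly_ana_grad(2)[OF poly_ana_X] c X'3_nz S_eq_q continuous_S X_zero in auto)
qed

lemma q_deriv: "\<forall>\<^sub>F s in nhds s0. (q has_derivative (\<lambda>h. q1 s * h $ 1 + q2 s * h $ 2)) (at s)"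
proof -
  have "isCont (pw2 wm wc wk) s0" unfolding pw2_def[abs_def] by (intro continuous_intros)
  then have "\<forall>\<^sub>F s in nhds s0. 0 < pw2 wm wc wk s" using pw2_pos by (rule isCont_eventually_pos)
  then show ?thesis
  proof eventually_elim
    case (elim s)
    show ?case
      unfolding p_w_norm
      by (rule has_derivative_eq_rhs[OF has_derivative_mult_right[OF p_w_has_derivative[OF elim]]])
        (simp add: fun_eq_iff algebra_simps)
  qed
qed

lemma g_deriv: "\<forall>\<^sub>F s in nhds s0. (g \<nu>0 has_derivative (\<lambda>h. (S1 s - q1 s) * h $ 1 + (S2 s - q2 s) * h $ 2)) (at s)"
  using S_deriv q_deriv
proof eventually_elim
  case (elim s)
  show ?case unfolding g_eq
    by (rule has_derivative_eq_rhs[OF has_derivative_diff[OF elim]]) (simp add: fun_eq_iff algebra_simps)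
qed

lemma S12_differentiable: "\<exists>D. (S1 has_derivative D) (at s0)" "\<exists>D. (S2 has_derivative D) (at s0)"
proof -
  have ch: "\<exists>D. ((\<lambda>s. X' j \<nu>0 (emb3 s (S \<nu>0 s))) has_derivative D) (at s0)" for j
    using chain_emb3[of "X' j \<nu>0" "\<lambda>k. X'' j k \<nu>0", OF poly_ana_grad(2)[OF poly_ana_grad(1)[OF poly_ana_X]]
        eventually_nhds_x_imp_x[OF S_deriv]] by blast
  have nz: "X' 3 \<nu>0 (emb3 s0 (S \<nu>0 s0)) \<noteq> 0" using X'3_nz S_eq_q by simp
  obtain D3 where D3: "((\<lambda>s. X' 3 \<nu>0 (emb3 s (S \<nu>0 s))) has_derivative D3) (at s0)" using ch by blast
  have "\<exists>D. ((\<lambda>s. - X' j \<nu>0 (emb3 s (S \<nu>0 s)) / X' 3 \<nu>0 (emb3 s (S \<nu>0 s))) has_derivative D) (at s0)" for j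
  proof -
    obtain D where "((\<lambda>s. X' j \<nu>0 (emb3 s (S \<nu>0 s))) has_derivative D) (at s0)" using ch by blast
    from has_derivative_divide[OF has_derivative_minus[OF this] D3 nz] show ?thesis by blast
  qed
  then show "\<exists>D. (S1 has_derivative D) (at s0)" "\<exists>D. (S2 has_derivative D) (at s0)"
    unfolding S1_def[abs_def] S2_def[abs_def] by blast+
qed

lemma q12_differentiable: "\<exists>D. (q1 has_derivative D) (at s0)" "\<exists>D. (q2 has_derivative D) (at s0)"
  using pw_partial_has_derivative[OF pw2_pos] has_derivative_mult_right by blast+

lemma grad_nz: "S1 s0 - q1 s0 \<noteq> 0 \<or> S2 s0 - q2 s0 \<noteq> 0"
proof (rule ccontr)
  assume "\<not> ?thesis"
  then have "GDERIV (g \<nu>0) s0 :> vector [0, 0]"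
    unfolding gderiv_vec2 using eventually_nhds_x_imp_x[OF g_deriv] by simp
  then have "gradient (g \<nu>0) s0 = vector [0, 0]" by (rule gradient_eq)
  then show False using grad by (simp add: vec_eq_iff forall_2)
qed

text \<open>Otherwise \<open>s0\<close>, where the constraint vanishes, would be a local minimum of
  it, against the nonzero gradient.\<close>

lemma strictly_feasible:
  assumes "e > 0"
  shows "\<exists>s\<in>ball s0 e. g \<nu>0 s < 0"
proof (rule ccontr)
  assume "\<not> ?thesis"
  then have "\<forall>s\<in>ball s0 e. g \<nu>0 s0 \<le> g \<nu>0 s" using g0 by (auto simp: not_less)
  then have "\<forall>\<^sub>F s in at s0. g \<nu>0 s0 \<le> g \<nu>0 s"
    using assms by (auto simp: eventually_at dist_commute intro!: exI[of _ e])
  from has_derivative_local_min[OF eventually_nhds_x_imp_x[OF g_deriv] this]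
  have z: "(S1 s0 - q1 s0) * h $ 1 + (S2 s0 - q2 s0) * h $ 2 = 0" for h :: "real^2" by meson
  show False using z[of "axis 1 1"] z[of "axis 2 1"] grad_nz by (simp add: axis_def)
qed

text \<open>The constraint is active at a maximizer, which gives \<open>H = 0\<close>. If
  \<open>\<kappa> * H\<close> were positive at a nearby point straight above or below
  \<open>t\<close>, that point would be strictly feasible and could be moved to the right, past
  \<open>t\<close>. So \<open>\<kappa> * H\<close> has a local maximum at \<open>t\<close> on the
  vertical line.\<close>

lemma critical_point:
  "\<exists>\<delta>>0. \<forall>\<nu>\<in>ball \<nu>0 \<delta>. \<forall>t\<in>ball s0 \<delta>. g \<nu> t \<le> 0 \<longrightarrow> (\<forall>t'. g \<nu> t' \<le> 0 \<longrightarrow> t' $ 1 \<le> t $ 1) \<longrightarrow>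
     H \<nu> t = 0 \<and> H' 2 \<nu> t = 0"
proof -
  obtain \<kappa> \<delta> where \<kappa>: "\<kappa> \<noteq> 0" and \<delta>: "\<delta> > 0"
    and sign: "\<And>\<nu> s. \<nu> \<in> ball \<nu>0 \<delta> \<Longrightarrow> s \<in> ball s0 \<delta> \<Longrightarrow> \<kappa> * H \<nu> s > 0 \<Longrightarrow> S \<nu> s < q s"
    using reduced_equation_sign[where X = X and X' = X' and q = q and S = S and ?\<nu>0.0 = \<nu>0 and ?s0.0 = s0,
        OF poly_ana_grad(2)[OF poly_ana_X] poly_ana_isCont[OF poly_ana_grad(1)[OF poly_ana_X]] X'3_nz isCont_S0 isCont_q S_eq_q X_zero]
    unfolding X_emb_q by blast
  have "H \<nu> t = 0 \<and> H' 2 \<nu> t = 0" if \<nu>: "\<nu> \<in> ball \<nu>0 \<delta>" and t: "t \<in> ball s0 \<delta>"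
    and f: "g \<nu> t \<le> 0" and max: "\<And>t'. g \<nu> t' \<le> 0 \<Longrightarrow> t' $ 1 \<le> t $ 1" for \<nu> t
  proof
    have "S \<nu> t = q t" using maximizer_zero[OF f max] by (simp add: g_eq)
    then show H0: "H \<nu> t = 0" using X_zero[of \<nu> t] X_emb_q[of \<nu> t] by simp
    have l: "((\<lambda>r. t + r *\<^sub>R axis 2 1) has_derivative (\<lambda>h. h *\<^sub>R axis 2 1)) (at 0)"
      by (auto intro!: derivative_eq_intros)
    have "((\<lambda>r. H \<nu> (t + r *\<^sub>R axis 2 1)) has_real_derivative H' 2 \<nu> t) (at 0)"
      unfolding has_field_derivative_def
      by (rule has_derivative_eq_rhs[OF has_derivative_compose[OF l poly_ana_grad(2)[OF poly_ana_H]]])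
        (simp add: sum_2 axis_def fun_eq_iff)
    then have "((\<lambda>r. \<kappa> * H \<nu> (t + r *\<^sub>R axis 2 1)) has_real_derivative \<kappa> * H' 2 \<nu> t) (at 0)"
      by (rule DERIV_cmult)
    moreover have "0 < \<delta> - dist t s0" using t by (simp add: dist_commute)
    moreover have "\<forall>r. \<bar>0 - r\<bar> < \<delta> - dist t s0 \<longrightarrow> \<kappa> * H \<nu> (t + r *\<^sub>R axis 2 1) \<le> \<kappa> * H \<nu> (t + 0 *\<^sub>R axis 2 1)"
    proof (intro allI impI, rule ccontr)
      fix r assume r: "\<bar>0 - r\<bar> < \<delta> - dist t s0"
        and "\<not> \<kappa> * H \<nu> (t + r *\<^sub>R axis 2 1) \<le> \<kappa> * H \<nu> (t + 0 *\<^sub>R axis 2 1)"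
      then have pos: "\<kappa> * H \<nu> (t + r *\<^sub>R axis 2 1) > 0" using H0 by simp
      have "dist s0 (t + r *\<^sub>R axis 2 1) \<le> dist s0 t + dist t (t + r *\<^sub>R axis 2 1)" by (rule dist_triangle)
      then have "t + r *\<^sub>R axis 2 1 \<in> ball s0 \<delta>" using r by (simp add: dist_commute dist_norm)
      from sign[OF \<nu> this pos] have "g \<nu> (t + r *\<^sub>R axis 2 1) < 0" by (simp add: g_eq)
      from negative_not_maximizer[OF continuous_g this] obtain t' where
        "g \<nu> t' \<le> 0" "(t + r *\<^sub>R axis 2 1) $ 1 < t' $ 1" by blast
      then show False using max[of t'] by (simp add: axis_def)
    qed
    ultimately have "\<kappa> * H' 2 \<nu> t = 0" by (rule DERIV_local_max)
    then show "H' 2 \<nu> t = 0" using \<kappa> by simp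
  qed
  then show ?thesis using \<delta> by blast
qed

lemma H0: "H \<nu>0 s0 = 0" "H' 2 \<nu>0 s0 = 0"
  using critical_point optimal by auto

lemma reduced:
  assumes "(S2 has_derivative DS) (at s0)" "(q2 has_derivative Dq) (at s0)"
  shows "H' 1 \<nu>0 s0 = X' 3 \<nu>0 (emb3 s0 (S \<nu>0 s0)) * (q1 s0 - S1 s0)"
    and "H' 2 \<nu>0 s0 = X' 3 \<nu>0 (emb3 s0 (S \<nu>0 s0)) * (q2 s0 - S2 s0)"
    and "q2 s0 = S2 s0 \<Longrightarrow> H2' 2 \<nu>0 s0 = X' 3 \<nu>0 (emb3 s0 (S \<nu>0 s0)) * (Dq (axis 2 1) - DS (axis 2 1))"
  using reduced_equation_derivatives[where X = "X \<nu>0" and X' = "\<lambda>j. X' j \<nu>0" and X'' = "\<lambda>j k. X'' j k \<nu>0"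
      and S = "S \<nu>0" and q = q and H = "H \<nu>0" and H' = "\<lambda>j. H' j \<nu>0" and H2' = "\<lambda>j. H2' j \<nu>0 s0"
      and ?s0.0 = s0 and ?S1.0 = S1 and ?S2.0 = S2 and ?q1.0 = q1 and ?q2.0 = q2,
      OF poly_ana_grad(2)[OF poly_ana_X] poly_ana_grad(2)[OF poly_ana_grad(1)[OF poly_ana_X]] S_deriv q_deriv assms X_zero S_eq_q[symmetric]
        X_emb_q[symmetric] poly_ana_grad(2)[OF poly_ana_H] poly_ana_grad(2)[OF poly_ana_grad(1)[OF poly_ana_H]]]
  by blast+

lemma g2_zero: "S2 s0 = q2 s0"
  using reduced(2) S12_differentiable(2) q12_differentiable(2) H0(2) X'3_nz S_eq_q by auto

lemma g1_nz: "S1 s0 - q1 s0 \<noteq> 0"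
  using grad_nz g2_zero by simp

lemma H'1_nz: "H' 1 \<nu>0 s0 \<noteq> 0"
  using reduced(1) S12_differentiable(2) q12_differentiable(2) X'3_nz S_eq_q g1_nz by auto

lemma H2'2_nz: "H2' 2 \<nu>0 s0 \<noteq> 0"
proof -
  obtain DS1 DS2 Dq1 Dq2 where D: "(S1 has_derivative DS1) (at s0)" "(S2 has_derivative DS2) (at s0)"
    "(q1 has_derivative Dq1) (at s0)" "(q2 has_derivative Dq2) (at s0)"
    using S12_differentiable q12_differentiable by blast
  have "invertible (hessian (lagrangian w \<epsilon> (P \<nu>0)) (vector [s0 $ 1, s0 $ 2, multiplier w \<epsilon> (P \<nu>0)]))"
    using nondeg unfolding non_degenerate_def kkt_point_def s0 by blast
  from hessian_lagrangian_invertible[OF g_deriv has_derivative_diff[OF D(1,3)] has_derivative_diff[OF D(2,4)] g1_nz _ this]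
  have "DS2 (axis 2 1) - Dq2 (axis 2 1) \<noteq> 0" using g2_zero by simp
  then show ?thesis using reduced(3)[OF D(2,4)] g2_zero X'3_nz S_eq_q by auto
qed

text \<open>Besides the value of the abscissa, the conclusion records that the constraint stays
  active along \<open>Y\<close>; differentiating this identity leads to the derivative
  formula.\<close>

lemma analytic_optimizer:
  "\<exists>Y. (\<forall>i. real_analytic_at (\<lambda>\<nu>. Y \<nu> $ i) \<nu>0) \<and> Y \<nu>0 = s0 \<and>
    (\<forall>\<^sub>F \<nu> in nhds \<nu>0. g \<nu> (Y \<nu>) = 0 \<and> pseudospectral_abscissa w \<epsilon> (P \<nu>) = Y \<nu> $ 1)"
proof -
  define F where "F i = (if i = (1::2) then H else H' 2)" for i
  define J :: "real^2^2" where "J = (\<chi> i j. if i = 1 then H' j \<nu>0 s0 else H2' j \<nu>0 s0)"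
  have "det J \<noteq> 0" using H0 H'1_nz H2'2_nz by (simp add: det_2 J_def)
  then have inv: "invertible J" by (simp add: invertible_det_nz)
  have PAF: "poly_ana \<nu>0 (F i)" for i using poly_ana_H poly_ana_grad(1)[OF poly_ana_H] by (simp add: F_def)
  have F0: "F i \<nu>0 s0 = 0" for i by (simp add: F_def H0)
  have dF: "(F i \<nu>0 has_derivative (\<lambda>h. (J *v h) $ i)) (at s0)" for i
  proof (cases "i = 1")
    case True
    then show ?thesis using poly_ana_grad(2)[OF poly_ana_H, of \<nu>0 s0] by (simp add: F_def J_def matrix_vector_mult_def)
  next
    case False
    then show ?thesis using poly_ana_grad(2)[OF poly_ana_grad(1)[OF poly_ana_H], of 2 \<nu>0 s0]
      by (simp add: F_def J_def matrix_vector_mult_def)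
  qed
  obtain Y \<delta> where \<delta>: "\<delta> > 0" and Y: "\<forall>i. real_analytic_at (\<lambda>\<nu>. Y \<nu> $ i) \<nu>0" "Y \<nu>0 = s0"
    and uniq: "\<forall>\<nu>\<in>ball \<nu>0 \<delta>. (\<forall>i. F i \<nu> (Y \<nu>) = 0) \<and> (\<forall>y\<in>ball s0 \<delta>. (\<forall>i. F i \<nu> y = 0) \<longrightarrow> y = Y \<nu>)"
    using analytic_implicit_function[of \<nu>0 F s0 J, OF PAF F0 dF inv] by blast
  obtain \<delta>' where \<delta>': "\<delta>' > 0" and crit: "\<And>\<nu> t. \<nu> \<in> ball \<nu>0 \<delta>' \<Longrightarrow> t \<in> ball s0 \<delta>' \<Longrightarrow> g \<nu> t \<le> 0 \<Longrightarrow>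
      (\<forall>t'. g \<nu> t' \<le> 0 \<longrightarrow> t' $ 1 \<le> t $ 1) \<Longrightarrow> H \<nu> t = 0 \<and> H' 2 \<nu> t = 0"
    using critical_point by blast
  define e where "e = min \<delta> \<delta>'"
  have e: "e > 0" using \<delta> \<delta>' by (simp add: e_def)
  have "\<forall>\<^sub>F \<nu> in nhds \<nu>0. \<exists>t\<in>ball s0 e. g \<nu> t \<le> 0 \<and> (\<forall>t'. g \<nu> t' \<le> 0 \<longrightarrow> t' $ 1 \<le> t $ 1)"
    by (rule maximizers_converge[where R = R, OF isCont_g0 continuous_g bdd optimal(2) optimal_unique strictly_feasible e])
  moreover have "\<forall>\<^sub>F \<nu> in nhds \<nu>0. \<nu> \<in> ball \<nu>0 e"
    by (rule eventually_nhds_in_open) (use e in auto)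
  ultimately have "\<forall>\<^sub>F \<nu> in nhds \<nu>0. g \<nu> (Y \<nu>) = 0 \<and> pseudospectral_abscissa w \<epsilon> (P \<nu>) = Y \<nu> $ 1"
  proof eventually_elim
    case (elim \<nu>)
    then obtain t where t: "t \<in> ball s0 e" "g \<nu> t \<le> 0" and max: "\<forall>t'. g \<nu> t' \<le> 0 \<longrightarrow> t' $ 1 \<le> t $ 1" by blast
    have "H \<nu> t = 0 \<and> H' 2 \<nu> t = 0" using crit[of \<nu> t] elim(2) t max by (simp add: e_def)
    then have "\<forall>i. F i \<nu> t = 0" by (simp add: F_def)
    then have "t = Y \<nu>" using uniq elim(2) t(1) by (simp add: e_def)
    moreover have "g \<nu> t = 0" using maximizer_zero t(2) max by blast
    moreover have "pseudospectral_abscissa w \<epsilon> (P \<nu>) = t $ 1"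
      by (rule pseudospectral_abscissa_eq) (use t(2) max in auto)
    ultimately show ?case by simp
  qed
  then show ?thesis using Y by blast
qed

lemma multiplier: "multiplier w \<epsilon> (P \<nu>0) = 1 / (S1 s0 - q1 s0)"
  by (rule multiplier_eq[of _ _ _ s0])
    (use s0 eventually_nhds_x_imp_x[OF g_deriv] g2_zero g1_nz g0 in auto)

end

section \<open>Derivatives along paths and the explicit formulas\<close>

lemma sesq_add: "sesq u (A + B) v = sesq u A v + sesq u B v"
  by (simp add: sesq_def matrix_vector_mult_add_rdistrib distrib_left sum.distrib)

lemma sesq_cscale: "sesq u (cscale c A) v = c * sesq u A v"
  by (simp add: sesq_def cscale_vector sum_distrib_left mult.left_commute)

lemma has_vector_derivative_vec2:
  fixes y :: "real \<Rightarrow> real^2"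
  assumes "((\<lambda>t. y t $ 1) has_real_derivative D1) (at x)" "((\<lambda>t. y t $ 2) has_real_derivative D2) (at x)"
  shows "(y has_vector_derivative vector [D1, D2]) (at x)"
  unfolding has_vector_derivative_def has_derivative_componentwise_within[of y]
proof
  fix i :: "real^2" assume "i \<in> Basis"
  then obtain j where j: "i = axis j 1" by (auto simp: Basis_vec_def)
  show "((\<lambda>t. y t \<bullet> i) has_derivative (\<lambda>h. (h *\<^sub>R vector [D1, D2]) \<bullet> i)) (at x)"
    using exhaust_2[of j] assms by (auto simp: j inner_axis has_field_derivative_def mult_commute_abs)
qed

lemma has_vector_derivative_cplx:
  assumes "(y has_vector_derivative vector [D1, D2]) (at x)"
  shows "((\<lambda>t. cplx (y t)) has_vector_derivative Complex D1 D2) (at x)"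
proof -
  have "bounded_linear cplx"
    unfolding linear_conv_bounded_linear[symmetric] by (rule linearI) (simp_all add: cplx_def complex_eq_iff)
  from bounded_linear.has_vector_derivative[OF this assms] show ?thesis by (simp add: cplx_def)
qed

text \<open>The derivative of the matrix along the path is the parameter part plus
  \<open>Complex D1 D2\<close> times \<open>quad_poly'\<close>; the real part of that product
  accounts for the last two terms and for the minus sign.\<close>

lemma sigma_min_quad_poly_path:
  fixes M C K :: "real \<Rightarrow> complex^'n^'n"
  assumes d: "((\<lambda>t. sigma_min (quad_poly (M t) (C t) (K t) (cplx (y t)))) has_real_derivative d) (at 0)"
    and uv: "consistent_singular_vectors (quad_poly (M 0) (C 0) (K 0) (cplx (y 0)))
        (sigma_min (quad_poly (M 0) (C 0) (K 0) (cplx (y 0)))) u v"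
    and pos: "0 < sigma_min (quad_poly (M 0) (C 0) (K 0) (cplx (y 0)))"
    and MCK: "(M has_vector_derivative M') (at 0)" "(C has_vector_derivative C') (at 0)" "(K has_vector_derivative K') (at 0)"
    and y: "(y has_vector_derivative vector [D1, D2]) (at 0)"
  shows "d = Re (sesq u (quad_poly M' C' K' (cplx (y 0))) v)
      + D1 * Re (sesq u (quad_poly' (M 0) (C 0) (cplx (y 0))) v)
      - D2 * Im (sesq u (quad_poly' (M 0) (C 0) (cplx (y 0))) v)"
  using sigma_min_path_derivative[OF uv pos quad_poly_path_derivative[OF MCK has_vector_derivative_cplx[OF y]] d]
  by (simp add: sesq_add sesq_cscale)

context nondegenerate_point
begin

text \<open>The coefficient matrices are frozen and \<open>s\<close> moves along a straight line;
  the two axis directions give the two identities.\<close>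

lemma S_partials:
  assumes uv: "consistent_singular_vectors (P \<nu>0 (cplx s0)) (S \<nu>0 s0) u v"
  shows "S1 s0 = Re (sesq u (quad_poly' (M \<nu>0) (C \<nu>0) (cplx s0)) v)"
    and "S2 s0 = - Im (sesq u (quad_poly' (M \<nu>0) (C \<nu>0) (cplx s0)) v)"
proof -
  have pos: "0 < S \<nu>0 s0" using q_pos S_eq_q by simp
  have main: "S1 s0 * D1 + S2 s0 * D2 = D1 * Re (sesq u (quad_poly' (M \<nu>0) (C \<nu>0) (cplx s0)) v)
      - D2 * Im (sesq u (quad_poly' (M \<nu>0) (C \<nu>0) (cplx s0)) v)" for D1 D2
  proof -
    let ?y = "\<lambda>t. s0 + t *\<^sub>R (vector [D1, D2] :: real^2)"
    have y: "(?y has_vector_derivative vector [D1, D2]) (at 0)"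
      by (auto intro!: derivative_eq_intros)
    then have "(?y has_derivative (\<lambda>h. h *\<^sub>R vector [D1, D2])) (at 0)" by (simp add: has_vector_derivative_def)
    moreover have "(S \<nu>0 has_derivative (\<lambda>h. S1 s0 * h $ 1 + S2 s0 * h $ 2)) (at (?y 0))"
      using eventually_nhds_x_imp_x[OF S_deriv] by simp
    ultimately have "((\<lambda>t. S \<nu>0 (?y t)) has_derivative
        (\<lambda>h. S1 s0 * (h *\<^sub>R vector [D1, D2] :: real^2) $ 1 + S2 s0 * (h *\<^sub>R vector [D1, D2] :: real^2) $ 2)) (at 0)"
      by (rule has_derivative_compose)
    then have d: "((\<lambda>t. S \<nu>0 (?y t)) has_real_derivative S1 s0 * D1 + S2 s0 * D2) (at 0)"
      unfolding has_field_derivative_def by (rule has_derivative_eq_rhs) (simp add: fun_eq_iff algebra_simps)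
    have y0: "?y 0 = s0" by simp
    have z: "sesq u (quad_poly 0 0 0 (cplx s0)) v = 0"
      by (simp add: sesq_def quad_poly_def matrix_vector_mult_def)
    have "S1 s0 * D1 + S2 s0 * D2 = Re (sesq u (quad_poly 0 0 0 (cplx (?y 0))) v)
      + D1 * Re (sesq u (quad_poly' (M \<nu>0) (C \<nu>0) (cplx (?y 0))) v)
      - D2 * Im (sesq u (quad_poly' (M \<nu>0) (C \<nu>0) (cplx (?y 0))) v)"
      by (rule sigma_min_quad_poly_path[where M = "\<lambda>_. M \<nu>0" and C = "\<lambda>_. C \<nu>0" and K = "\<lambda>_. K \<nu>0" and y = ?y, OF d])
        (use uv pos y in \<open>simp_all only: y0 has_vector_derivative_const\<close>)
    then show ?thesis using z by simp
  qed
  show "S1 s0 = Re (sesq u (quad_poly' (M \<nu>0) (C \<nu>0) (cplx s0)) v)" using main[of 1 0] by simp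
  show "S2 s0 = - Im (sesq u (quad_poly' (M \<nu>0) (C \<nu>0) (cplx s0)) v)" using main[of 0 1] by simp
qed

lemma abscissa_analytic: "real_analytic_at (\<lambda>\<nu>. pseudospectral_abscissa w \<epsilon> (P \<nu>)) \<nu>0"
proof -
  obtain Y where Y: "\<forall>i. real_analytic_at (\<lambda>\<nu>. Y \<nu> $ i) \<nu>0"
    and ev: "\<forall>\<^sub>F \<nu> in nhds \<nu>0. g \<nu> (Y \<nu>) = 0 \<and> pseudospectral_abscissa w \<epsilon> (P \<nu>) = Y \<nu> $ 1"
    using analytic_optimizer by blast
  show ?thesis
    by (rule real_analytic_at_eventually_eq[OF Y[rule_format, of 1]]) (use ev in \<open>auto elim: eventually_mono\<close>)
qed

lemma multiplier_formula:
  assumes "consistent_singular_vectors (P \<nu>0 (cplx s0)) (S \<nu>0 s0) u v"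
  shows "multiplier w \<epsilon> (P \<nu>0) = 1 / (Re (sesq u (quad_poly' (M \<nu>0) (C \<nu>0) (cplx s0)) v)
              - \<epsilon> * (s0 $ 1 / norm s0) * deriv (p_w w) (norm s0))"
proof -
  have "q1 s0 = \<epsilon> * (s0 $ 1 / norm s0) * deriv (p_w w) (norm s0)"
    unfolding pw_partial_1_eq[OF pw2_pos, symmetric] by (rule mult.assoc[symmetric])
  then show ?thesis unfolding multiplier S_partials(1)[OF assms] by simp
qed

text \<open>Along the curve \<open>Y\<close> of optimizers \<open>sigma_min\<close> equals
  \<open>q\<close>, so their derivatives agree. Because \<open>S2 s0 = q2 s0\<close>, the unknown
  velocity \<open>D2\<close> drops out, and the equation can be solved for \<open>D1\<close>, the
  derivative of the abscissa.\<close>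

lemma abscissa_partial_derivative:
  assumes uv: "consistent_singular_vectors (P \<nu>0 (cplx s0)) (S \<nu>0 s0) u v"
  shows "((\<lambda>t. pseudospectral_abscissa w \<epsilon> (P (\<nu>0 + t *\<^sub>R axis j 1))) has_real_derivative
      - multiplier w \<epsilon> (P \<nu>0) * Re (sesq u (partial_derivative j (\<lambda>\<nu>. P \<nu> (cplx s0)) \<nu>0) v)) (at 0)"
proof -
  obtain Y where Y: "\<forall>i. real_analytic_at (\<lambda>\<nu>. Y \<nu> $ i) \<nu>0" "Y \<nu>0 = s0"
    and ev: "\<forall>\<^sub>F \<nu> in nhds \<nu>0. g \<nu> (Y \<nu>) = 0 \<and> pseudospectral_abscissa w \<epsilon> (P \<nu>) = Y \<nu> $ 1"
    using analytic_optimizer by blast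
  define l where "l t = \<nu>0 + t *\<^sub>R axis j 1" for t
  have l0: "l 0 = \<nu>0" by (simp add: l_def)
  have "isCont l 0" unfolding l_def by (intro continuous_intros)
  then have "filterlim l (nhds \<nu>0) (nhds 0)" unfolding l0[symmetric] by (rule isCont_tendsto_nhds)
  from eventually_compose_filterlim[OF ev this]
  have evl: "\<forall>\<^sub>F t in nhds 0. g (l t) (Y (l t)) = 0 \<and> pseudospectral_abscissa w \<epsilon> (P (l t)) = Y (l t) $ 1" .
  obtain D1 where D1: "((\<lambda>t. Y (l t) $ 1) has_real_derivative D1) (at 0)"
    using real_analytic_at_imp_DERIV[OF Y(1)[rule_format, of 1], of j] unfolding l_def by blast
  obtain D2 where D2: "((\<lambda>t. Y (l t) $ 2) has_real_derivative D2) (at 0)"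
    using real_analytic_at_imp_DERIV[OF Y(1)[rule_format, of 2], of j] unfolding l_def by blast
  have y: "((\<lambda>t. Y (l t)) has_vector_derivative vector [D1, D2]) (at 0)"
    by (rule has_vector_derivative_vec2[OF D1 D2])
  obtain M' where M': "((\<lambda>t. M (l t)) has_vector_derivative M') (at 0)"
    using matrix_analytic_at_path[OF ana_le(1), of j] unfolding l_def by blast
  obtain C' where C': "((\<lambda>t. C (l t)) has_vector_derivative C') (at 0)"
    using matrix_analytic_at_path[OF ana_le(2), of j] unfolding l_def by blast
  obtain K' where K': "((\<lambda>t. K (l t)) has_vector_derivative K') (at 0)"
    using matrix_analytic_at_path[OF ana_le(3), of j] unfolding l_def by blast
  have "((\<lambda>t. P (l t) (cplx s0)) has_vector_derivative
      quad_poly M' C' K' (cplx s0) + cscale 0 (quad_poly' (M (l 0)) (C (l 0)) (cplx s0))) (at 0)"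
    by (rule quad_poly_path_derivative[OF M' C' K' has_vector_derivative_const])
  moreover have "cscale 0 (quad_poly' (M (l 0)) (C (l 0)) (cplx s0)) = 0"
    by (simp add: vec_eq_iff)
  ultimately have pd: "partial_derivative j (\<lambda>\<nu>. P \<nu> (cplx s0)) \<nu>0 = quad_poly M' C' K' (cplx s0)"
    unfolding partial_derivative_def l_def[symmetric] by (simp add: vector_derivative_at)
  have "(q has_derivative (\<lambda>h. q1 s0 * h $ 1 + q2 s0 * h $ 2)) (at (Y (l 0)))"
    using eventually_nhds_x_imp_x[OF q_deriv] by (simp add: l0 Y(2))
  from has_derivative_compose[OF y[unfolded has_vector_derivative_def] this]
  have "((\<lambda>t. q (Y (l t))) has_real_derivative q1 s0 * D1 + q2 s0 * D2) (at 0)"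
    unfolding has_field_derivative_def by (rule has_derivative_eq_rhs) (simp add: fun_eq_iff algebra_simps)
  moreover have "\<forall>\<^sub>F t in nhds 0. S (l t) (Y (l t)) = q (Y (l t))"
    using evl by eventually_elim (simp add: g_eq)
  \<comment> \<open>Differentiability of \<open>sigma_min\<close> along the curve, which
    \<open>sigma_min_quad_poly_path\<close> presupposes, is inherited from \<open>q\<close> through
    this identity.\<close>
  ultimately have d: "((\<lambda>t. S (l t) (Y (l t))) has_real_derivative q1 s0 * D1 + q2 s0 * D2) (at 0)"
    by (subst DERIV_cong_ev[OF refl _ refl])
  have "q1 s0 * D1 + q2 s0 * D2 = Re (sesq u (quad_poly M' C' K' (cplx s0)) v)
      + D1 * Re (sesq u (quad_poly' (M \<nu>0) (C \<nu>0) (cplx s0)) v)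
      - D2 * Im (sesq u (quad_poly' (M \<nu>0) (C \<nu>0) (cplx s0)) v)"
    using sigma_min_quad_poly_path[OF d _ _ M' C' K' y] uv q_pos S_eq_q by (simp add: l0 Y(2))
  also have "\<dots> = Re (sesq u (quad_poly M' C' K' (cplx s0)) v) + D1 * S1 s0 + D2 * S2 s0"
    by (simp add: S_partials[OF uv])
  finally have "D1 * (S1 s0 - q1 s0) = - Re (sesq u (quad_poly M' C' K' (cplx s0)) v)"
    using g2_zero by (simp add: algebra_simps)
  then have D1_eq: "D1 = - multiplier w \<epsilon> (P \<nu>0) * Re (sesq u (partial_derivative j (\<lambda>\<nu>. P \<nu> (cplx s0)) \<nu>0) v)"
    using g1_nz unfolding multiplier pd by (simp add: field_simps)
  have "\<forall>\<^sub>F t in nhds 0. pseudospectral_abscissa w \<epsilon> (P (l t)) = Y (l t) $ 1"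
    using evl by eventually_elim simp
  then have "((\<lambda>t. pseudospectral_abscissa w \<epsilon> (P (l t))) has_real_derivative D1) (at 0)"
    using D1 by (subst DERIV_cong_ev[OF refl _ refl])
  then show ?thesis unfolding D1_eq l_def .
qed

end

section \<open>Uniform boundedness and conclusion\<close>

lemma constraint_feasible_bounded:
  assumes "\<forall>\<^sub>F \<nu> in F. \<forall>z\<in>pseudospectrum w \<epsilon> (A \<nu>). cmod z \<le> R"
  shows "\<forall>\<^sub>F \<nu> in F. \<forall>s. constraint w \<epsilon> (A \<nu>) s \<le> 0 \<longrightarrow> norm s \<le> R"
  using assms
proof eventually_elim
  case (elim \<nu>)
  show ?case
  proof (intro allI impI)
    fix s assume "constraint w \<epsilon> (A \<nu>) s \<le> 0"
    then have "cplx s \<in> pseudospectrum w \<epsilon> (A \<nu>)"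
      by (simp add: pseudospectrum_def constraint_def cmod_cplx)
    then show "norm s \<le> R" using elim by (auto simp flip: cmod_cplx)
  qed
qed

text \<open>For \<open>w\<^sub>m = 0\<close> boundedness is required uniformly near
  \<open>\<nu>0\<close>, since a leading coefficient that vanishes at \<open>\<nu>0\<close> can send
  eigenvalues to infinity. An example with 1 x 1 matrices is \<nu> z^2 + z with weights (0, 0, 1):
  every pseudospectrum is bounded and \<nu> = 0 is non-degenerate, but for \<nu> < 0 the
  pseudospectrum contains -1/\<nu>, so the abscissa is unbounded near 0.\<close>

theorem theorem2p6:
  fixes \<Omega> \<Omega>' :: "(real^'d) set"
    and \<epsilon> w\<^sub>m w\<^sub>c w\<^sub>k :: real
    and nM nC nK :: nat
    and \<psi> \<zeta> \<kappa> :: "nat \<Rightarrow> real^'d \<Rightarrow> real"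
    and Mi Ci Ki :: "nat \<Rightarrow> complex^'n^'n"
    and M C K :: "real^'d \<Rightarrow> complex^'n^'n"
    and P :: "real^'d \<Rightarrow> complex \<Rightarrow> complex^'n^'n"
    and w :: "real \<times> real \<times> real"
    and \<alpha> :: "real^'d \<Rightarrow> real"
    and \<nu>0 :: "real^'d"
    and s :: "real^2"
  assumes Omega: "open \<Omega>" "compact \<Omega>'" "\<Omega>' \<subseteq> \<Omega>"
    and eps: "\<epsilon> > 0"
    and weights: "w\<^sub>m \<ge> 0" "w\<^sub>c \<ge> 0" "w\<^sub>k \<ge> 0" "w = (w\<^sub>m, w\<^sub>c, w\<^sub>k)"
    and analytic:
      "\<And>i. i < nM \<Longrightarrow> real_analytic_on (\<psi> i) \<Omega>"
      "\<And>i. i < nC \<Longrightarrow> real_analytic_on (\<zeta> i) \<Omega>"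
      "\<And>i. i < nK \<Longrightarrow> real_analytic_on (\<kappa> i) \<Omega>"
    and coefficients:
      "M = (\<lambda>\<nu>. \<Sum>i<nM. \<psi> i \<nu> *\<^sub>R Mi i)"
      "C = (\<lambda>\<nu>. \<Sum>i<nC. \<zeta> i \<nu> *\<^sub>R Ci i)"
      "K = (\<lambda>\<nu>. \<Sum>i<nK. \<kappa> i \<nu> *\<^sub>R Ki i)"
    and P: "P = (\<lambda>\<nu>. quad_poly (M \<nu>) (C \<nu>) (K \<nu>))"
    and alpha: "\<alpha> = (\<lambda>\<nu>. pseudospectral_abscissa w \<epsilon> (P \<nu>))"
    and bounded: "\<And>\<nu>. \<nu> \<in> \<Omega>' \<Longrightarrow> bounded (pseudospectrum w \<epsilon> (P \<nu>))"
    and bounded_at: "bounded (pseudospectrum w \<epsilon> (P \<nu>0))"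
    and bounded_near: "w\<^sub>m = 0 \<Longrightarrow>
      \<exists>\<delta>>0. bounded (\<Union>\<nu>\<in>ball \<nu>0 \<delta> \<inter> \<Omega>. pseudospectrum w \<epsilon> (P \<nu>))"
    and nu0: "\<nu>0 \<in> \<Omega>"
    and non_degenerate: "non_degenerate w \<epsilon> (P \<nu>0)"
    and s: "s = optimizer w \<epsilon> (P \<nu>0)"
    and p_w_nz: "p_w w (norm s) \<noteq> 0"
    and grad_nz: "gradient (constraint w \<epsilon> (P \<nu>0)) s \<noteq> 0"
  shows "real_analytic_at \<alpha> \<nu>0 \<and>
    (\<forall>u v. consistent_singular_vectors (P \<nu>0 (cplx s)) (sigma_min (P \<nu>0 (cplx s))) u v \<longrightarrow>
       multiplier w \<epsilon> (P \<nu>0) =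
         1 / (Re (sesq u (quad_poly' (M \<nu>0) (C \<nu>0) (cplx s)) v)
              - \<epsilon> * (s $ 1 / norm s) * deriv (p_w w) (norm s)) \<and>
       (\<forall>j. ((\<lambda>t. \<alpha> (\<nu>0 + t *\<^sub>R axis j 1)) has_real_derivative
               - multiplier w \<epsilon> (P \<nu>0) *
                 Re (sesq u (partial_derivative j (\<lambda>\<nu>. P \<nu> (cplx s)) \<nu>0) v)) (at 0)))"
proof -
  have analytic_MCK: "matrix_analytic_at M \<nu>0" "matrix_analytic_at C \<nu>0" "matrix_analytic_at K \<nu>0"
    unfolding coefficients using analytic nu0
    by (auto intro!: matrix_analytic_at_sum simp: real_analytic_on_def)
  have "\<exists>R. \<forall>\<^sub>F \<nu> in nhds \<nu>0. \<forall>z\<in>pseudospectrum w \<epsilon> (P \<nu>). cmod z \<le> R"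
  proof (cases "w\<^sub>m = 0")
    case True
    then obtain \<delta> where \<delta>: "\<delta> > 0" "bounded (\<Union>\<nu>\<in>ball \<nu>0 \<delta> \<inter> \<Omega>. pseudospectrum w \<epsilon> (P \<nu>))"
      using bounded_near by blast
    then obtain R where R: "\<And>z. z \<in> (\<Union>\<nu>\<in>ball \<nu>0 \<delta> \<inter> \<Omega>. pseudospectrum w \<epsilon> (P \<nu>)) \<Longrightarrow> cmod z \<le> R"
      unfolding bounded_iff by blast
    have "\<forall>\<^sub>F \<nu> in nhds \<nu>0. \<nu> \<in> ball \<nu>0 \<delta> \<inter> \<Omega>"
      by (rule eventually_nhds_in_open) (use Omega(1) nu0 \<delta>(1) in auto)
    then have "\<forall>\<^sub>F \<nu> in nhds \<nu>0. \<forall>z\<in>pseudospectrum w \<epsilon> (P \<nu>). cmod z \<le> R"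
      by eventually_elim (use R in blast)
    then show ?thesis by blast
  next
    case False
    then have wm: "w\<^sub>m > 0" using weights(1) by simp
    have "\<epsilon> * w\<^sub>m < sigma_min (M \<nu>0)"
      using bounded_pseudospectrum_sigma_min[OF eps wm] bounded_at unfolding weights(4) P by blast
    from eventually_bounded_pseudospectrum[OF weights(1-3) eps this analytic_MCK[THEN matrix_analytic_at_tendsto]]
    show ?thesis unfolding P weights(4) .
  qed
  then obtain R where R: "\<forall>\<^sub>F \<nu> in nhds \<nu>0. \<forall>z\<in>pseudospectrum w \<epsilon> (P \<nu>). cmod z \<le> R" by blast
  interpret nondegenerate_point w\<^sub>m w\<^sub>c w\<^sub>k \<epsilon> M C K \<nu>0 s R
  proof
    show "\<forall>\<^sub>F \<nu> in nhds \<nu>0. \<forall>s. constraint (w\<^sub>m, w\<^sub>c, w\<^sub>k) \<epsilon> (quad_poly (M \<nu>) (C \<nu>) (K \<nu>)) s \<le> 0 \<longrightarrow> norm s \<le> R"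
      using constraint_feasible_bounded[OF R] unfolding P weights(4) .
  qed (fact eps analytic_MCK non_degenerate[unfolded P weights(4)] s[unfolded P weights(4)]
      p_w_nz[unfolded weights(4)] grad_nz[unfolded P weights(4)])+
  show ?thesis
    unfolding alpha P weights(4)
    using abscissa_analytic multiplier_formula abscissa_partial_derivative by blast
qed

end
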